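(* Let $\lambda$ be a nonzero partition with $s$ distinct nonzero parts, let $(R_1,\dots,R_s)$ be its rectangular filtration, and put $f_i=Q_{R_i}$ ($1\le i\le s$), the dual Jack function of the rectangular partition $R_i$. Then there is $c'_\lambda(\alpha)\in\mathbb{Q}(\alpha)\setminus\{0\}$ such that $$Q_\lambda=c'_\lambda(\alpha)\,\Big(\cdots\big((f_s^{*}\cdot f_{s-1})^{*}\cdot f_{s-2}\big)^{*}\cdots\cdot f_2\Big)^{*}\cdot f_1 .$$ The right-hand side is computed from the inside out: first $g_{s-1}=f_s^*\cdot f_{s-1}$, then $g_{s-2}=g_{s-1}^*\cdot f_{s-2}$, and so on, ending with $g_1=g_2^*\cdot f_1$. For $s=1$ the expression is just $f_1$.
   Context: Let $\Lambda_F$ be the ring of symmetric functions over $F=\mathbb{Q}(\alpha)$, with $\alpha$ an indeterminate. It carries the scalar product $\langle p_\lambda,p_\mu\rangle=\delta_{\lambda\mu}z_\lambda\alpha^{l(\lambda)}$, where $p_\lambda$ are power sums and $z_\lambda=\prod_i i^{m_i}m_i!$. The Jack function $P_\lambda$ (parameter $\alpha$) is the unique symmetric function of the form $m_\lambda+\sum_{\mu<\lambda}c_{\lambda\mu}m_\mu$ (dominance order) such that the $P_\lambda$ are pairwise orthogonal. Set $Q_\lambda=\langle P_\lambda,P_\lambda\rangle^{-1}P_\lambda$. For a symmetric function $f$, $f^*$ denotes the adjoint, with respect to this scalar product, of the operator of multiplication by $f$. We write $f^*\cdot g$ for $f^*$ applied to $g$. For partitions, $(r^s)$ denotes the rectangle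 with $s$ parts equal to $r$. If $\nu\subset(r^s)$, write $\nu=(\nu_1,\dots,\nu_s)$ padded with zeros and define the complement $(r^s)-'\nu=(r-\nu_s,r-\nu_{s-1},\dots,r-\nu_1)$, with zero parts dropped. For a nonzero partition $\lambda$ put $\mathfrak{R}(\lambda)=(\lambda_1^{\,l(\lambda)})$ and $\mathfrak{C}(\lambda)=\mathfrak{R}(\lambda)-'\lambda$. If $\lambda$ has $s$ distinct nonzero parts, its rectangular filtration is $(R_1,\dots,R_s)$, where $R_i=\mathfrak{R}(\mathfrak{C}^{i-1}(\lambda))$ and $\mathfrak{C}^0(\lambda)=\lambda$. *)

theory Defs
  imports
    "HOL-Library.Multiset"
    "HOL-Computational_Algebra.Computational_Algebra"
begin

section \<open>The ring of symmetric functions\<close>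

text \<open>
  A monomial in the variables $x_0, x_1, x_2, \dots$ is encoded as the multiset of the indices of
  its variables, so that multiplication of monomials is addition of multisets, the degree is the
  size, and the exponent of $x_i$ is the multiplicity of $i$. A symmetric function is a formal
  series of bounded degree in these variables (given by its coefficients) which is invariant
  under permutations of the variables.
\<close>

typedef (overloaded) 'a symfun =
  "{f :: nat multiset \<Rightarrow> 'a::zero.
      (\<forall>\<pi> M. bij \<pi> \<longrightarrow> f (image_mset \<pi> M) = f M) \<and> (\<exists>d. \<forall>M. size M > d \<longrightarrow> f M = 0)}"
  morphisms coeff_sf Abs_symfun
  by (rule exI[of _ "\<lambda>_. 0"]) auto

setup_lifting type_definition_symfun

lemma symfun_eqI: "(\<And>M. coeff_sf f M = coeff_sf g M) \<Longrightarrow> f = g"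
  by transfer auto

lemma finite_submultisets: "finite {A. A \<subseteq># (M :: 'b multiset)}"
proof (induction M)
  case (add x M)
  have "{A. A \<subseteq># add_mset x M} \<subseteq> {A. A \<subseteq># M} \<union> add_mset x ` {A. A \<subseteq># M}"
  proof
    fix A assume A: "A \<in> {A. A \<subseteq># add_mset x M}"
    show "A \<in> {A. A \<subseteq># M} \<union> add_mset x ` {A. A \<subseteq># M}"
    proof (cases "x \<in># A")
      case True
      then obtain B where B: "A = add_mset x B" by (meson multi_member_split)
      with A show ?thesis by auto
    next
      case False
      with A show ?thesis by (auto simp: subseteq_mset_def not_in_iff split: if_splits) (metis count_add_mset le_less_Suc_eq zero_le not_in_iff)
    qed
  qed
  with add show ?case by (meson finite_UnI finite_imageI finite_subset)
qed simp

instantiation symfun :: (ab_group_add) ab_group_add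
begin

lift_definition zero_symfun :: "'a symfun" is "\<lambda>_. 0" by auto

lift_definition plus_symfun :: "'a symfun \<Rightarrow> 'a symfun \<Rightarrow> 'a symfun" is "\<lambda>f g M. f M + g M"
proof -
  fix f g :: "nat multiset \<Rightarrow> 'a"
  assume f: "(\<forall>\<pi> M. bij \<pi> \<longrightarrow> f (image_mset \<pi> M) = f M) \<and> (\<exists>d. \<forall>M. d < size M \<longrightarrow> f M = 0)"
    and g: "(\<forall>\<pi> M. bij \<pi> \<longrightarrow> g (image_mset \<pi> M) = g M) \<and> (\<exists>d. \<forall>M. d < size M \<longrightarrow> g M = 0)"
  obtain d e where "\<forall>M. d < size M \<longrightarrow> f M = 0" "\<forall>M. e < size M \<longrightarrow> g M = 0"
    using f g by blast
  then have "\<forall>M. max d e < size M \<longrightarrow> f M + g M = 0" by auto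
  then have "\<exists>d. \<forall>M. d < size M \<longrightarrow> f M + g M = 0" by blast
  moreover have "\<forall>\<pi> M. bij \<pi> \<longrightarrow> f (image_mset \<pi> M) + g (image_mset \<pi> M) = f M + g M"
    using f g by simp
  ultimately show "(\<forall>\<pi> M. bij \<pi> \<longrightarrow> f (image_mset \<pi> M) + g (image_mset \<pi> M) = f M + g M) \<and>
      (\<exists>d. \<forall>M. d < size M \<longrightarrow> f M + g M = 0)" by blast
qed

lift_definition uminus_symfun :: "'a symfun \<Rightarrow> 'a symfun" is "\<lambda>f M. - f M" by auto

definition minus_symfun :: "'a symfun \<Rightarrow> 'a symfun \<Rightarrow> 'a symfun" where
  "minus_symfun f g = f + - g"

instance
  by standard (unfold minus_symfun_def, (transfer, simp add: algebra_simps)+)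

end

instantiation symfun :: (comm_ring_1) comm_ring_1
begin

lift_definition one_symfun :: "'a symfun" is "\<lambda>M. if M = {#} then 1 else 0"
  by (auto intro!: exI[of _ 0])

lift_definition times_symfun :: "'a symfun \<Rightarrow> 'a symfun \<Rightarrow> 'a symfun" is
  "\<lambda>f g M. \<Sum>A | A \<subseteq># M. f A * g (M - A)"
proof -
  fix f g :: "nat multiset \<Rightarrow> 'a"
  assume f: "(\<forall>\<pi> M. bij \<pi> \<longrightarrow> f (image_mset \<pi> M) = f M) \<and> (\<exists>d. \<forall>M. d < size M \<longrightarrow> f M = 0)"
    and g: "(\<forall>\<pi> M. bij \<pi> \<longrightarrow> g (image_mset \<pi> M) = g M) \<and> (\<exists>d. \<forall>M. d < size M \<longrightarrow> g M = 0)"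
  have "(\<Sum>A | A \<subseteq># image_mset \<pi> M. f A * g (image_mset \<pi> M - A)) =
        (\<Sum>A | A \<subseteq># M. f A * g (M - A))" if \<pi>: "bij \<pi>" for \<pi> M
  proof -
    define \<rho> where "\<rho> = inv \<pi>"
    have inv: "image_mset \<rho> (image_mset \<pi> A) = A" "image_mset \<pi> (image_mset \<rho> A) = A" for A
      using \<pi> by (simp_all add: \<rho>_def multiset.map_comp bij_is_inj bij_is_surj comp_def surj_f_inv_f)
    show ?thesis
    proof (rule sum.reindex_bij_witness[where i = "image_mset \<pi>" and j = "image_mset \<rho>"])
      fix A assume A: "A \<in> {A. A \<subseteq># image_mset \<pi> M}"
      then show "image_mset \<rho> A \<in> {A. A \<subseteq># M}"
        using image_mset_subseteq_mono[of A "image_mset \<pi> M" \<rho>] by (simp add: inv)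
      then have "image_mset \<pi> M - A = image_mset \<pi> (M - image_mset \<rho> A)"
        by (simp add: image_mset_Diff inv)
      then show "f (image_mset \<rho> A) * g (M - image_mset \<rho> A) = f A * g (image_mset \<pi> M - A)"
        using f g \<pi> inv by metis
    qed (auto simp: inv image_mset_subseteq_mono)
  qed
  moreover obtain d e where d: "\<And>M. d < size M \<Longrightarrow> f M = 0" and e: "\<And>M. e < size M \<Longrightarrow> g M = 0"
    using f g by blast
  have "(\<Sum>A | A \<subseteq># M. f A * g (M - A)) = 0" if M: "d + e < size M" for M
  proof (rule sum.neutral, rule ballI)
    fix A assume "A \<in> {A. A \<subseteq># M}"
    then have "size M = size A + size (M - A)"
      by (metis mem_Collect_eq size_union subset_mset.add_diff_inverse)
    with M have "d < size A \<or> e < size (M - A)" by linarith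
    then show "f A * g (M - A) = 0" using d e by auto
  qed
  ultimately show "(\<forall>\<pi> M. bij \<pi> \<longrightarrow>
          (\<Sum>A | A \<subseteq># image_mset \<pi> M. f A * g (image_mset \<pi> M - A)) =
          (\<Sum>A | A \<subseteq># M. f A * g (M - A))) \<and>
        (\<exists>d. \<forall>M. d < size M \<longrightarrow> (\<Sum>A | A \<subseteq># M. f A * g (M - A)) = 0)" by blast
qed

instance
proof
  fix f g h :: "'a symfun"
  show comm: "f * g = g * f" for f g :: "'a symfun"
  proof (rule symfun_eqI)
    fix M :: "nat multiset"
    have "M - (M - A) = A" if "A \<subseteq># M" for A
      using that by (simp add: multiset_eq_iff subseteq_mset_def)
    then show "coeff_sf (f * g) M = coeff_sf (g * f) M"
      unfolding times_symfun.rep_eq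
      by (intro sum.reindex_bij_witness[where i = "\<lambda>A. M - A" and j = "\<lambda>A. M - A"])
         (simp_all add: mult.commute)
  qed
  show "f * g * h = f * (g * h)"
  proof (rule symfun_eqI)
    fix M
    have "coeff_sf (f * g * h) M =
        (\<Sum>(A, B) \<in> (SIGMA A:{A. A \<subseteq># M}. {B. B \<subseteq># A}).
            coeff_sf f B * coeff_sf g (A - B) * coeff_sf h (M - A))"
      by (simp add: times_symfun.rep_eq sum_distrib_right sum.Sigma finite_submultisets)
    also have "\<dots> = (\<Sum>(B, C) \<in> (SIGMA B:{B. B \<subseteq># M}. {C. C \<subseteq># M - B}).
            coeff_sf f B * (coeff_sf g C * coeff_sf h (M - B - C)))"
    proof (rule sum.reindex_bij_witness[where i = "\<lambda>(B, C). (B + C, B)"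
            and j = "\<lambda>(A, B). (B, A - B)"])
      fix a assume "a \<in> (SIGMA A:{A. A \<subseteq># M}. {B. B \<subseteq># A})"
      then obtain A B where a: "a = (A, B)" "A \<subseteq># M" "B \<subseteq># A" by auto
      show "(case case a of (A, B) \<Rightarrow> (B, A - B) of (B, C) \<Rightarrow> (B + C, B)) = a"
        using a by auto
      show "(case a of (A, B) \<Rightarrow> (B, A - B)) \<in> (SIGMA B:{B. B \<subseteq># M}. {C. C \<subseteq># M - B})"
        using a by (auto simp: subseteq_mset_def intro: order_trans diff_le_mono)
      show "(case case a of (A, B) \<Rightarrow> (B, A - B) of (B, C) \<Rightarrow>
              coeff_sf f B * (coeff_sf g C * coeff_sf h (M - B - C))) =
            (case a of (A, B) \<Rightarrow> coeff_sf f B * coeff_sf g (A - B) * coeff_sf h (M - A))"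
        using a by (simp add: mult.assoc)
    next
      fix b assume "b \<in> (SIGMA B:{B. B \<subseteq># M}. {C. C \<subseteq># M - B})"
      then obtain B C where b: "b = (B, C)" "B \<subseteq># M" "C \<subseteq># M - B" by auto
      show "(case case b of (B, C) \<Rightarrow> (B + C, B) of (A, B) \<Rightarrow> (B, A - B)) = b"
        using b by auto
      show "(case b of (B, C) \<Rightarrow> (B + C, B)) \<in> (SIGMA A:{A. A \<subseteq># M}. {B. B \<subseteq># A})"
        using b by (auto simp: subset_mset.le_diff_conv2 add.commute)
    qed
    also have "\<dots> = coeff_sf (f * (g * h)) M"
      by (simp add: times_symfun.rep_eq sum_distrib_left sum.Sigma finite_submultisets)
    finally show "coeff_sf (f * g * h) M = coeff_sf (f * (g * h)) M" .
  qed
  show "1 * f = f"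
  proof (rule symfun_eqI)
    fix M
    have "coeff_sf (1 * f) M =
        (\<Sum>A | A \<subseteq># M. if A = {#} then coeff_sf f M else 0)"
      unfolding times_symfun.rep_eq one_symfun.rep_eq by (rule sum.cong) auto
    then show "coeff_sf (1 * f) M = coeff_sf f M"
      by (simp add: sum.delta finite_submultisets)
  qed
  show "(f + g) * h = f * h + g * h"
    by (rule symfun_eqI)
       (simp add: times_symfun.rep_eq plus_symfun.rep_eq distrib_right sum.distrib)
  show "(0 :: 'a symfun) \<noteq> 1"
    by transfer (metis zero_neq_one)
qed

end

lift_definition scale_sf :: "'a::comm_ring_1 \<Rightarrow> 'a symfun \<Rightarrow> 'a symfun" is "\<lambda>c f M. c * f M"
  by (metis mult_zero_right)

lemma vector_space_symfun: "vector_space (scale_sf :: 'a::field \<Rightarrow> 'a symfun \<Rightarrow> 'a symfun)"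
  by standard (transfer, simp add: algebra_simps)+


section \<open>Partitions\<close>

text \<open>A partition is the weakly decreasing list of its nonzero parts.\<close>

definition is_partition :: "nat list \<Rightarrow> bool" where
  "is_partition lam \<longleftrightarrow> sorted_wrt (\<ge>) lam \<and> 0 \<notin> set lam"

definition dominates :: "nat list \<Rightarrow> nat list \<Rightarrow> bool" where
  "dominates lam \<mu> \<longleftrightarrow>
     sum_list lam = sum_list \<mu> \<and> (\<forall>k. sum_list (take k \<mu>) \<le> sum_list (take k lam))"

definition z_part :: "nat list \<Rightarrow> nat" where
  "z_part lam = (\<Prod>i\<in>set lam. i ^ count_list lam i * fact (count_list lam i))"

text \<open>
  The complement $(r^s) -' \nu$. It is only meaningful if $\nu$ is contained in $(r^s)$, i.e. if
  $\nu$ has at most $s$ parts and all of them are at most $r$.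
\<close>

definition rect_compl :: "nat \<Rightarrow> nat \<Rightarrow> nat list \<Rightarrow> nat list" where
  "rect_compl r s \<nu> =
     filter (\<lambda>x. x \<noteq> 0) (map (\<lambda>x. r - x) (rev (\<nu> @ replicate (s - length \<nu>) 0)))"

definition rect_hull :: "nat list \<Rightarrow> nat list" where
  "rect_hull lam = replicate (length lam) (hd lam)"

definition hull_compl :: "nat list \<Rightarrow> nat list" where
  "hull_compl lam = rect_compl (hd lam) (length lam) lam"

text \<open>
  Passing to the complement removes exactly one distinct part, so every iterate used below is
  a nonzero partition.
\<close>

definition rect_filtration :: "nat list \<Rightarrow> nat list list" where
  "rect_filtration lam = map (\<lambda>i. rect_hull ((hull_compl ^^ i) lam)) [0..<card (set lam)]"


section \<open>Monomial and power sum symmetric functions\<close>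

text \<open>The multiset of the nonzero exponents of a monomial.\<close>

definition exponents :: "nat multiset \<Rightarrow> nat multiset" where
  "exponents M = image_mset (count M) (mset_set (set_mset M))"

lemma size_exponents: "sum_mset (exponents M) = size M"
  by (simp add: exponents_def size_multiset_overloaded_eq sum_unfold_sum_mset)

lemma exponents_image_mset:
  assumes "bij \<pi>"
  shows "exponents (image_mset \<pi> M) = exponents M"
proof -
  have inj: "inj \<pi>" using assms by (rule bij_is_inj)
  have "mset_set (\<pi> ` set_mset M) = image_mset \<pi> (mset_set (set_mset M))"
    by (simp add: image_mset_mset_set inj_on_subset[OF inj])
  moreover have "count (image_mset \<pi> M) (\<pi> x) = count M x" for x
    proof -
    have "\<pi> -` {\<pi> x} = {x}" using inj by (auto dest: injD)
    then show ?thesis by (cases "x \<in># M") (simp_all add: count_image_mset not_in_iff)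
  qed
  ultimately show ?thesis
    by (simp add: exponents_def multiset.map_comp comp_def)
qed

lift_definition monomial_sf :: "nat list \<Rightarrow> 'a::comm_ring_1 symfun" is
  "\<lambda>lam M. if exponents M = mset lam then 1 else 0"
proof -
  fix lam :: "nat list"
  have "size M = sum_list lam" if "exponents M = mset lam" for M
    using that size_exponents[of M] by (simp add: sum_mset_sum_list)
  then show "(\<forall>\<pi> M. bij \<pi> \<longrightarrow> (if exponents (image_mset \<pi> M) = mset lam then 1 else (0::'a)) =
               (if exponents M = mset lam then 1 else 0)) \<and>
             (\<exists>d. \<forall>M. d < size M \<longrightarrow> (if exponents M = mset lam then 1 else (0::'a)) = 0)"
    by (auto simp: exponents_image_mset intro!: exI[of _ "sum_list lam"])
qed

lift_definition power_sum :: "nat \<Rightarrow> 'a::comm_ring_1 symfun" is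
  "\<lambda>k M. if \<exists>i. M = replicate_mset k i then 1 else 0"
proof -
  fix k :: nat
  have "(\<exists>i. image_mset \<pi> M = replicate_mset k i) \<longleftrightarrow> (\<exists>i. M = replicate_mset k i)"
    if \<pi>: "bij \<pi>" for \<pi> :: "nat \<Rightarrow> nat" and M
  proof
    assume "\<exists>i. image_mset \<pi> M = replicate_mset k i"
    then obtain i where "image_mset \<pi> M = replicate_mset k i" by blast
    then have "image_mset (inv \<pi>) (image_mset \<pi> M) = replicate_mset k (inv \<pi> i)" by simp
    then have "M = replicate_mset k (inv \<pi> i)"
      using \<pi> by (simp add: multiset.map_comp bij_is_inj)
    then show "\<exists>i. M = replicate_mset k i" by blast
  qed auto
  then show "(\<forall>(\<pi> :: nat \<Rightarrow> nat) M. bij \<pi> \<longrightarrow>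
                (if \<exists>i. image_mset \<pi> M = replicate_mset k i then 1 else (0::'a)) =
                (if \<exists>i. M = replicate_mset k i then 1 else 0)) \<and>
             (\<exists>d. \<forall>M :: nat multiset. d < size M \<longrightarrow>
                (if \<exists>i. M = replicate_mset k i then 1 else (0::'a)) = 0)"
    by (intro conjI allI impI exI[of _ k]) auto
qed

definition power_sum_part :: "nat list \<Rightarrow> 'a::comm_ring_1 symfun" where
  "power_sum_part lam = prod_list (map power_sum lam)"


section \<open>The scalar product and Jack functions\<close>

text \<open>The field of rational functions in the indeterminate $\alpha$ with rational coefficients.\<close>

type_synonym ratfun = "rat poly fract"

definition jack_param :: ratfun where
  "jack_param = Fract [:0, 1:] 1"

text \<open>
  The power sums indexed by partitions form a basis, so there is exactly one bilinear form with
  the prescribed values on them.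
\<close>

definition jack_inner :: "ratfun symfun \<Rightarrow> ratfun symfun \<Rightarrow> ratfun" where
  "jack_inner = (THE B.
     (\<forall>g. Vector_Spaces.linear scale_sf (*) (\<lambda>f. B f g)) \<and>
     (\<forall>f. Vector_Spaces.linear scale_sf (*) (\<lambda>g. B f g)) \<and>
     (\<forall>lam \<mu>. is_partition lam \<longrightarrow> is_partition \<mu> \<longrightarrow>
        B (power_sum_part lam) (power_sum_part \<mu>) =
          (if lam = \<mu> then of_nat (z_part lam) * jack_param ^ length lam else 0)))"

definition mult_adjoint :: "ratfun symfun \<Rightarrow> ratfun symfun \<Rightarrow> ratfun symfun" where
  "mult_adjoint f = (THE T. \<forall>g h. jack_inner (T g) h = jack_inner g (f * h))"

text \<open>
  The defining property of the family of Jack functions $(P_\lambda)_\lambda$. The values at lists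
  that are not partitions are irrelevant. For each partition the sum has finitely many terms, since
  dominance only compares partitions of the same size.
\<close>

definition is_jack_family :: "(nat list \<Rightarrow> ratfun symfun) \<Rightarrow> bool" where
  "is_jack_family P \<longleftrightarrow>
     (\<forall>lam. is_partition lam \<longrightarrow>
        (\<exists>c. P lam = monomial_sf lam +
           (\<Sum>\<mu> | is_partition \<mu> \<and> dominates lam \<mu> \<and> \<mu> \<noteq> lam. scale_sf (c \<mu>) (monomial_sf \<mu>)))) \<and>
     (\<forall>lam \<mu>. is_partition lam \<longrightarrow> is_partition \<mu> \<longrightarrow> lam \<noteq> \<mu> \<longrightarrow> jack_inner (P lam) (P \<mu>) = 0)"

definition jack_dual :: "(nat list \<Rightarrow> ratfun symfun) \<Rightarrow> nat list \<Rightarrow> ratfun symfun" where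
  "jack_dual P lam = scale_sf (inverse (jack_inner (P lam) (P lam))) (P lam)"

text \<open>
  For $f_1, \dots, f_s$ with $s \ge 1$, the element $g_1$ determined by $g_s = f_s$ and
  $g_i = g_{i+1}^* \cdot f_i$. The value for the empty list is never used.
\<close>

fun nested_adjoint :: "ratfun symfun list \<Rightarrow> ratfun symfun" where
  "nested_adjoint [] = 1"
| "nested_adjoint [f] = f"
| "nested_adjoint (f # f' # fs) = mult_adjoint (nested_adjoint (f' # fs)) f"

end

theory Submission
  imports Defs "HOL-Combinatorics.Permutations"
begin

text \<open>
  Let $R=(r^n)$ and $\nu\subseteq R$. The theorem follows by induction on the number of distinct
  parts once $Q_\nu^* Q_R$ is known to be a nonzero multiple of $Q_{R-'\nu}$, that is, once
  $\langle P_\mu P_\nu, P_R\rangle$ is known to be nonzero exactly for $\mu = R-'\nu$.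

  In $n$ variables $(x_1\cdots x_n)^r P_\nu(x^{-1}) = P_{R-'\nu}(x)$, since both sides are
  eigenfunctions of the Laplace--Beltrami operator with the same leading monomial. Reflecting the
  structure constants in this way turns the bound $\mu\cup(1^k)\le\lambda$ for the Jack functions
  $P_\lambda$ occurring in $P_{(1^k)}P_\mu$, a consequence of duality of bases, into a bound on the
  last parts of $\lambda$. By induction, removing the first column of $\nu$,
  $\langle P_\mu P_\nu, P_R\rangle\neq 0$ then implies $R-'\mu\le\nu$, and by symmetry
  $R-'\nu\le\mu$, so that $\mu=R-'\nu$.
  For the nonvanishing, the functions annihilated by the pairing with $P_R$ form an ideal, and
  $P_{\nu\cup\sigma}$ occurs in $P_\nu P_\sigma$; hence it is enough to treat $\nu$ with exactly $n$
  parts, whose complement fits into the narrower rectangle $((r-1)^n)$.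

  Partitions are handled as multisets of positive parts. Dominance is expressed by the functions
  $t\mapsto\sum_i\max(\lambda_i-t,0)$, which are additive under union of partitions.
\<close>

section \<open>Dominance and complements of partitions\<close>

text \<open>A Jack family is given only by triangularity and orthogonality, so constants stay
  implicit: each step about products merely decides whether some pairing <P_N P_M, P_L> vanishes.
  The Laplace-Beltrami operator is used in two guises. In power sums it is visibly self-adjoint; on
  monomials in n variables it is visibly triangular and compatible with x_i |-> 1/x_i. Passing to n
  variables destroys all information on partitions with more than n parts. This does no harm to a
  pairing with P_L when L has at most n parts, because every partition above L in dominance again
  has at most n parts. The step to a narrower rectangle in the nonvanishing part comes from
  reflecting the two factors in boxes of different widths. Let N' be the complement of N in (r^n).
  Reflecting N in width r + 1 and N' in width r turns <P_N P_N', P_(r^n)> into the pairing of N and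
  its complement in ((r+1)^n) against P of ((r+1)^n), since (r^n) and ((r+1)^n) are complementary in
  width 2r + 1.\<close>

definition excess :: "nat \<Rightarrow> nat multiset \<Rightarrow> nat" where
  "excess t A = (\<Sum>a\<in>#A. a - t)"

text \<open>The smaller partition is the first argument, in contrast to \<open>dominates\<close>. As
  \<open>excess t\<close> counts the cells of the diagram beyond column t, the inequalities are
  those of the conjugate partitions, read from the tail.\<close>

definition dom_le :: "nat multiset \<Rightarrow> nat multiset \<Rightarrow> bool" where
  "dom_le A B \<longleftrightarrow> sum_mset A = sum_mset B \<and> (\<forall>t. excess t A \<le> excess t B)"

text \<open>A numerical shadow of dominance, strictly increasing along it. It is the measure for
  inductions over dominance and also the part of the eigenvalue that carries \<alpha>.\<close>

definition sumsq :: "nat multiset \<Rightarrow> nat" where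
  "sumsq A = (\<Sum>a\<in>#A. a\<^sup>2)"

lemma excess_simps [simp]:
  "excess t {#} = 0" "excess t (add_mset a A) = (a - t) + excess t A" "excess t (A + B) = excess t A + excess t B"
  "excess t (replicate_mset k a) = k * (a - t)"
  by (simp_all add: excess_def)

lemma excess_0 [simp]: "excess 0 A = sum_mset A"
  by (simp add: excess_def)

lemma excess_mono: "A \<subseteq># B \<Longrightarrow> excess t A \<le> excess t B"
  by (metis le_add1 excess_simps(3) subset_mset.add_diff_inverse)

lemma excess_eq_0_iff: "excess t A = 0 \<longleftrightarrow> (\<forall>a\<in>#A. a \<le> t)"
  by (simp add: excess_def)

lemma excess_1: "0 \<notin># A \<Longrightarrow> excess (Suc 0) A + size A = sum_mset A"
  by (induction A) auto

text \<open>Each part a contributes t |-> max(a - t, 0), piecewise linear with its only kink at t =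
  a. The second difference counts the parts at the kink, so the excesses determine all
  multiplicities.\<close>

lemma excess_second_difference: "excess t A + excess (t + 2) A = 2 * excess (t + 1) A + count A (t + 1)"
proof (induction A)
  case (add a A)
  have "(a - t) + (a - (t + 2)) = 2 * (a - (t + 1)) + (if a = t + 1 then 1 else 0)"
    by auto
  with add show ?case by (simp split: if_splits)
qed simp

lemma multiset_eqI_excess:
  assumes "0 \<notin># A" "0 \<notin># B" "\<And>t. excess t A = excess t B"
  shows "A = B"
proof (rule multiset_eqI)
  fix k
  show "count A k = count B k"
  proof (cases k)
    case 0
    with assms show ?thesis by (simp add: not_in_iff)
  next
    case (Suc t)
    then show ?thesis
      using excess_second_difference[of t A] excess_second_difference[of t B] assms(3) by simp
  qed
qed

lemma dom_le_refl [simp]: "dom_le A A"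
  by (simp add: dom_le_def)

lemma dom_le_trans [trans]: "dom_le A B \<Longrightarrow> dom_le B C \<Longrightarrow> dom_le A C"
  unfolding dom_le_def by (metis order_trans)

lemma dom_le_antisym:
  assumes "0 \<notin># A" "0 \<notin># B" "dom_le A B" "dom_le B A"
  shows "A = B"
  using assms by (intro multiset_eqI_excess) (auto simp: dom_le_def intro: antisym)

lemma dom_le_sum: "dom_le A B \<Longrightarrow> sum_mset A = sum_mset B"
  by (simp add: dom_le_def)

lemma dom_le_excess: "dom_le A B \<Longrightarrow> excess t A \<le> excess t B"
  by (simp add: dom_le_def)

text \<open>At t = 1 the excess is the weight minus the number of parts, so going up in dominance
  cannot create parts.\<close>

lemma dom_le_size:
  assumes "dom_le A B" "0 \<notin># A" "0 \<notin># B"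
  shows "size B \<le> size A"
  using excess_1[OF assms(2)] excess_1[OF assms(3)] dom_le_sum[OF assms(1)] dom_le_excess[OF assms(1), of "Suc 0"]
  by linarith

lemma dom_le_bound: "dom_le A B \<Longrightarrow> (\<forall>b\<in>#B. b \<le> r) \<Longrightarrow> (\<forall>a\<in>#A. a \<le> r)"
  using dom_le_excess[of A B r] excess_eq_0_iff[of r B] excess_eq_0_iff[of r A] by auto

text \<open>Since $a^2 + a = 2\sum_{t<a}(a-t)$, dominance is reflected in the sum of squares.\<close>
lemma sumsq_excess:
  assumes "\<forall>a\<in>#A. a \<le> T"
  shows "sumsq A + sum_mset A = 2 * (\<Sum>t<T. excess t A)"
  using assms
proof (induction A)
  case (add a A)
  have gen: "2 * (\<Sum>t<S. a - t) = a\<^sup>2 + a" if "a \<le> S" for S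
  proof -
    have "(\<Sum>t<S. a - t) = (\<Sum>t<a. a - t)"
      using that by (intro sum.mono_neutral_right) auto
    also have "\<dots> = (\<Sum>t<a. Suc t)"
      by (rule sum.reindex_bij_witness[of _ "\<lambda>t. a - Suc t" "\<lambda>t. a - Suc t"]) auto
    also have "2 * \<dots> = a\<^sup>2 + a"
      by (induction a) (auto simp: power2_eq_square)
    finally show ?thesis .
  qed
  from add gen[of T] show ?case
    by (simp add: sumsq_def sum.distrib distrib_left)
qed (simp add: sumsq_def)

lemma dom_le_sumsq:
  assumes "dom_le A B"
  shows "sumsq A \<le> sumsq B"
    and "0 \<notin># A \<Longrightarrow> 0 \<notin># B \<Longrightarrow> A \<noteq> B \<Longrightarrow> sumsq A < sumsq B"
proof -
  define T where "T = sum_mset A"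
  have bd: "\<forall>a\<in>#A. a \<le> T" "\<forall>a\<in>#B. a \<le> T"
    using dom_le_sum[OF assms] sum_mset.remove unfolding T_def by (metis le_add1)+
  note eqs = sumsq_excess[OF bd(1)] sumsq_excess[OF bd(2)]
  have "(\<Sum>t<T. excess t A) \<le> (\<Sum>t<T. excess t B)"
    by (intro sum_mono dom_le_excess[OF assms])
  with eqs dom_le_sum[OF assms] show "sumsq A \<le> sumsq B" by linarith
  assume *: "0 \<notin># A" "0 \<notin># B" "A \<noteq> B"
  then obtain t where t: "excess t A \<noteq> excess t B" using multiset_eqI_excess by metis
  then have "excess t A < excess t B" using dom_le_excess[OF assms, of t] by simp
  \<comment> \<open>T bounds all parts on both sides, hence both excesses vanish from T on and the
    strict inequality lies inside the range of summation.\<close>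
  moreover have "t < T"
  proof (rule ccontr)
    assume "\<not> t < T"
    then have "excess t B = 0" using bd by (auto simp: excess_eq_0_iff)
    with t dom_le_excess[OF assms, of t] show False by simp
  qed
  ultimately have "(\<Sum>t<T. excess t A) < (\<Sum>t<T. excess t B)"
    by (intro sum_strict_mono_ex1) (auto intro: dom_le_excess[OF assms])
  with eqs dom_le_sum[OF assms] show "sumsq A < sumsq B" by linarith
qed

section \<open>Translation between partitions as lists and as multisets\<close>

definition part_list :: "nat multiset \<Rightarrow> nat list" where
  "part_list A = rev (sorted_list_of_multiset A)"

lemma mset_part_list [simp]: "mset (part_list A) = A"
  by (simp add: part_list_def)

lemma length_part_list [simp]: "length (part_list A) = size A"
  by (metis mset_part_list size_mset)

lemma is_partition_part_list: "is_partition (part_list A) \<longleftrightarrow> 0 \<notin># A"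
  by (simp add: is_partition_def part_list_def sorted_wrt_rev)

lemma part_list_mset: "is_partition l \<Longrightarrow> part_list (mset l) = l"
proof -
  assume "is_partition l"
  then have "sorted (rev l)" by (simp add: is_partition_def sorted_wrt_rev)
  then have "sort l = rev l" by (metis mset_rev properties_for_sort)
  then show ?thesis by (simp add: part_list_def)
qed

lemma part_list_inject [simp]: "part_list A = part_list B \<longleftrightarrow> A = B"
  by (metis mset_part_list)

text \<open>Each entry satisfies x \<le> (x - t) + t with truncated subtraction. With the lemma
  below, \<open>excess t\<close> becomes the Legendre transform of the partial sums: the maximum
  over j of the sum of the first j parts minus j times t.\<close>

lemma sum_list_take_le_excess: "sum_list (take j l) \<le> excess t (mset l) + j * t"
proof (induction l arbitrary: j)
  case (Cons x l)
  show ?case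
  proof (cases j)
    case (Suc i)
    then show ?thesis using Cons[of i] by simp
  qed simp
qed simp

text \<open>The maximum is attained at the number j of parts that exceed t.\<close>

lemma excess_eq_sum_list_take:
  assumes "sorted_wrt (\<ge>) l"
  shows "\<exists>j. excess t (mset l) + j * t = sum_list (take j l)"
  using assms
proof (induction l)
  case (Cons x l)
  show ?case
  proof (cases "t < x")
    case True
    from Cons obtain j where "excess t (mset l) + j * t = sum_list (take j l)" by auto
    with True show ?thesis by (intro exI[of _ "Suc j"]) simp
  next
    case False
    with Cons.prems have "excess t (mset (x # l)) = 0" by (auto simp: excess_def)
    then show ?thesis by (intro exI[of _ 0]) simp
  qed
qed simp

text \<open>The index j that is optimal for \<open>mu\<close> is an admissible choice for
  \<open>lam\<close>.\<close>

lemma dominates_imp_dom_le: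
  assumes "is_partition lam" "is_partition mu" "dominates lam mu"
  shows "dom_le (mset mu) (mset lam)"
  unfolding dom_le_def
proof (intro conjI allI)
  show "sum_mset (mset mu) = sum_mset (mset lam)"
    using assms by (simp add: dominates_def sum_mset_sum_list)
  fix t
  obtain j where j: "excess t (mset mu) + j * t = sum_list (take j mu)"
    using excess_eq_sum_list_take[of mu t] assms by (auto simp: is_partition_def)
  have "sum_list (take j mu) \<le> sum_list (take j lam)"
    using assms by (simp add: dominates_def)
  also have "\<dots> \<le> excess t (mset lam) + j * t" by (rule sum_list_take_le_excess)
  finally show "excess t (mset mu) \<le> excess t (mset lam)" using j by simp
qed

text \<open>In \<open>inbox\<close> and \<open>rcompl\<close> the number n of rows precedes the
  width r, whereas \<open>rect_compl\<close> takes the width first.\<close>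

definition inbox :: "nat \<Rightarrow> nat \<Rightarrow> nat multiset \<Rightarrow> bool" where
  "inbox n r A \<longleftrightarrow> 0 \<notin># A \<and> size A \<le> n \<and> (\<forall>a\<in>#A. a \<le> r)"

definition rcompl :: "nat \<Rightarrow> nat \<Rightarrow> nat multiset \<Rightarrow> nat multiset" where
  "rcompl n r A = filter_mset (\<lambda>x. x \<noteq> 0) (image_mset (\<lambda>a. r - a) A + replicate_mset (n - size A) r)"

lemma excess_filter_nonzero [simp]: "excess t (filter_mset (\<lambda>x. x \<noteq> 0) A) = excess t A"
  by (induction A) auto

lemma excess_rcompl: "excess t (rcompl n r A) = (\<Sum>a\<in>#A. r - a - t) + (n - size A) * (r - t)"
  unfolding rcompl_def excess_filter_nonzero excess_simps
  by (simp add: excess_def multiset.map_comp comp_def)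

lemma zero_notin_rcompl [simp]: "0 \<notin># rcompl n r A"
  by (simp add: rcompl_def)

lemma inbox_rcompl: "inbox n r A \<Longrightarrow> inbox n r (rcompl n r A)"
proof -
  assume "inbox n r A"
  then have "size (image_mset (\<lambda>a. r - a) A + replicate_mset (n - size A) r) = n"
    by (simp add: inbox_def)
  then have "size (rcompl n r A) \<le> n"
    unfolding rcompl_def by (metis size_filter_mset_lesseq)
  then show ?thesis by (auto simp: inbox_def rcompl_def)
qed

text \<open>Termwise this is max(x, 0) = x + max(-x, 0) with x = r - t - a. Complementation reflects
  the parameter t to r - t and otherwise changes the excess only by terms depending on n, r, t and
  the weight.\<close>

lemma excess_rcompl_eq:
  assumes "inbox n r A" "t \<le> r"
  shows "excess t (rcompl n r A) + sum_mset A = excess (r - t) A + n * (r - t)"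
proof -
  have "(\<Sum>a\<in>#A. r - a - t) + sum_mset A = excess (r - t) A + size A * (r - t)"
  proof (induction A)
    case (add a A)
    have "(r - a - t) + a = (a - (r - t)) + (r - t)" using assms(2) by auto
    with add show ?case by simp
  qed simp
  moreover have "size A * (r - t) + (n - size A) * (r - t) = n * (r - t)"
    using assms(1) by (metis add_mult_distrib inbox_def le_add_diff_inverse)
  ultimately show ?thesis unfolding excess_rcompl by linarith
qed

lemma excess_rcompl_ge: "r \<le> t \<Longrightarrow> excess t (rcompl n r A) = 0"
  by (auto simp: excess_eq_0_iff rcompl_def)

lemma inbox_excess_ge: "inbox n r A \<Longrightarrow> r \<le> t \<Longrightarrow> excess t A = 0"
  by (auto simp: excess_eq_0_iff inbox_def)

lemma sum_rcompl: "inbox n r A \<Longrightarrow> sum_mset (rcompl n r A) + sum_mset A = n * r"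
  using excess_rcompl_eq[of n r A 0] inbox_excess_ge[of n r A r] by simp

lemma rcompl_rcompl: assumes "inbox n r A" shows "rcompl n r (rcompl n r A) = A"
proof (rule multiset_eqI_excess)
  fix t
  show "excess t (rcompl n r (rcompl n r A)) = excess t A"
  proof (cases "t \<le> r")
    case True
    define N where "N = n * (r - t)"
    define N' where "N' = n * t"
    have "N + N' = n * r" using True unfolding N_def N'_def by (metis add.commute add_mult_distrib2 le_add_diff_inverse)
    then show ?thesis
      using excess_rcompl_eq[OF inbox_rcompl[OF assms] True] excess_rcompl_eq[OF assms, of "r - t"] sum_rcompl[OF assms] True
      unfolding N_def[symmetric] by (simp add: N'_def[symmetric])
  qed (simp add: excess_rcompl_ge inbox_excess_ge[OF assms])
qed (use assms in \<open>auto simp: inbox_def\<close>)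

text \<open>The correction terms in \<open>excess_rcompl_eq\<close> agree for partitions of equal
  weight, so complementation preserves dominance rather than reversing it.\<close>

lemma dom_le_rcompl:
  assumes "inbox n r A" "inbox n r B" "dom_le A B"
  shows "dom_le (rcompl n r A) (rcompl n r B)"
  unfolding dom_le_def
proof (intro conjI allI)
  show "sum_mset (rcompl n r A) = sum_mset (rcompl n r B)"
    using sum_rcompl[OF assms(1)] sum_rcompl[OF assms(2)] dom_le_sum[OF assms(3)] by simp
  fix t
  show "excess t (rcompl n r A) \<le> excess t (rcompl n r B)"
  proof (cases "t \<le> r")
    case True
    then show ?thesis
      using excess_rcompl_eq[OF assms(1) True] excess_rcompl_eq[OF assms(2) True] dom_le_sum[OF assms(3)]
        dom_le_excess[OF assms(3), of "r - t"] by linarith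
  qed (simp add: excess_rcompl_ge)
qed

text \<open>Widening the box by one column puts a column of height n in front of the complement,
  which shifts every positive parameter by one.\<close>

lemma excess_rcompl_Suc: "0 < s \<Longrightarrow> inbox n r A \<Longrightarrow> excess s (rcompl n (Suc r) A) = excess (s - 1) (rcompl n r A)"
proof -
  assume s: "0 < s" and A: "inbox n r A"
  then have "(\<Sum>a\<in>#A. Suc r - a - s) = (\<Sum>a\<in>#A. r - a - (s - 1))"
    by (intro arg_cong[where f = sum_mset] image_mset_cong) (auto simp: inbox_def)
  with s show ?thesis by (simp add: excess_rcompl)
qed

section \<open>Coefficients of symmetric functions\<close>

lemma coeff_0 [simp]: "coeff_sf 0 M = 0"
  by (simp add: zero_symfun.rep_eq)

lemma coeff_add [simp]: "coeff_sf (f + g) M = coeff_sf f M + coeff_sf g M"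
  by (simp add: plus_symfun.rep_eq)

lemma coeff_uminus [simp]: "coeff_sf (- f) M = - coeff_sf f M"
  by (simp add: uminus_symfun.rep_eq)

lemma coeff_diff [simp]: "coeff_sf (f - g) M = coeff_sf f M - coeff_sf g M"
  unfolding minus_symfun_def coeff_add coeff_uminus by (rule add_uminus_conv_diff)

lemma coeff_scale [simp]: "coeff_sf (scale_sf c f) M = c * coeff_sf f M"
  by (simp add: scale_sf.rep_eq)

lemma coeff_sum [simp]: "coeff_sf (sum f S) M = (\<Sum>x\<in>S. coeff_sf (f x) M)"
  by (induction S rule: infinite_finite_induct) auto

lemma coeff_1: "coeff_sf 1 M = (if M = {#} then 1 else 0)"
  by (simp add: one_symfun.rep_eq)

lemma coeff_mult: "coeff_sf (f * g) M = (\<Sum>A | A \<subseteq># M. coeff_sf f A * coeff_sf g (M - A))"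
  by (simp add: times_symfun.rep_eq)

lemma scale_mult_left: "scale_sf c f * g = scale_sf c (f * g)"
  by (rule symfun_eqI) (simp add: coeff_mult sum_distrib_left mult.assoc)

lemma scale_mult_right: "f * scale_sf c g = scale_sf c (f * g)"
  by (metis scale_mult_left mult.commute)

lemma coeff_bounded:
  obtains D where "\<And>M. size M > D \<Longrightarrow> coeff_sf f M = 0"
proof -
  have "\<exists>d. \<forall>M. size M > d \<longrightarrow> coeff_sf f M = 0" using coeff_sf[of f] by simp
  then show thesis using that by blast
qed

lemma coeff_image_bij: "bij \<pi> \<Longrightarrow> coeff_sf f (image_mset \<pi> M) = coeff_sf f M"
  using coeff_sf[of f] by simp

lemma zero_notin_exponents [simp]: "0 \<notin># exponents M"
  by (auto simp: exponents_def) (metis not_in_iff)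

lemma size_exponents_card: "size (exponents M) = card (set_mset M)"
  by (simp add: exponents_def)

text \<open>The zeros stand for variables of I that do not divide the monomial. Complementation has
  to see them, since it turns them into full rows.\<close>

lemma image_count_mset_set:
  assumes "finite I" "set_mset M \<subseteq> I"
  shows "image_mset (count M) (mset_set I) =
    exponents M + replicate_mset (card I - size (exponents M)) 0"
proof -
  have "mset_set I = mset_set (set_mset M) + mset_set (I - set_mset M)"
    using assms by (metis finite_set_mset finite_Diff mset_set_Union Diff_disjoint Un_Diff_cancel sup.absorb_iff2)
  moreover have "image_mset (count M) (mset_set (I - set_mset M)) =
      image_mset (\<lambda>_. 0) (mset_set (I - set_mset M))"
    using assms by (intro image_mset_cong) (auto simp: not_in_iff)
  moreover have "card (I - set_mset M) = card I - card (set_mset M)"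
    using assms by (simp add: card_Diff_subset)
  ultimately show ?thesis
    by (simp add: exponents_def size_exponents_card image_mset_const_eq)
qed

lemma sum_count_exponents:
  assumes "finite I" "set_mset M \<subseteq> I" "f 0 = (0 :: 'b :: comm_monoid_add)"
  shows "(\<Sum>i\<in>I. f (count M i)) = (\<Sum>a\<in>#exponents M. f a)"
proof -
  have "(\<Sum>i\<in>I. f (count M i)) = (\<Sum>a\<in>#image_mset (count M) (mset_set I). f a)"
    by (simp add: sum_unfold_sum_mset multiset.map_comp comp_def)
  also have "\<dots> = (\<Sum>a\<in>#exponents M. f a)"
    unfolding image_count_mset_set[OF assms(1,2)] using assms(3)
    by (simp add: sum_mset.neutral)
  finally show ?thesis .
qed

lemma filter_nonzero_id: "0 \<notin># A \<Longrightarrow> filter_mset (\<lambda>a. a \<noteq> 0) A = A" for A :: "nat multiset"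
  by (rule multiset_eqI) (auto simp: not_in_iff)

lemma exponents_count:
  assumes "finite I" "set_mset M \<subseteq> I"
  shows "exponents M = filter_mset (\<lambda>a. a \<noteq> 0) (image_mset (count M) (mset_set I))"
proof -
  have "filter_mset (\<lambda>a. a \<noteq> 0) (exponents M) = exponents M"
    by (rule filter_nonzero_id) simp
  then show ?thesis
    unfolding image_count_mset_set[OF assms] by simp
qed

text \<open>After padding to a common finite set of variables, equal exponents are matched by a
  permutation of that set, extended by the identity.\<close>

lemma coeff_cong_exponents:
  assumes "exponents M = exponents M'"
  shows "coeff_sf f M = coeff_sf f M'"
proof -
  define I where "I = set_mset M \<union> set_mset M'"
  have I: "finite I" "set_mset M \<subseteq> I" "set_mset M' \<subseteq> I" by (auto simp: I_def)
  have "image_mset (count M) (mset_set I) = image_mset (count M') (mset_set I)"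
    by (simp add: image_count_mset_set I assms)
  then obtain p where p: "p permutes I" "\<forall>i\<in>I. count M i = count M' (p i)"
    using image_mset_eq_implies_permutes[OF I(1)] by blast
  have bij: "bij p" using p(1) by (rule permutes_bij)
  have "count M' j = count (image_mset p M) j" for j
  proof -
    obtain i where i: "j = p i" using bij by (metis bij_pointE)
    have "p -` {p i} = {i}" using bij by (auto dest: bij_is_inj injD)
    then have "count (image_mset p M) j = count M i"
      by (cases "i \<in># M") (simp_all add: i count_image_mset not_in_iff)
    moreover have "count M i = count M' j"
    proof (cases "i \<in> I")
      case False
      with p(1) have "p i = i" by (simp add: permutes_not_in)
      with False i I show ?thesis by (metis not_in_iff subsetD)
    qed (use p i in simp)
    ultimately show ?thesis by simp
  qed
  then have "M' = image_mset p M" by (simp add: multiset_eq_iff)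
  then show ?thesis using coeff_image_bij[OF bij] by metis
qed

text \<open>A representative monomial with exponent partition A in the first \<open>size A\<close>
  variables, at which the coefficient of m_A can be read off.\<close>

definition canon :: "nat multiset \<Rightarrow> nat multiset" where
  "canon A = (\<Sum>i<size A. replicate_mset (part_list A ! i) i)"

lemma count_canon: "count (canon A) i = (if i < size A then part_list A ! i else 0)"
  by (simp add: canon_def count_sum if_distrib sum.delta cong: if_cong)

lemma set_canon: "set_mset (canon A) \<subseteq> {..<size A}"
proof
  fix i assume "i \<in># canon A"
  then have "count (canon A) i \<noteq> 0" by simp
  then show "i \<in> {..<size A}" by (simp add: count_canon split: if_splits)
qed

lemma exponents_canon:
  assumes "0 \<notin># A"
  shows "exponents (canon A) = A"
proof -
  have "image_mset (count (canon A)) (mset_set {..<size A}) = image_mset (\<lambda>i. part_list A ! i) (mset_set {..<size A})"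
    by (intro image_mset_cong) (simp add: count_canon)
  also have "\<dots> = mset (map (\<lambda>i. part_list A ! i) [0..<length (part_list A)])"
    unfolding mset_map mset_upt atLeast0LessThan by simp
  also have "\<dots> = A" by (simp only: map_nth mset_part_list)
  finally have "image_mset (count (canon A)) (mset_set {..<size A}) = A" .
  moreover have "filter_mset (\<lambda>a. a \<noteq> 0) A = A"
    using assms by (rule filter_nonzero_id)
  ultimately show ?thesis
    using exponents_count[OF _ set_canon] by simp
qed

definition pcoeff :: "'a::zero symfun \<Rightarrow> nat multiset \<Rightarrow> 'a" where
  "pcoeff f A = coeff_sf f (canon A)"

lemma coeff_pcoeff: "coeff_sf f M = pcoeff f (exponents M)"
  unfolding pcoeff_def by (rule coeff_cong_exponents) (simp add: exponents_canon)

definition mon :: "nat multiset \<Rightarrow> 'a::comm_ring_1 symfun" where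
  "mon A = monomial_sf (part_list A)"

lemma coeff_mon: "coeff_sf (mon A) M = (if exponents M = A then 1 else 0)"
  by (simp add: mon_def monomial_sf.rep_eq)

lemma pcoeff_mon: "0 \<notin># B \<Longrightarrow> pcoeff (mon A) B = (if A = B then 1 else 0)"
  by (auto simp: pcoeff_def coeff_mon exponents_canon)

lemma mon_empty: "mon {#} = 1"
proof -
  have "exponents M = {#} \<longleftrightarrow> M = {#}" for M
    by (simp add: exponents_def mset_set_empty_iff)
  then show ?thesis by (intro symfun_eqI) (simp add: coeff_mon coeff_1)
qed

definition ptns :: "nat \<Rightarrow> nat multiset set" where
  "ptns D = {A. 0 \<notin># A \<and> sum_mset A \<le> D}"

lemma finite_ptns: "finite (ptns D)"
proof -
  \<comment> \<open>Every part k satisfies 1 \<le> k \<le> D and occurs at most D times, so all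
    these partitions are submultisets of one fixed multiset.\<close>
  have "ptns D \<subseteq> {A. A \<subseteq># (\<Sum>k\<in>{1..D}. replicate_mset D k)}"
  proof
    fix A assume A: "A \<in> ptns D"
    have "count A k \<le> count (\<Sum>k\<in>{1..D}. replicate_mset D k) k" for k
    proof (cases "k \<in># A")
      case True
      then have k: "0 < k" using A by (auto simp: ptns_def intro: Nat.gr0I)
      have "replicate_mset (count A k) k \<subseteq># A" by (simp flip: count_le_replicate_mset_subset_eq)
      then obtain B where B: "A = replicate_mset (count A k) k + B"
        by (metis subset_mset.add_diff_inverse)
      have "count A k * k \<le> sum_mset A"
        by (subst (2) B) simp
      then have le: "count A k * k \<le> D" using A by (simp add: ptns_def)
      have "k \<le> count A k * k" using True by simp
      with le have kD: "k \<le> D" by linarith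
      have "count A k \<le> count A k * k" using k by simp
      with le have "count A k \<le> D" by linarith
      with k kD show ?thesis by (simp add: count_sum if_distrib sum.delta cong: if_cong)
    qed (simp add: not_in_iff)
    then show "A \<in> {A. A \<subseteq># (\<Sum>k\<in>{1..D}. replicate_mset D k)}"
      by (simp add: subseteq_mset_def)
  qed
  then show ?thesis by (rule finite_subset) (rule finite_submultisets)
qed

lemma expand_mon:
  assumes "\<And>M. size M > D \<Longrightarrow> coeff_sf f M = 0"
  shows "f = (\<Sum>A\<in>ptns D. scale_sf (pcoeff f A) (mon A))"
proof (rule symfun_eqI)
  fix M
  have "coeff_sf (\<Sum>A\<in>ptns D. scale_sf (pcoeff f A) (mon A)) M =
      (\<Sum>A\<in>ptns D. if exponents M = A then pcoeff f A else 0)"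
    by (simp add: coeff_mon if_distrib cong: if_cong)
  also have "\<dots> = (if exponents M \<in> ptns D then pcoeff f (exponents M) else 0)"
    by (simp add: finite_ptns)
  also have "\<dots> = coeff_sf f M"
    using assms[of M] by (auto simp: ptns_def size_exponents coeff_pcoeff)
  finally show "coeff_sf f M = coeff_sf (\<Sum>A\<in>ptns D. scale_sf (pcoeff f A) (mon A)) M" by simp
qed

text \<open>The coefficient of $x^M$ in $x^N f$.\<close>
definition mcoeff :: "'a::zero symfun \<Rightarrow> nat multiset \<Rightarrow> nat multiset \<Rightarrow> 'a" where
  "mcoeff f N M = (if N \<subseteq># M then coeff_sf f (M - N) else 0)"

lemma mcoeff_linear [simp]: "mcoeff 0 N M = 0" "mcoeff (f + g) N M = mcoeff f N M + mcoeff g N M"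
  "mcoeff (scale_sf c f) N M = c * mcoeff f N M" "mcoeff (sum F S) N M = (\<Sum>x\<in>S. mcoeff (F x) N M)"
  by (simp_all add: mcoeff_def)

text \<open>Any finite I containing the variables of M will do, as \<open>mcoeff\<close> vanishes at
  the others; later I is a full set of n variables. Positivity of k makes the monomials x_i^k
  distinct.\<close>

lemma coeff_power_sum_mult:
  assumes "0 < k" "finite I" "set_mset M \<subseteq> I"
  shows "coeff_sf (power_sum k * f) M = (\<Sum>i\<in>I. mcoeff f (replicate_mset k i) M)"
proof -
  define J where "J = {i \<in> I. replicate_mset k i \<subseteq># M}"
  have inj: "inj_on (replicate_mset k) J"
    using assms(1) by (intro inj_onI) (metis count_replicate_mset neq0_conv)
  have sub: "replicate_mset k ` J \<subseteq> {A. A \<subseteq># M}" by (auto simp: J_def)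
  have ex: "A \<in> replicate_mset k ` J" if "A \<subseteq># M" "A = replicate_mset k i" for A i
  proof -
    have "i \<in># M" using that assms(1) by (metis in_replicate_mset mset_subset_eqD)
    with that assms(3) show ?thesis by (auto simp: J_def)
  qed
  have "coeff_sf (power_sum k * f) M =
      (\<Sum>A\<in>replicate_mset k ` J. (if \<exists>i. A = replicate_mset k i then 1 else 0) * coeff_sf f (M - A))"
    unfolding coeff_mult power_sum.rep_eq
    by (rule sum.mono_neutral_right) (use sub ex in \<open>auto simp: finite_submultisets\<close>)
  also have "\<dots> = (\<Sum>i\<in>J. coeff_sf f (M - replicate_mset k i))"
    by (subst sum.reindex[OF inj]) (auto intro!: sum.cong)
  also have "\<dots> = (\<Sum>i\<in>I. mcoeff f (replicate_mset k i) M)"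
    unfolding J_def mcoeff_def using assms(2) by (simp add: sum.inter_filter)
  finally show ?thesis .
qed

lemma mcoeff_power_sum_mult:
  assumes "0 < k" "finite I" "set_mset M \<subseteq> I"
  shows "mcoeff (power_sum k * f) N M = (\<Sum>i\<in>I. mcoeff f (N + replicate_mset k i) M)"
proof (cases "N \<subseteq># M")
  case True
  have "set_mset (M - N) \<subseteq> I" using assms(3) by (meson in_diffD subset_iff)
  then have "mcoeff (power_sum k * f) N M = (\<Sum>i\<in>I. mcoeff f (replicate_mset k i) (M - N))"
    using True coeff_power_sum_mult[OF assms(1,2), of "M - N" f] by (simp add: mcoeff_def)
  also have "\<dots> = (\<Sum>i\<in>I. mcoeff f (N + replicate_mset k i) M)"
    using True by (intro sum.cong) (auto simp: mcoeff_def subset_mset.le_diff_conv2 add.commute)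
  finally show ?thesis .
next
  case False
  then have "\<not> N + replicate_mset k i \<subseteq># M" for i
    by (meson mset_subset_eq_add_left subset_mset.order_trans)
  with False show ?thesis by (simp add: mcoeff_def)
qed

lemma exponents_add_new:
  assumes "i \<notin># M" "0 < k"
  shows "exponents (M + replicate_mset k i) = add_mset k (exponents M)"
proof -
  have "image_mset (count (M + replicate_mset k i)) (mset_set (set_mset M)) = exponents M"
    unfolding exponents_def using assms by (intro image_mset_cong) auto
  moreover have "set_mset (M + replicate_mset k i) = insert i (set_mset M)" using assms by auto
  ultimately show ?thesis
    using assms by (simp add: exponents_def not_in_iff)
qed

section \<open>The power sum basis\<close>

definition psum :: "nat multiset \<Rightarrow> 'a::comm_ring_1 symfun" where
  "psum J = (\<Prod>k\<in>#J. power_sum k)"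

lemma psum_simps [simp]: "psum {#} = 1" "psum (add_mset k J) = power_sum k * psum J" "psum (J + J') = psum J * psum J'"
  by (simp_all add: psum_def)

lemma power_sum_part_eq: "power_sum_part lam = psum (mset lam)"
  by (simp add: power_sum_part_def psum_def prod_mset_prod_list flip: mset_map)

interpretation sf: vector_space "scale_sf :: 'a::field \<Rightarrow> 'a symfun \<Rightarrow> 'a symfun"
  by (rule vector_space_symfun)

interpretation scalars: vector_space "(*) :: 'a::field \<Rightarrow> 'a \<Rightarrow> 'a"
  by unfold_locales (simp_all add: algebra_simps)

text \<open>As a simplification rule this would undo \<open>mult.assoc\<close>.\<close>
declare scalars.scale_scale [simp del]

interpretation sf_sf: vector_space_pair "scale_sf :: 'a::field \<Rightarrow> 'a symfun \<Rightarrow> 'a symfun"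
    "scale_sf :: 'a \<Rightarrow> 'a symfun \<Rightarrow> 'a symfun"
  by unfold_locales

interpretation sf_scalars: vector_space_pair "scale_sf :: 'a::field \<Rightarrow> 'a symfun \<Rightarrow> 'a symfun"
    "(*) :: 'a \<Rightarrow> 'a \<Rightarrow> 'a"
  by unfold_locales

lemma subspace_vimage_mult:
  "sf.subspace S \<Longrightarrow> sf.subspace {f. g * f \<in> S}"
  unfolding sf.subspace_def by (auto simp: distrib_left scale_mult_right)

lemma power_sum_mult_span:
  assumes "f \<in> sf.span (psum ` {J. 0 \<notin># J \<and> sum_mset J = d})" "0 < k"
  shows "power_sum k * f \<in> sf.span (psum ` {J. 0 \<notin># J \<and> sum_mset J = d + k})"
proof -
  have "f \<in> {f. power_sum k * f \<in> sf.span (psum ` {J. 0 \<notin># J \<and> sum_mset J = d + k})}"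
    using assms(1)
  proof (rule sf.span_induct)
    show "sf.subspace {x. x \<in> {f. power_sum k * f \<in> sf.span (psum ` {J. 0 \<notin># J \<and> sum_mset J = d + k})}}"
      by (simp add: subspace_vimage_mult sf.subspace_span)
    fix x :: "'a symfun" assume "x \<in> psum ` {J. 0 \<notin># J \<and> sum_mset J = d}"
    then obtain J where J: "x = psum J" "0 \<notin># J" "sum_mset J = d" by auto
    have "add_mset k J \<in> {J. 0 \<notin># J \<and> sum_mset J = d + k}"
      using J assms(2) by auto
    then have "psum (add_mset k J) \<in> sf.span (psum ` {J. 0 \<notin># J \<and> sum_mset J = d + k} :: 'a symfun set)"
      by (intro sf.span_base imageI)
    then show "x \<in> {f. power_sum k * f \<in> sf.span (psum ` {J. 0 \<notin># J \<and> sum_mset J = d + k})}"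
      by (simp add: J(1))
  qed
  then show ?thesis by simp
qed

text \<open>$p_k m_A$ is a nonzero multiple of $m_{A \cup (k)}$ plus monomial functions with fewer parts.\<close>
lemma mon_in_span_psum:
  assumes "0 \<notin># A"
  shows "(mon A :: 'a::field_char_0 symfun) \<in> sf.span (psum ` {J. 0 \<notin># J \<and> sum_mset J = sum_mset A})"
  using assms
proof (induction "size A" arbitrary: A rule: less_induct)
  case less
  show ?case
  proof (cases "A = {#}")
    case True
    have "psum {#} \<in> sf.span (psum ` {J. 0 \<notin># J \<and> sum_mset J = sum_mset {#}} :: 'a symfun set)"
      by (intro sf.span_base imageI CollectI conjI) (rule count_empty[THEN not_in_iff[THEN iffD2]], rule refl)
    then show ?thesis by (simp only: True mon_empty psum_simps)
  next
    case False
    then obtain k A' where A: "A = add_mset k A'" by (cases A) auto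
    then have k: "0 < k" "0 \<notin># A'" using less.prems by auto
    define S where "S = sf.span (psum ` {J. 0 \<notin># J \<and> sum_mset J = sum_mset A} :: 'a symfun set)"
    define f where "f = power_sum k * (mon A' :: 'a symfun)"
    have "f \<in> sf.span (psum ` {J. 0 \<notin># J \<and> sum_mset J = sum_mset A' + k})"
      unfolding f_def by (rule power_sum_mult_span[OF less.hyps]) (use A k in auto)
    then have fS: "f \<in> S" by (simp add: S_def A add.commute)
    \<comment> \<open>\<open>X M\<close> collects the variables whose k-th power can be split off.
      The coefficients of f are therefore cardinalities, which can be tested for zero in
      characteristic zero.\<close>
    define X where "X = (\<lambda>M. {i\<in>set_mset M. replicate_mset k i \<subseteq># M \<and> exponents (M - replicate_mset k i) = A'})"
    have cff: "coeff_sf f M = of_nat (card (X M))" for M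
    proof -
      have "coeff_sf f M = (\<Sum>i\<in>set_mset M. if replicate_mset k i \<subseteq># M \<and> exponents (M - replicate_mset k i) = A' then 1 else 0)"
        unfolding f_def coeff_power_sum_mult[OF k(1) finite_set_mset subset_refl]
        by (intro sum.cong) (auto simp: mcoeff_def coeff_mon)
      then show ?thesis by (simp add: X_def sum.inter_filter[symmetric])
    qed
    have sz: "size M = sum_mset A \<and> (exponents M = A \<or> size (exponents M) < size A)" if "coeff_sf f M \<noteq> 0" for M
    proof -
      have "X M \<noteq> {}" using that cff[of M] by auto
      then obtain i where i: "replicate_mset k i \<subseteq># M" "exponents (M - replicate_mset k i) = A'"
        by (auto simp: X_def)
      define N where "N = M - replicate_mset k i"
      have M: "M = N + replicate_mset k i" using i(1) by (simp add: N_def)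
      have eN: "exponents N = A'" using i by (simp add: N_def)
      have "size M = sum_mset A"
        using size_exponents[of N] by (simp add: M eN A)
      moreover have "exponents M = A \<or> size (exponents M) < size A"
      proof (cases "i \<in># N")
        case True
        then have "set_mset M = set_mset N" by (auto simp: M)
        then have "size (exponents M) = size A'" using eN by (metis size_exponents_card)
        then show ?thesis by (simp add: A)
      next
        case False
        then show ?thesis using exponents_add_new[OF False k(1)] by (simp add: M A eN)
      qed
      ultimately show ?thesis by simp
    qed
    have "f = (\<Sum>B\<in>ptns (sum_mset A). scale_sf (pcoeff f B) (mon B))"
    proof (rule expand_mon)
      fix M :: "nat multiset" assume "size M > sum_mset A"
      then show "coeff_sf f M = 0" using sz[of M] by auto
    qed
    also have "\<dots> = scale_sf (pcoeff f A) (mon A) + (\<Sum>B\<in>ptns (sum_mset A) - {A}. scale_sf (pcoeff f B) (mon B))"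
      by (rule sum.remove) (use less.prems in \<open>auto simp: ptns_def finite_ptns[unfolded ptns_def]\<close>)
    finally have f: "scale_sf (pcoeff f A) (mon A) = f - (\<Sum>B\<in>ptns (sum_mset A) - {A}. scale_sf (pcoeff f B) (mon B))"
      by (simp only: eq_diff_eq)
    have "(\<Sum>B\<in>ptns (sum_mset A) - {A}. scale_sf (pcoeff f B) (mon B)) \<in> S"
    proof (unfold S_def, rule sf.span_sum)
      fix B assume B: "B \<in> ptns (sum_mset A) - {A}"
      then have B0: "0 \<notin># B" by (simp add: ptns_def)
      show "scale_sf (pcoeff f B) (mon B) \<in> sf.span (psum ` {J. 0 \<notin># J \<and> sum_mset J = sum_mset A})"
      proof (cases "pcoeff f B = 0")
        case False
        with sz[of "canon B"] B have "sum_mset B = sum_mset A" "size B < size A"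
          using exponents_canon[OF B0] size_exponents[of "canon B"] by (auto simp: pcoeff_def)
        with less.hyps[OF _ B0] show ?thesis by (simp add: sf.span_scale)
      qed (simp add: sf.span_zero)
    qed
    then have inS: "scale_sf (pcoeff f A) (mon A) \<in> S"
      unfolding f using fS unfolding S_def by (intro sf.span_diff)
    \<comment> \<open>Attaching x_i^k to a variable outside \<open>canon A'\<close> gives a monomial
      with exponents A at which \<open>X M\<close> is nonempty.\<close>
    have cne: "pcoeff f A \<noteq> 0"
    proof -
      define N where "N = canon A'"
      define i where "i = size A'"
      have iN: "i \<notin># N" using set_canon[of A'] by (auto simp: N_def i_def)
      define M where "M = N + replicate_mset k i"
      have "exponents M = A"
        using exponents_add_new[OF iN k(1)] exponents_canon[OF k(2)] by (simp add: A M_def N_def)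
      then have "pcoeff f A = coeff_sf f M" by (simp add: coeff_pcoeff)
      moreover have "M - replicate_mset k i = canon A'" "i \<in># M" "replicate_mset k i \<subseteq># M"
        using k(1) by (simp_all add: M_def N_def)
      then have "i \<in> X M" by (simp add: X_def exponents_canon[OF k(2)])
      then have "card (X M) \<noteq> 0" by (auto simp: X_def)
      ultimately show ?thesis by (metis cff of_nat_eq_0_iff)
    qed
    have "scale_sf (inverse (pcoeff f A)) (scale_sf (pcoeff f A) (mon A)) = mon A"
      using cne by simp
    then show ?thesis
      using sf.span_scale[OF inS[unfolded S_def], of "inverse (pcoeff f A)"] by (simp only:)
  qed
qed

abbreviation positive_parts :: "nat multiset set" where
  "positive_parts \<equiv> {J. 0 \<notin># J}"

lemma span_psum: "sf.span (psum ` positive_parts) = (UNIV :: 'a::field_char_0 symfun set)"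
proof -
  have "f \<in> sf.span (psum ` positive_parts)" for f :: "'a symfun"
  proof -
    obtain D where "\<And>M. size M > D \<Longrightarrow> coeff_sf f M = 0" using coeff_bounded[of f] by blast
    then have "f = (\<Sum>A\<in>ptns D. scale_sf (pcoeff f A) (mon A))" by (rule expand_mon)
    also have "\<dots> \<in> sf.span (psum ` positive_parts)"
    proof (intro sf.span_sum sf.span_scale)
      fix A assume "A \<in> ptns D"
      then have "mon A \<in> sf.span (psum ` {J. 0 \<notin># J \<and> sum_mset J = sum_mset A} :: 'a symfun set)"
        by (intro mon_in_span_psum) (simp add: ptns_def)
      then show "mon A \<in> sf.span (psum ` positive_parts :: 'a symfun set)"
        using sf.span_mono[of "psum ` {J. 0 \<notin># J \<and> sum_mset J = sum_mset A}" "psum ` positive_parts"] by blast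
    qed
    finally show ?thesis .
  qed
  then show ?thesis by blast
qed

lemma independent_mon: "sf.independent (mon ` positive_parts :: 'a::field symfun set)"
proof -
  have False if "finite t" "t \<subseteq> mon ` positive_parts" "(\<Sum>v\<in>t. scale_sf (u v) v) = 0"
    "v0 \<in> t" "u v0 \<noteq> 0" for t and u :: "'a symfun \<Rightarrow> 'a" and v0
  proof -
    obtain A where A: "v0 = mon A" "0 \<notin># A" using \<open>t \<subseteq> mon ` positive_parts\<close> \<open>v0 \<in> t\<close> by blast
    have "0 = pcoeff (\<Sum>v\<in>t. scale_sf (u v) v) A" using that by (simp add: pcoeff_def)
    also have "\<dots> = (\<Sum>v\<in>t. if v = v0 then u v0 else 0)"
      unfolding pcoeff_def coeff_sum coeff_scale
    proof (intro sum.cong refl)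
      fix v assume "v \<in> t"
      then obtain B where B: "v = mon B" "0 \<notin># B" using \<open>t \<subseteq> mon ` positive_parts\<close> by blast
      have "coeff_sf v (canon A) = (if B = A then 1 else 0)"
        using pcoeff_mon[OF A(2), of B, where ?'a = 'a] by (simp add: B pcoeff_def)
      moreover have "v = v0 \<longleftrightarrow> B = A"
        using pcoeff_mon[OF A(2), of B, where ?'a = 'a] pcoeff_mon[OF A(2), of A, where ?'a = 'a]
        by (cases "B = A") (auto simp: A B)
      ultimately show "u v * coeff_sf v (canon A) = (if v = v0 then u v0 else 0)" by (cases "v = v0") auto
    qed
    also have "\<dots> = u v0" using that by simp
    finally show False using that by simp
  qed
  then show ?thesis unfolding sf.dependent_explicit by blast
qed

lemma inj_mon: "inj_on (mon :: _ \<Rightarrow> 'a::comm_ring_1 symfun) positive_parts"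
proof (rule inj_onI)
  fix A B assume "A \<in> positive_parts" "B \<in> positive_parts" "mon A = (mon B :: 'a symfun)"
  then have 1: "pcoeff (mon B :: 'a symfun) A = 1" and 0: "A \<noteq> B \<Longrightarrow> pcoeff (mon B :: 'a symfun) A = 0"
    using pcoeff_mon[of A A, where ?'a = 'a] pcoeff_mon[of A B, where ?'a = 'a] by auto
  show "A = B" by (rule ccontr) (use 0 1 in simp)
qed

text \<open>Triangularity yields only a spanning family. In bounded degree the monomial functions
  are independent and as many as the index set, so a family with the same index set whose span
  contains them must be injective and independent.\<close>

lemma psum_bounded_basis:
  "inj_on (psum :: _ \<Rightarrow> 'a::field_char_0 symfun) (ptns D) \<and> sf.independent (psum ` ptns D :: 'a symfun set)"
proof -
  have sp: "mon ` ptns D \<subseteq> sf.span (psum ` ptns D :: 'a symfun set)"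
  proof safe
    fix A assume A: "A \<in> ptns D"
    then have "{J. 0 \<notin># J \<and> sum_mset J = sum_mset A} \<subseteq> ptns D" by (auto simp: ptns_def)
    with A mon_in_span_psum[of A] show "mon A \<in> sf.span (psum ` ptns D :: 'a symfun set)"
      using sf.span_mono[of "psum ` {J. 0 \<notin># J \<and> sum_mset J = sum_mset A}" "psum ` ptns D"]
      by (auto simp: ptns_def)
  qed
  have sub: "ptns D \<subseteq> positive_parts" by (auto simp: ptns_def)
  have ind: "sf.independent (mon ` ptns D :: 'a symfun set)"
    by (rule sf.independent_mono[OF independent_mon image_mono[OF sub]])
  have card: "card (mon ` ptns D :: 'a symfun set) = card (ptns D)"
    by (intro card_image inj_on_subset[OF inj_mon sub])
  have bound: "card (ptns D) \<le> card T" if "finite T" "mon ` ptns D \<subseteq> sf.span T" for T :: "'a symfun set"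
    using sf.independent_span_bound[OF that(1) ind that(2)] card by simp
  have "card (ptns D) \<le> card (psum ` ptns D :: 'a symfun set)"
    by (rule bound) (use sp finite_ptns in auto)
  then have eq: "card (psum ` ptns D :: 'a symfun set) = card (ptns D)"
    using card_image_le[OF finite_ptns, of psum D] by (rule antisym[rotated])
  moreover have "sf.independent (psum ` ptns D :: 'a symfun set)"
  proof (rule ccontr)
    assume "\<not> ?thesis"
    then have "\<exists>a \<in> psum ` ptns D. a \<in> sf.span (psum ` ptns D - {a} :: 'a symfun set)"
      unfolding sf.dependent_def not_not .
    then obtain a :: "'a symfun" where a: "a \<in> psum ` ptns D" "a \<in> sf.span (psum ` ptns D - {a})" ..
    then have "sf.span (insert a (psum ` ptns D - {a})) = sf.span (psum ` ptns D - {a})"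
      by (intro sf.span_redundant)
    then have "sf.span (psum ` ptns D) = sf.span (psum ` ptns D - {a})"
      by (simp only: insert_Diff[OF a(1)])
    then have "mon ` ptns D \<subseteq> sf.span (psum ` ptns D - {a})"
      using sp by (simp only:)
    then have "card (ptns D) \<le> card (psum ` ptns D - {a})"
      by (intro bound finite_Diff finite_imageI finite_ptns)
    also have "\<dots> < card (psum ` ptns D :: 'a symfun set)"
      using a(1) by (intro card_Diff1_less finite_imageI finite_ptns)
    finally show False by (simp only: eq less_irrefl)
  qed
  ultimately show ?thesis using eq_card_imp_inj_on[OF finite_ptns eq] by (intro conjI)
qed

lemma inj_psum: "inj_on (psum :: _ \<Rightarrow> 'a::field_char_0 symfun) positive_parts"
proof (rule inj_onI)
  fix A B assume *: "A \<in> positive_parts" "B \<in> positive_parts" "psum A = (psum B :: 'a symfun)"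
  define D where "D = max (sum_mset A) (sum_mset B)"
  have "A \<in> ptns D" "B \<in> ptns D" using * by (auto simp: D_def ptns_def)
  with * show "A = B" using psum_bounded_basis[of D, where ?'a = 'a] by (auto dest: inj_onD)
qed

lemma independent_psum: "sf.independent (psum ` positive_parts :: 'a::field_char_0 symfun set)"
proof
  assume "sf.dependent (psum ` positive_parts :: 'a symfun set)"
  then obtain t and u :: "'a symfun \<Rightarrow> 'a" where
    t: "finite t" "t \<subseteq> psum ` positive_parts" "(\<Sum>v\<in>t. scale_sf (u v) v) = 0" "\<exists>v\<in>t. u v \<noteq> 0"
    unfolding sf.dependent_explicit by blast
  obtain T where T: "finite T" "T \<subseteq> positive_parts" "t = psum ` T"
    using t by (meson finite_subset_image)
  define D where "D = (\<Sum>A\<in>T. sum_mset A)"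
  have "T \<subseteq> ptns D"
    using T by (auto simp: ptns_def D_def intro!: member_le_sum)
  then have "t \<subseteq> psum ` ptns D" using T by auto
  moreover have "sf.dependent t" unfolding sf.dependent_explicit using t by blast
  ultimately show False
    using psum_bounded_basis[of D, where ?'a = 'a] sf.dependent_mono by blast
qed

lemma symfun_induct [case_names zero add scale psum]:
  fixes P :: "'a::field_char_0 symfun \<Rightarrow> bool"
  assumes "P 0" "\<And>f g. P f \<Longrightarrow> P g \<Longrightarrow> P (f + g)" "\<And>c f. P f \<Longrightarrow> P (scale_sf c f)"
    "\<And>J. 0 \<notin># J \<Longrightarrow> P (psum J)"
  shows "P f"
proof -
  have f: "f \<in> sf.span (psum ` positive_parts)" by (simp only: span_psum UNIV_I)
  show ?thesis
    by (rule sf.span_induct[OF f]) (use assms in \<open>auto simp: sf.subspace_def\<close>)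
qed

lemma psum_expand:
  fixes f :: "'a::field_char_0 symfun"
  obtains T c where "finite T" "T \<subseteq> positive_parts" "f = (\<Sum>J\<in>T. scale_sf (c J) (psum J))"
proof -
  have "f \<in> sf.span (psum ` positive_parts)" by (simp only: span_psum UNIV_I)
  then obtain t and r :: "'a symfun \<Rightarrow> 'a" where
    t: "finite t" "t \<subseteq> psum ` positive_parts" "f = (\<Sum>a\<in>t. scale_sf (r a) a)"
    unfolding sf.span_explicit by (elim CollectE exE conjE) (rule that)
  obtain T where T: "T \<subseteq> positive_parts" "finite T" "t = psum ` T"
    using finite_subset_image[OF t(1,2)] by (elim exE conjE) (rule that)
  have "f = (\<Sum>J\<in>T. scale_sf (r (psum J)) (psum J))"
    unfolding t(3) T(3) by (rule sum.reindex[OF inj_on_subset[OF inj_psum T(1)], unfolded o_def])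
  then show thesis by (rule that[OF T(2,1)])
qed

lemma linear_ext_psum:
  fixes \<phi> :: "nat multiset \<Rightarrow> 'a::field_char_0 symfun"
  shows "\<exists>g. Vector_Spaces.linear scale_sf scale_sf g \<and> (\<forall>J. 0 \<notin># J \<longrightarrow> g (psum J) = \<phi> J)"
proof -
  obtain g where g: "Vector_Spaces.linear scale_sf scale_sf g"
    "\<forall>x\<in>psum ` positive_parts. g x = \<phi> (the_inv_into positive_parts psum x)"
    using sf_sf.linear_independent_extend[OF independent_psum, of "\<lambda>x. \<phi> (the_inv_into positive_parts psum x)"] by (elim exE conjE) (rule that)
  have *: "g (psum J) = \<phi> J" if "0 \<notin># J" for J
    using g(2) that by (simp add: the_inv_into_f_f[OF inj_psum])
  with g(1) show ?thesis by (intro exI[of _ g]) simp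
qed

lemma linear_form_ext_psum:
  fixes \<phi> :: "nat multiset \<Rightarrow> 'a::field_char_0"
  shows "\<exists>g. Vector_Spaces.linear scale_sf (*) g \<and> (\<forall>J. 0 \<notin># J \<longrightarrow> g (psum J) = \<phi> J)"
proof -
  obtain g where g: "Vector_Spaces.linear scale_sf (*) g"
    "\<forall>x\<in>psum ` positive_parts. g x = \<phi> (the_inv_into positive_parts psum x)"
    using sf_scalars.linear_independent_extend[OF independent_psum, of "\<lambda>x. \<phi> (the_inv_into positive_parts psum x)"] by (elim exE conjE) (rule that)
  have *: "g (psum J) = \<phi> J" if "0 \<notin># J" for J
    using g(2) that by (simp add: the_inv_into_f_f[OF inj_psum])
  with g(1) show ?thesis by (intro exI[of _ g]) simp
qed

section \<open>Derivations with respect to power sums\<close>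

text \<open>The partial derivative with respect to p_k, with symmetric functions regarded as
  polynomials in the power sums.\<close>

definition pdrv :: "nat \<Rightarrow> 'a::field_char_0 symfun \<Rightarrow> 'a symfun" where
  "pdrv k = (SOME g. Vector_Spaces.linear scale_sf scale_sf g \<and>
     (\<forall>J. 0 \<notin># J \<longrightarrow> g (psum J) = scale_sf (of_nat (count J k)) (psum (J - {#k#}))))"

lemma pdrv_props:
  "Vector_Spaces.linear scale_sf scale_sf (pdrv k :: 'a::field_char_0 symfun \<Rightarrow> _) \<and>
     (\<forall>J. 0 \<notin># J \<longrightarrow> pdrv k (psum J :: 'a symfun) = scale_sf (of_nat (count J k)) (psum (J - {#k#})))"
proof -
  show ?thesis unfolding pdrv_def by (rule someI_ex[OF linear_ext_psum])
qed

lemma pdrv_psum: "0 \<notin># J \<Longrightarrow> pdrv k (psum J) = scale_sf (of_nat (count J k)) (psum (J - {#k#}))"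
  using pdrv_props by blast

lemma pdrv_linear [simp]:
  fixes f :: "'a::field_char_0 symfun"
  shows "pdrv k (0 :: 'a symfun) = 0" "pdrv k (f + g) = pdrv k f + pdrv k g" "pdrv k (scale_sf c f) = scale_sf c (pdrv k f)"
proof -
  have lin: "Vector_Spaces.linear scale_sf scale_sf (pdrv k :: 'a symfun \<Rightarrow> _)" using pdrv_props by blast
  show "pdrv k (0 :: 'a symfun) = 0" by (rule sf_sf.linear_0[OF lin])
  show "pdrv k (f + g) = pdrv k f + pdrv k g" by (rule sf_sf.linear_add[OF lin])
  show "pdrv k (scale_sf c f) = scale_sf c (pdrv k f)" by (rule sf_sf.linear_scale[OF lin])
qed

lemma pdrv_power_sum_mult:
  assumes "0 < j"
  shows "pdrv k (power_sum j * f) = power_sum j * pdrv k f + (if j = k then f else 0)"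
proof (induction f rule: symfun_induct)
  case (psum J)
  have 1: "pdrv k (power_sum j * psum J :: 'a symfun) =
      scale_sf (of_nat (count (add_mset j J) k)) (psum (add_mset j J - {#k#}))"
    using pdrv_psum[of "add_mset j J" k, where ?'a = 'a] psum assms by simp
  have 2: "power_sum j * pdrv k (psum J) = scale_sf (of_nat (count J k)) (power_sum j * psum (J - {#k#}) :: 'a symfun)"
    by (simp add: pdrv_psum psum scale_mult_right)
  show ?case
  proof (cases "k \<in># J")
    case True
    then have "add_mset j J - {#k#} = add_mset j (J - {#k#})" by simp
    then have 3: "psum (add_mset j J - {#k#}) = (power_sum j * psum (J - {#k#}) :: 'a symfun)" by simp
    have "j = k \<Longrightarrow> power_sum j * psum (J - {#k#}) = (psum J :: 'a symfun)"
      using True by (simp flip: psum_simps(2))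
    then show ?thesis unfolding 1 2 3 by (auto simp: sf.scale_left_distrib add.commute)
  next
    case False
    then show ?thesis unfolding 1 2 by (simp add: not_in_iff)
  qed
qed (simp_all add: distrib_left scale_mult_right sf.scale_right_distrib)

text \<open>This is $x_i\partial_i f = \sum_b b\, x_i^b\, \partial f/\partial p_b$.\<close>
lemma count_mult_coeff:
  fixes f :: "'a::field_char_0 symfun"
  assumes "count M i \<le> n"
  shows "of_nat (count M i) * coeff_sf f M =
    (\<Sum>b=1..n. of_nat b * mcoeff (pdrv b f) (replicate_mset b i) M)"
  using assms
proof (induction f arbitrary: M rule: symfun_induct)
  case zero
  then show ?case by simp
next
  case (add f g)
  then show ?case by (simp add: distrib_left sum.distrib)
next
  case (scale c f)
  have "of_nat (count M i) * coeff_sf (scale_sf c f) M = c * (of_nat (count M i) * coeff_sf f M)"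
    by (simp only: coeff_scale mult.left_commute)
  also have "\<dots> = c * (\<Sum>b=1..n. of_nat b * mcoeff (pdrv b f) (replicate_mset b i) M)"
    by (simp only: scale(1)[OF scale(2)])
  also have "\<dots> = (\<Sum>b=1..n. of_nat b * mcoeff (pdrv b (scale_sf c f)) (replicate_mset b i) M)"
    unfolding sum_distrib_left pdrv_linear mcoeff_linear by (intro sum.cong refl mult.left_commute)
  finally show ?case .
next
  case (psum J)
  then show ?case
  proof (induction J arbitrary: M)
    case empty
    have "pdrv b 1 = (0 :: 'a symfun)" for b
      using pdrv_psum[of "{#}" b, where ?'a = 'a] by simp
    then show ?case by (simp add: coeff_1)
  next
    case (add a J)
    then have a: "0 < a" "0 \<notin># J" by auto
    define h where "h = (psum J :: 'a symfun)"
    define I where "I = insert i (set_mset M)"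
    have I: "finite I" "set_mset M \<subseteq> I" "i \<in> I" by (auto simp: I_def)
    \<comment> \<open>Leibniz rule for the summand x_j^a h of p_a h: the exponent of x_i in M is the
      one in M / x_j^a, which the induction hypothesis handles, plus a if j = i.\<close>
    have trm: "of_nat (count M i) * mcoeff h (replicate_mset a j) M =
        (\<Sum>b=1..n. of_nat b * mcoeff (pdrv b h) (replicate_mset b i + replicate_mset a j) M) +
        (if j = i then of_nat a * mcoeff h (replicate_mset a j) M else 0)" for j
    proof (cases "replicate_mset a j \<subseteq># M")
      case True
      define N where "N = M - replicate_mset a j"
      have M: "M = N + replicate_mset a j" using True by (simp add: N_def)
      have le: "count N i \<le> n" using add.prems by (simp add: M)
      have "mcoeff (pdrv b h) (replicate_mset b i) N = mcoeff (pdrv b h) (replicate_mset b i + replicate_mset a j) M" for b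
        by (simp add: mcoeff_def M)
      then have e1: "of_nat (count N i) * coeff_sf h N =
        (\<Sum>b=1..n. of_nat b * mcoeff (pdrv b h) (replicate_mset b i + replicate_mset a j) M)"
        using add.IH[OF a(2) le] by (simp only: h_def)
      have e2: "mcoeff h (replicate_mset a j) M = coeff_sf h N" by (simp add: mcoeff_def M)
      have e3: "of_nat (count M i) = of_nat (count N i) + (if j = i then of_nat a else (0 :: 'a))"
        by (simp add: M)
      show ?thesis unfolding e2 e3 distrib_right e1 by (cases "j = i") simp_all
    next
      case False
      then have "\<not> replicate_mset b i + replicate_mset a j \<subseteq># M" for b
        by (meson mset_subset_eq_add_right subset_mset.order_trans)
      with False show ?thesis by (auto simp: mcoeff_def)
    qed
    have "of_nat (count M i) * coeff_sf (psum (add_mset a J)) M =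
        (\<Sum>j\<in>I. of_nat (count M i) * mcoeff h (replicate_mset a j) M)"
      by (simp add: coeff_power_sum_mult[OF a(1) I(1,2)] sum_distrib_left h_def)
    also have "\<dots> = (\<Sum>b=1..n. \<Sum>j\<in>I. of_nat b * mcoeff (pdrv b h) (replicate_mset b i + replicate_mset a j) M)
        + of_nat a * mcoeff h (replicate_mset a i) M"
      unfolding trm sum.distrib using I by (simp add: sum.delta' sum.swap[of _ I])
    also have "of_nat a * mcoeff h (replicate_mset a i) M =
        (\<Sum>b=1..n. if a = b then of_nat b * mcoeff h (replicate_mset b i) M else 0)"
    proof (cases "a \<le> n")
      case False
      with add.prems have "\<not> replicate_mset a i \<subseteq># M"
        by (simp flip: count_le_replicate_mset_subset_eq)
      with False show ?thesis by (simp add: mcoeff_def)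
    qed (use a(1) in \<open>simp add: sum.delta'\<close>)
    also have "(\<Sum>b=1..n. \<Sum>j\<in>I. of_nat b * mcoeff (pdrv b h) (replicate_mset b i + replicate_mset a j) M) + \<dots> =
        (\<Sum>b=1..n. of_nat b * mcoeff (pdrv b (psum (add_mset a J))) (replicate_mset b i) M)"
      unfolding sum.distrib[symmetric]
    proof (rule sum.cong[OF refl])
      fix b
      show "(\<Sum>j\<in>I. of_nat b * mcoeff (pdrv b h) (replicate_mset b i + replicate_mset a j) M) +
          (if a = b then of_nat b * mcoeff h (replicate_mset b i) M else 0) =
          of_nat b * mcoeff (pdrv b (psum (add_mset a J))) (replicate_mset b i) M"
        by (simp add: pdrv_power_sum_mult[OF a(1)] mcoeff_power_sum_mult[OF a(1) I(1,2)] h_def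
            distrib_left sum_distrib_left)
    qed
    finally show ?case .
  qed
qed

text \<open>The Euler operator of x_i acts on the second factor of x^N f only, whence the subtracted
  exponent of N.\<close>

lemma count_mult_mcoeff:
  fixes f :: "'a::field_char_0 symfun"
  assumes "count M i \<le> n"
  shows "(of_nat (count M i) - of_nat (count N i)) * mcoeff f N M =
    (\<Sum>b=1..n. of_nat b * mcoeff (pdrv b f) (N + replicate_mset b i) M)"
proof (cases "N \<subseteq># M")
  case True
  then obtain L where M: "M = L + N" by (metis subset_mset.diff_add)
  have le: "count L i \<le> n" using assms by (simp add: M)
  have "mcoeff (pdrv b f) (replicate_mset b i) L = mcoeff (pdrv b f) (N + replicate_mset b i) M" for b
    by (simp add: mcoeff_def M add.commute[of N])
  with count_mult_coeff[OF le, of f] show ?thesis by (simp add: mcoeff_def M)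
next
  case False
  then have "\<not> N + replicate_mset b i \<subseteq># M" for b
    by (meson mset_subset_eq_add_left subset_mset.order_trans)
  with False show ?thesis by (simp add: mcoeff_def)
qed

section \<open>The scalar product\<close>

text \<open>Supplies characteristic zero for \<open>ratfun\<close>, on which the power sum basis
  rests.\<close>

instance fract :: ("{idom, ring_char_0}") field_char_0
proof
  show "inj (of_nat :: nat \<Rightarrow> 'a fract)"
    by (rule injI) (simp add: eq_fract flip: Fract_of_nat_eq)
qed

abbreviation ji ("\<langle>_, _\<rangle>") where "ji \<equiv> jack_inner"

abbreviation alpha :: ratfun where "alpha \<equiv> jack_param"

lemma alpha_nonzero [simp]: "alpha \<noteq> 0"
  by (simp add: jack_param_def Zero_fract_def eq_fract)

definition z_mset :: "nat multiset \<Rightarrow> nat" where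
  "z_mset J = (\<Prod>i\<in>set_mset J. i ^ count J i * fact (count J i))"

lemma z_part_eq: "z_part lam = z_mset (mset lam)"
proof -
  have "count_list lam = count (mset lam)" by (rule ext) (induction lam, auto)
  then show ?thesis by (simp add: z_part_def z_mset_def)
qed

lemma z_mset_add_mset: "z_mset (add_mset k J) = k * Suc (count J k) * z_mset J"
proof -
  have "z_mset J = (\<Prod>i\<in>insert k (set_mset J). i ^ count J i * fact (count J i))"
    unfolding z_mset_def by (rule prod.mono_neutral_left) (auto simp: not_in_iff)
  also have "\<dots> = k ^ count J k * fact (count J k) * (\<Prod>i\<in>set_mset J - {k}. i ^ count J i * fact (count J i))"
    by (simp add: prod.insert_remove)
  finally have 1: "z_mset J = \<dots>" .
  have "z_mset (add_mset k J) = k ^ Suc (count J k) * fact (Suc (count J k)) *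
      (\<Prod>i\<in>set_mset J - {k}. i ^ count (add_mset k J) i * fact (count (add_mset k J) i))"
    by (simp add: z_mset_def prod.insert_remove)
  also have "(\<Prod>i\<in>set_mset J - {k}. i ^ count (add_mset k J) i * fact (count (add_mset k J) i)) =
      (\<Prod>i\<in>set_mset J - {k}. i ^ count J i * fact (count J i))"
    by (intro prod.cong) auto
  finally show ?thesis unfolding 1 by (simp add: algebra_simps)
qed

definition psum_norm :: "nat multiset \<Rightarrow> ratfun" where
  "psum_norm J = of_nat (z_mset J) * alpha ^ size J"

lemma psum_norm_add_mset: "psum_norm (add_mset k J) = alpha * of_nat k * of_nat (Suc (count J k)) * psum_norm J"
  unfolding psum_norm_def z_mset_add_mset size_add_mset power_Suc of_nat_mult by (simp only: mult_ac)

lemma psum_norm_empty: "psum_norm {#} = 1"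
  by (simp add: psum_norm_def z_mset_def)

lemma psum_norm_nonzero: "0 \<notin># J \<Longrightarrow> psum_norm J \<noteq> 0"
proof (induction J)
  case (add k J)
  then have "k \<noteq> 0" "psum_norm J \<noteq> 0" by auto
  then show ?case unfolding psum_norm_add_mset by (simp del: of_nat_Suc)
qed (simp add: psum_norm_empty)

text \<open>The predicate under the definite description of \<open>jack_inner\<close>, isolated in
  order to prove existence and uniqueness for it.\<close>

definition jack_form :: "(ratfun symfun \<Rightarrow> ratfun symfun \<Rightarrow> ratfun) \<Rightarrow> bool" where
  "jack_form B \<longleftrightarrow>
     (\<forall>g. Vector_Spaces.linear scale_sf (*) (\<lambda>f. B f g)) \<and>
     (\<forall>f. Vector_Spaces.linear scale_sf (*) (\<lambda>g. B f g)) \<and>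
     (\<forall>lam \<mu>. is_partition lam \<longrightarrow> is_partition \<mu> \<longrightarrow>
        B (power_sum_part lam) (power_sum_part \<mu>) =
          (if lam = \<mu> then of_nat (z_part lam) * jack_param ^ length lam else 0))"

lemma linear_form_add: "Vector_Spaces.linear scale_sf (*) \<phi> \<Longrightarrow> \<phi> (f + g) = \<phi> f + \<phi> g"
  for \<phi> :: "'a::field symfun \<Rightarrow> 'a"
  by (rule sf_scalars.linear_add)

lemma linear_form_scale: "Vector_Spaces.linear scale_sf (*) \<phi> \<Longrightarrow> \<phi> (scale_sf c g) = c * \<phi> g"
  for \<phi> :: "'a::field symfun \<Rightarrow> 'a"
  by (rule sf_scalars.linear_scale)

lemma linear_form_0: "Vector_Spaces.linear scale_sf (*) \<phi> \<Longrightarrow> \<phi> 0 = 0"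
  for \<phi> :: "'a::field symfun \<Rightarrow> 'a"
  by (rule sf_scalars.linear_0)

lemma linear_formI:
  fixes \<phi> :: "'a::field symfun \<Rightarrow> 'a"
  assumes "\<And>f g. \<phi> (f + g) = \<phi> f + \<phi> g" "\<And>c f. \<phi> (scale_sf c f) = c * \<phi> f"
  shows "Vector_Spaces.linear scale_sf (*) \<phi>"
  by (rule Vector_Spaces.linear.intro)
    (unfold_locales, auto simp: assms algebra_simps module_hom_axioms_def)

lemma jack_form_psum:
  assumes "jack_form B" "0 \<notin># J" "0 \<notin># K"
  shows "B (psum J) (psum K) = (if J = K then psum_norm J else 0)"
proof -
  have "B (power_sum_part (part_list J)) (power_sum_part (part_list K)) =
     (if part_list J = part_list K then of_nat (z_part (part_list J)) * jack_param ^ length (part_list J) else 0)"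
    using assms unfolding jack_form_def by (simp add: is_partition_part_list)
  then show ?thesis by (simp add: power_sum_part_eq z_part_eq psum_norm_def)
qed

lemma jack_form_unique:
  assumes B: "jack_form B" "jack_form B'"
  shows "B = B'"
proof (intro ext)
  fix f g
  have lin: "Vector_Spaces.linear scale_sf (*) (\<lambda>f. B f g)" "Vector_Spaces.linear scale_sf (*) (\<lambda>f. B' f g)"
    "Vector_Spaces.linear scale_sf (*) (\<lambda>g. B f g)" "Vector_Spaces.linear scale_sf (*) (\<lambda>g. B' f g)" for f g
    using B unfolding jack_form_def by simp_all
  have 1: "B (psum J) g = B' (psum J) g" if J: "0 \<notin># J" for J
  proof (induction g rule: symfun_induct)
    case (psum K)
    with J show ?case using jack_form_psum[OF B(1)] jack_form_psum[OF B(2)] by simp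
  qed (simp_all add: linear_form_0[OF lin(3)] linear_form_0[OF lin(4)] linear_form_add[OF lin(3)] linear_form_add[OF lin(4)] linear_form_scale[OF lin(3)] linear_form_scale[OF lin(4)])
  show "B f g = B' f g"
    by (induction f rule: symfun_induct)
      (simp_all add: 1 linear_form_0[OF lin(1)] linear_form_0[OF lin(2)] linear_form_add[OF lin(1)] linear_form_add[OF lin(2)] linear_form_scale[OF lin(1)] linear_form_scale[OF lin(2)])
qed

lemma jack_form_exists: "\<exists>B. jack_form B"
proof -
  \<comment> \<open>\<open>\<phi> J\<close> is to be the functional that pairs its argument with
    p_J.\<close>
  have "\<forall>J. \<exists>\<phi>. Vector_Spaces.linear scale_sf (*) \<phi> \<and> (\<forall>K. 0 \<notin># K \<longrightarrow> \<phi> (psum K) = (if J = K then psum_norm J else 0))"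
    by (intro allI linear_form_ext_psum)
  from choice[OF this] obtain \<phi> where \<phi>': "\<forall>J. Vector_Spaces.linear scale_sf (*) (\<phi> J) \<and>
    (\<forall>K. 0 \<notin># K \<longrightarrow> \<phi> J (psum K) = (if J = K then psum_norm J else 0))" ..
  then have \<phi>: "Vector_Spaces.linear scale_sf (*) (\<phi> J)"
    "0 \<notin># K \<Longrightarrow> \<phi> J (psum K) = (if J = K then psum_norm J else 0)" for J K by simp_all
  \<comment> \<open>For fixed g the values \<open>\<phi> J g\<close> are extended linearly in p_J.
    Linearity in g is not automatic for these separate choices and is verified on power
    sums.\<close>
  have "\<forall>g. \<exists>\<psi>. Vector_Spaces.linear scale_sf (*) \<psi> \<and> (\<forall>J. 0 \<notin># J \<longrightarrow> \<psi> (psum J) = \<phi> J g)"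
    by (intro allI linear_form_ext_psum)
  from choice[OF this] obtain \<psi> where \<psi>': "\<forall>g. Vector_Spaces.linear scale_sf (*) (\<psi> g) \<and>
    (\<forall>J. 0 \<notin># J \<longrightarrow> \<psi> g (psum J) = \<phi> J g)" ..
  then have \<psi>: "Vector_Spaces.linear scale_sf (*) (\<psi> g)"
    "0 \<notin># J \<Longrightarrow> \<psi> g (psum J) = \<phi> J g" for g J by simp_all
  note l = linear_form_0[OF \<psi>(1)] linear_form_add[OF \<psi>(1)] linear_form_scale[OF \<psi>(1)]
    \<psi>(2) linear_form_add[OF \<phi>(1)] linear_form_scale[OF \<phi>(1)]
  have "\<psi> (g + h) f = \<psi> g f + \<psi> h f" for f g h
    by (induction f rule: symfun_induct) (simp_all add: l algebra_simps)
  moreover have "\<psi> (scale_sf c g) f = c * \<psi> g f" for f g c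
    by (induction f rule: symfun_induct) (simp_all add: l algebra_simps)
  ultimately have "Vector_Spaces.linear scale_sf (*) (\<lambda>g. \<psi> g f)" for f
    by (intro linear_formI)
  moreover have "\<psi> (power_sum_part \<mu>) (power_sum_part lam) =
      (if lam = \<mu> then of_nat (z_part lam) * jack_param ^ length lam else 0)"
    if "is_partition lam" "is_partition \<mu>" for lam \<mu>
  proof -
    from that have *: "0 \<notin># mset lam" "0 \<notin># mset \<mu>" by (simp_all add: is_partition_def)
    have "mset lam = mset \<mu> \<longleftrightarrow> lam = \<mu>" using part_list_mset that by metis
    with * show ?thesis by (simp add: power_sum_part_eq \<psi> \<phi> z_part_eq psum_norm_def)
  qed
  ultimately have "jack_form (\<lambda>f g. \<psi> g f)"
    unfolding jack_form_def using \<psi>(1) by simp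
  then show ?thesis by blast
qed

lemma jack_form_jack_inner: "jack_form jack_inner"
proof -
  have "\<exists>!B. jack_form B" using jack_form_exists jack_form_unique by blast
  then have "jack_form (THE B. jack_form B)" by (rule theI')
  then show ?thesis unfolding jack_inner_def jack_form_def .
qed

lemma ji_psum: "0 \<notin># J \<Longrightarrow> 0 \<notin># K \<Longrightarrow> \<langle>psum J, psum K\<rangle> = (if J = K then psum_norm J else 0)"
  by (rule jack_form_psum[OF jack_form_jack_inner])

lemma ji_linear_left: "Vector_Spaces.linear scale_sf (*) (\<lambda>f. \<langle>f, g\<rangle>)"
  and ji_linear_right: "Vector_Spaces.linear scale_sf (*) (\<lambda>g. \<langle>f, g\<rangle>)"
  using jack_form_jack_inner unfolding jack_form_def by simp_all

lemma ji_linear [simp]: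
  "\<langle>0, g\<rangle> = 0" "\<langle>f, 0\<rangle> = 0"
  "\<langle>f + f', g\<rangle> = \<langle>f, g\<rangle> + \<langle>f', g\<rangle>" "\<langle>f, g + g'\<rangle> = \<langle>f, g\<rangle> + \<langle>f, g'\<rangle>"
  "\<langle>f - f', g\<rangle> = \<langle>f, g\<rangle> - \<langle>f', g\<rangle>" "\<langle>f, g - g'\<rangle> = \<langle>f, g\<rangle> - \<langle>f, g'\<rangle>"
  "\<langle>scale_sf c f, g\<rangle> = c * \<langle>f, g\<rangle>" "\<langle>f, scale_sf c g\<rangle> = c * \<langle>f, g\<rangle>"
  "\<langle>sum F S, g\<rangle> = (\<Sum>x\<in>S. \<langle>F x, g\<rangle>)" "\<langle>f, sum F S\<rangle> = (\<Sum>x\<in>S. \<langle>f, F x\<rangle>)"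
  using sf_scalars.linear_0[OF ji_linear_left] sf_scalars.linear_0[OF ji_linear_right]
    sf_scalars.linear_add[OF ji_linear_left] sf_scalars.linear_add[OF ji_linear_right]
    sf_scalars.linear_diff[OF ji_linear_left] sf_scalars.linear_diff[OF ji_linear_right]
    sf_scalars.linear_scale[OF ji_linear_left] sf_scalars.linear_scale[OF ji_linear_right]
    sf_scalars.linear_sum[OF ji_linear_left] sf_scalars.linear_sum[OF ji_linear_right]
  by simp_all

lemma ji_commute: "\<langle>f, g\<rangle> = \<langle>g, f\<rangle>"
proof (induction f rule: symfun_induct)
  case (psum J)
  show ?case by (induction g rule: symfun_induct) (auto simp: ji_psum psum)
qed simp_all

lemma ji_nondegenerate:
  assumes "\<And>J. 0 \<notin># J \<Longrightarrow> \<langle>f, psum J\<rangle> = 0"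
  shows "f = 0"
proof -
  obtain T c where T: "finite T" "T \<subseteq> positive_parts" "f = (\<Sum>J\<in>T. scale_sf (c J) (psum J))"
    by (rule psum_expand)
  have "c J = 0" if "J \<in> T" for J
  proof -
    have "0 = \<langle>f, psum J\<rangle>" using assms that T by auto
    also have "\<dots> = (\<Sum>K\<in>T. c K * \<langle>psum K, psum J\<rangle>)" by (simp add: T(3))
    also have "\<dots> = (\<Sum>K\<in>T. if J = K then c K * psum_norm K else 0)"
      using T(2) that by (intro sum.cong) (auto simp: ji_psum subset_iff)
    also have "\<dots> = c J * psum_norm J" using T(1) that by simp
    finally show ?thesis using psum_norm_nonzero[of J] T(2) that by auto
  qed
  then show ?thesis unfolding T(3) by (intro sum.neutral) simp
qed

lemma ji_eqI:
  assumes "\<And>h. \<langle>f, h\<rangle> = \<langle>g, h\<rangle>"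
  shows "f = g"
  using ji_nondegenerate[of "f - g"] assms by simp

text \<open>Adjoining a part k multiplies the norm of p_J by \<alpha> k (m_k + 1), where m_k is the
  multiplicity of k in J; the last factor is the one that differentiation produces.\<close>

lemma ji_power_sum_mult:
  assumes "0 < k"
  shows "\<langle>power_sum k * f, g\<rangle> = alpha * of_nat k * \<langle>f, pdrv k g\<rangle>"
proof (induction f rule: symfun_induct)
  case (psum J)
  show ?case
  proof (induction g rule: symfun_induct)
    case (psum K)
    have J: "0 \<notin># J" by fact
    have K: "0 \<notin># K - {#k#}" using \<open>0 \<notin># K\<close> by (meson in_diffD)
    have "\<langle>power_sum k * psum J, psum K\<rangle> = \<langle>psum (add_mset k J), psum K\<rangle>" by simp
    also have "\<dots> = (if add_mset k J = K then psum_norm (add_mset k J) else 0)"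
      by (rule ji_psum) (use J assms psum in auto)
    also have "\<dots> = alpha * of_nat k * (of_nat (count K k) * (if J = K - {#k#} then psum_norm J else 0))"
    proof (cases "k \<in># K")
      case True
      then have "add_mset k J = K \<longleftrightarrow> J = K - {#k#}" by auto
      moreover have "count K k = Suc (count J k)" if "J = K - {#k#}" using True that by simp
      ultimately show ?thesis by (simp add: psum_norm_add_mset del: of_nat_Suc)
    next
      case False
      then show ?thesis by (auto simp: not_in_iff)
    qed
    also have "\<dots> = alpha * of_nat k * \<langle>psum J, pdrv k (psum K)\<rangle>"
      using \<open>0 \<notin># K\<close> by (simp add: pdrv_psum ji_psum[OF J K])
    finally show ?case .
  qed (simp_all add: algebra_simps)
qed (simp_all add: algebra_simps scale_mult_right)

lemma ji_1_left: "\<langle>1, f\<rangle> = coeff_sf f {#}"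
proof (induction f rule: symfun_induct)
  case (psum J)
  have "coeff_sf (psum J) {#} = (if J = {#} then 1 else (0 :: ratfun))"
  proof (cases J)
    case (add k K)
    with psum have "0 < k" by auto
    from coeff_power_sum_mult[OF this, of "{}" "{#}" "psum K :: ratfun symfun"] show ?thesis by (simp add: add)
  qed (simp add: coeff_1)
  moreover have "\<langle>1, psum J\<rangle> = (if J = {#} then 1 else 0)"
    using ji_psum[of "{#}" J] psum by (auto simp: psum_norm_empty)
  ultimately show ?case by simp
qed simp_all

text \<open>Operators with an adjoint are closed under sums, scalars and composition, so the power
  sums suffice.\<close>

lemma adjoint_exists: "\<exists>T. \<forall>g h. \<langle>T g, h\<rangle> = \<langle>g, f * h\<rangle>"
proof (induction f rule: symfun_induct)
  case zero
  show ?case by (rule exI[of _ "\<lambda>_. 0"]) simp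
next
  case (add f f')
  then obtain T T' where "\<And>g h. \<langle>T g, h\<rangle> = \<langle>g, f * h\<rangle>" "\<And>g h. \<langle>T' g, h\<rangle> = \<langle>g, f' * h\<rangle>" by metis
  then show ?case by (intro exI[of _ "\<lambda>g. T g + T' g"]) (simp add: distrib_right)
next
  case (scale c f)
  then obtain T where "\<And>g h. \<langle>T g, h\<rangle> = \<langle>g, f * h\<rangle>" by metis
  then show ?case by (intro exI[of _ "\<lambda>g. scale_sf c (T g)"]) (simp add: scale_mult_left)
next
  case (psum J)
  then show ?case
  proof (induction J)
    case empty
    show ?case by (rule exI[of _ "\<lambda>g. g"]) simp
  next
    case (add k J)
    then obtain T where T: "\<And>g h. \<langle>T g, h\<rangle> = \<langle>g, psum J * h\<rangle>" by auto
    have k: "0 < k" using add.prems by auto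
    have "\<langle>T (scale_sf (alpha * of_nat k) (pdrv k g)), h\<rangle> = \<langle>g, psum (add_mset k J) * h\<rangle>" for g h
      using ji_power_sum_mult[OF k, of "psum J * h" g] ji_commute[of "power_sum k * (psum J * h)" g]
        ji_commute[of "pdrv k g" "psum J * h"] by (simp add: T mult.assoc)
    then show ?case by (intro exI[of _ "\<lambda>g. T (scale_sf (alpha * of_nat k) (pdrv k g))"]) simp
  qed
qed

lemma ji_mult_adjoint: "\<langle>mult_adjoint f g, h\<rangle> = \<langle>g, f * h\<rangle>"
proof -
  have "\<exists>!T. \<forall>g h. \<langle>T g, h\<rangle> = \<langle>g, f * h\<rangle>"
  proof (rule ex_ex1I[OF adjoint_exists])
    fix T T' assume "\<forall>g h. \<langle>T g, h\<rangle> = \<langle>g, f * h\<rangle>" "\<forall>g h. \<langle>T' g, h\<rangle> = \<langle>g, f * h\<rangle>"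
    then show "T = T'" by (intro ext ji_eqI) simp
  qed
  from theI'[OF this] show ?thesis unfolding mult_adjoint_def by blast
qed

lemma ji_psum_mon:
  assumes "0 \<notin># J" "0 \<notin># B" "sum_mset J \<noteq> sum_mset B"
  shows "\<langle>psum J, mon B\<rangle> = 0"
proof (rule sf.span_induct[OF mon_in_span_psum[OF assms(2)]])
  show "sf.subspace {x. \<langle>psum J, x\<rangle> = 0}" by (simp add: sf.subspace_def)
  show "\<langle>psum J, x\<rangle> = 0" if "x \<in> psum ` {J. 0 \<notin># J \<and> sum_mset J = sum_mset B}" for x
    using that assms by (auto simp: ji_psum)
qed

section \<open>Monomials and the scalar product\<close>

lemma count_image_inj: "inj f \<Longrightarrow> count (image_mset f M) (f x) = count M x"
proof -
  assume "inj f"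
  then have "f -` {f x} = {x}" by (auto dest: injD)
  then show ?thesis by (cases "x \<in># M") (simp_all add: count_image_mset not_in_iff)
qed

lemma exponents_image_inj:
  assumes "inj f"
  shows "exponents (image_mset f M) = exponents M"
proof -
  have "mset_set (f ` set_mset M) = image_mset f (mset_set (set_mset M))"
    by (simp add: image_mset_mset_set inj_on_subset[OF assms])
  then show ?thesis
    by (simp add: exponents_def multiset.map_comp comp_def count_image_inj[OF assms])
qed

text \<open>The coefficient of $y^k$ in $f(y, x_0, x_1, \dots)$. It is the adjoint of multiplication by
  the function dual to the monomial function of the one-part partition $(k)$.\<close>
lift_definition skew :: "nat \<Rightarrow> 'a::zero symfun \<Rightarrow> 'a symfun" is
  "\<lambda>k f M. f (image_mset Suc M + replicate_mset k 0)"
proof (intro conjI allI impI)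
  fix k and f :: "nat multiset \<Rightarrow> 'a" and \<pi> :: "nat \<Rightarrow> nat" and M
  assume f: "(\<forall>\<pi> M. bij \<pi> \<longrightarrow> f (image_mset \<pi> M) = f M) \<and> (\<exists>d. \<forall>M. d < size M \<longrightarrow> f M = 0)"
    and \<pi>: "bij \<pi>"
  define \<rho> where "\<rho> = case_nat 0 (\<lambda>i. Suc (\<pi> i))"
  have "bij \<rho>"
  proof (rule o_bij[of "case_nat 0 (\<lambda>i. Suc (inv \<pi> i))"])
    show "case_nat 0 (\<lambda>i. Suc (inv \<pi> i)) \<circ> \<rho> = id" "\<rho> \<circ> case_nat 0 (\<lambda>i. Suc (inv \<pi> i)) = id"
      using \<pi> by (auto simp: \<rho>_def fun_eq_iff bij_is_inj bij_is_surj surj_f_inv_f split: nat.split)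
  qed
  moreover have "image_mset \<rho> (image_mset Suc M + replicate_mset k 0) =
      image_mset Suc (image_mset \<pi> M) + replicate_mset k 0"
    by (simp add: \<rho>_def multiset.map_comp comp_def)
  ultimately show "f (image_mset Suc (image_mset \<pi> M) + replicate_mset k 0) =
      f (image_mset Suc M + replicate_mset k 0)"
    using f by metis
next
  fix k and f :: "nat multiset \<Rightarrow> 'a"
  assume f: "(\<forall>\<pi> M. bij \<pi> \<longrightarrow> f (image_mset \<pi> M) = f M) \<and> (\<exists>d. \<forall>M. d < size M \<longrightarrow> f M = 0)"
  then obtain d where "\<forall>M. d < size M \<longrightarrow> f M = 0" by blast
  then show "\<exists>d. \<forall>M. d < size M \<longrightarrow> f (image_mset Suc M + replicate_mset k 0) = 0"
    by (intro exI[of _ d]) simp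
qed

lemma coeff_skew: "coeff_sf (skew k f) M = coeff_sf f (image_mset Suc M + replicate_mset k 0)"
  by (simp add: skew.rep_eq)

lemma exponents_Suc_add:
  "0 < k \<Longrightarrow> exponents (image_mset Suc M + replicate_mset k 0) = add_mset k (exponents M)"
  using exponents_add_new[of 0 "image_mset Suc M" k] by (auto simp: exponents_image_inj)

lemma skew_0: "skew 0 f = f"
  by (rule symfun_eqI) (simp add: coeff_skew coeff_pcoeff[of f] exponents_image_inj)

lemma skew_mon: "0 < k \<Longrightarrow> skew k (mon B) = (if k \<in># B then mon (B - {#k#}) else 0)"
  by (rule symfun_eqI) (auto simp: coeff_skew coeff_mon exponents_Suc_add)

text \<open>The Euler identity in the additional variable y, read off at y^k. Dually it is a
  Newton-type recursion.\<close>

lemma skew_pdrv: "scale_sf (of_nat k) (skew k h) = (\<Sum>j=1..k. scale_sf (of_nat j) (skew (k - j) (pdrv j h)))"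
proof (rule symfun_eqI)
  fix M
  define N where "N = image_mset Suc M + replicate_mset k 0"
  have "0 \<notin># image_mset Suc M" by auto
  then have "count (image_mset Suc M) 0 = 0" by (rule not_in_iff[THEN iffD1])
  then have c: "count N 0 = k" by (simp add: N_def)
  have "coeff_sf (scale_sf (of_nat k) (skew k h)) M = of_nat (count N 0) * coeff_sf h N"
    by (simp only: coeff_scale coeff_skew c N_def[symmetric])
  also have "\<dots> = (\<Sum>j=1..k. of_nat j * mcoeff (pdrv j h) (replicate_mset j 0) N)"
    by (rule count_mult_coeff) (simp add: c)
  also have "\<dots> = (\<Sum>j=1..k. of_nat j * coeff_sf (skew (k - j) (pdrv j h)) M)"
  proof (intro sum.cong refl arg_cong2[where f = "(*)"])
    fix j assume "j \<in> {1..k}"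
    then have "replicate_mset k (0::nat) = replicate_mset (k - j) 0 + replicate_mset j 0"
      by (simp add: multiset_eq_iff)
    then have N: "N = (image_mset Suc M + replicate_mset (k - j) 0) + replicate_mset j 0"
      by (simp add: N_def)
    show "mcoeff (pdrv j h) (replicate_mset j 0) N = coeff_sf (skew (k - j) (pdrv j h)) M"
      unfolding N mcoeff_def coeff_skew by simp
  qed
  finally show "coeff_sf (scale_sf (of_nat k) (skew k h)) M =
      coeff_sf (\<Sum>j=1..k. scale_sf (of_nat j) (skew (k - j) (pdrv j h))) M" by simp
qed

text \<open>Take g_0 = 1 and let \<alpha> k g_k be the sum of p_j g_(k-j) over 1 \<le> j \<le> k;
  the generating series is exp(sum_j p_j y^j / (\<alpha> j)). Dualising \<open>skew_pdrv\<close>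
  shows inductively that multiplication by g_k is adjoint to \<open>skew k\<close>.\<close>

lemma skew_adjoint: "\<exists>g. \<forall>f h. \<langle>g * f, h\<rangle> = \<langle>f, skew k h\<rangle>"
proof (induction k rule: less_induct)
  case (less k)
  show ?case
  proof (cases "k = 0")
    case True
    then show ?thesis by (intro exI[of _ 1]) (simp add: skew_0)
  next
    case False
    have "\<forall>i. \<exists>g. i < k \<longrightarrow> (\<forall>f h. \<langle>g * f, h\<rangle> = \<langle>f, skew i h\<rangle>)"
      using less by blast
    from choice[OF this] obtain G where G: "\<And>i f h. i < k \<Longrightarrow> \<langle>G i * f, h\<rangle> = \<langle>f, skew i h\<rangle>"
      by blast
    define g where "g = scale_sf (inverse (alpha * of_nat k)) (\<Sum>j=1..k. power_sum j * G (k - j))"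
    have "\<langle>g * f, h\<rangle> = \<langle>f, skew k h\<rangle>" for f h
    proof -
      have "(\<Sum>j=1..k. power_sum j * G (k - j)) * f = (\<Sum>j=1..k. power_sum j * (G (k - j) * f))"
        by (simp add: sum_distrib_right mult.assoc)
      then have "\<langle>g * f, h\<rangle> = inverse (alpha * of_nat k) * (\<Sum>j=1..k. \<langle>power_sum j * (G (k - j) * f), h\<rangle>)"
        by (simp only: g_def scale_mult_left ji_linear)
      also have "(\<Sum>j=1..k. \<langle>power_sum j * (G (k - j) * f), h\<rangle>) =
          (\<Sum>j=1..k. alpha * (of_nat j * \<langle>f, skew (k - j) (pdrv j h)\<rangle>))"
        by (intro sum.cong refl) (simp add: ji_power_sum_mult G mult.assoc)
      also have "\<dots> = alpha * \<langle>f, scale_sf (of_nat k) (skew k h)\<rangle>"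
        unfolding skew_pdrv by (simp add: sum_distrib_left)
      also have "inverse (alpha * of_nat k) * \<dots> = \<langle>f, skew k h\<rangle>"
        using False by (simp add: field_simps)
      finally show ?thesis .
    qed
    then show ?thesis by blast
  qed
qed

text \<open>G is the product of the g_k over the parts k of A, and each factor strips one part off
  m_B. The case f = 1 gives the basis dual to the monomial functions.\<close>

lemma dual_mon_exists:
  assumes "0 \<notin># A"
  shows "\<exists>G. \<forall>B f. 0 \<notin># B \<longrightarrow> \<langle>G * f, mon B\<rangle> = (if A \<subseteq># B then \<langle>f, mon (B - A)\<rangle> else 0)"
  using assms
proof (induction A)
  case empty
  show ?case by (intro exI[of _ 1]) simp
next
  case (add k A)
  then have k: "0 < k" by auto
  from add obtain G where G: "\<And>B f. 0 \<notin># B \<Longrightarrow> \<langle>G * f, mon B\<rangle> = (if A \<subseteq># B then \<langle>f, mon (B - A)\<rangle> else 0)"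
    by auto
  obtain g where g: "\<And>f h. \<langle>g * f, h\<rangle> = \<langle>f, skew k h\<rangle>" using skew_adjoint[of k] by blast
  have "\<langle>g * G * f, mon B\<rangle> = (if add_mset k A \<subseteq># B then \<langle>f, mon (B - add_mset k A)\<rangle> else 0)"
    if B: "0 \<notin># B" for B f
  proof (cases "k \<in># B")
    case True
    have B': "0 \<notin># B - {#k#}" using B by (meson in_diffD)
    have "add_mset k A \<subseteq># B \<longleftrightarrow> A \<subseteq># B - {#k#}"
      using True by (simp add: insert_subset_eq_iff)
    then show ?thesis using True by (simp add: mult.assoc g skew_mon[OF k] G[OF B'])
  next
    case False
    then have "\<not> add_mset k A \<subseteq># B" by (auto dest: mset_subset_eq_insertD)
    with False show ?thesis by (simp add: mult.assoc g skew_mon[OF k])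
  qed
  then show ?case by blast
qed

lemma ji_nondegenerate_mon:
  assumes "\<And>B. 0 \<notin># B \<Longrightarrow> \<langle>f, mon B\<rangle> = 0"
  shows "f = 0"
proof (rule ji_nondegenerate)
  fix J :: "nat multiset"
  obtain D where D: "\<And>M. size M > D \<Longrightarrow> coeff_sf (psum J :: ratfun symfun) M = 0"
    using coeff_bounded[of "psum J :: ratfun symfun"] by blast
  show "\<langle>f, psum J\<rangle> = 0"
    by (subst expand_mon[OF D]) (auto simp: ptns_def assms intro!: sum.neutral)
qed

text \<open>Multiplication is adjoint to doubling the variables, which sends m_B to the sum of
  m_A(x) m_(B-A)(y). For f in the dual basis this is \<open>dual_mon_exists\<close>, and every p_J
  is a finite combination of that basis.\<close>

lemma ji_mult_mon:
  assumes B: "0 \<notin># B"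
  shows "\<langle>f * g, mon B\<rangle> = (\<Sum>A | A \<subseteq># B. \<langle>f, mon A\<rangle> * \<langle>g, mon (B - A)\<rangle>)"
proof (induction f rule: symfun_induct)
  case (psum J)
  have "\<forall>A. \<exists>G. 0 \<notin># A \<longrightarrow> (\<forall>B f. 0 \<notin># B \<longrightarrow> \<langle>G * f, mon B\<rangle> = (if A \<subseteq># B then \<langle>f, mon (B - A)\<rangle> else 0))"
    using dual_mon_exists by blast
  from choice[OF this] obtain G where G: "\<And>A B f. 0 \<notin># A \<Longrightarrow> 0 \<notin># B \<Longrightarrow>
    \<langle>G A * f, mon B\<rangle> = (if A \<subseteq># B then \<langle>f, mon (B - A)\<rangle> else 0)" by blast
  have dual: "\<langle>G A, mon B\<rangle> = (if A = B then 1 else 0)" if "0 \<notin># A" "0 \<notin># B" for A B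
  proof -
    have "exponents {#} = {#}" by (simp add: exponents_def)
    then have "\<langle>1, mon (B - A)\<rangle> = (if B - A = {#} then 1 else 0)"
      by (simp add: ji_1_left coeff_mon eq_commute[of "{#}"])
    moreover have "A \<subseteq># B \<and> B - A = {#} \<longleftrightarrow> A = B"
      by (auto simp: Diff_eq_empty_iff_mset)
    ultimately show ?thesis using G[OF that, of 1] by (auto split: if_splits)
  qed
  define S where "S = {A. 0 \<notin># A \<and> sum_mset A = sum_mset J}"
  have fin: "finite S"
    by (rule finite_subset[OF _ finite_ptns[of "sum_mset J"]]) (auto simp: S_def ptns_def)
  have "psum J - (\<Sum>A\<in>S. scale_sf \<langle>psum J, mon A\<rangle> (G A)) = 0"
  proof (rule ji_nondegenerate_mon)
    fix C :: "nat multiset" assume C: "0 \<notin># C"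
    have "\<langle>\<Sum>A\<in>S. scale_sf \<langle>psum J, mon A\<rangle> (G A), mon C\<rangle> = (\<Sum>A\<in>S. if A = C then \<langle>psum J, mon A\<rangle> else 0)"
      unfolding ji_linear by (intro sum.cong) (auto simp: S_def dual C)
    also have "\<dots> = \<langle>psum J, mon C\<rangle>"
      using fin C ji_psum_mon[OF psum C] by (auto simp: S_def)
    finally show "\<langle>psum J - (\<Sum>A\<in>S. scale_sf \<langle>psum J, mon A\<rangle> (G A)), mon C\<rangle> = 0" by simp
  qed
  then have eq: "psum J = (\<Sum>A\<in>S. scale_sf \<langle>psum J, mon A\<rangle> (G A))" by simp
  have "\<langle>psum J * g, mon B\<rangle> = (\<Sum>A\<in>S. \<langle>psum J, mon A\<rangle> * \<langle>G A * g, mon B\<rangle>)"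
    by (subst eq) (simp add: sum_distrib_right scale_mult_left)
  also have "\<dots> = (\<Sum>A\<in>S. if A \<subseteq># B then \<langle>psum J, mon A\<rangle> * \<langle>g, mon (B - A)\<rangle> else 0)"
    by (intro sum.cong) (auto simp: S_def G B)
  also have "\<dots> = (\<Sum>A | A \<in> S \<and> A \<subseteq># B. \<langle>psum J, mon A\<rangle> * \<langle>g, mon (B - A)\<rangle>)"
    using fin by (simp add: sum.inter_filter)
  also have "\<dots> = (\<Sum>A | A \<subseteq># B. \<langle>psum J, mon A\<rangle> * \<langle>g, mon (B - A)\<rangle>)"
  proof (rule sum.mono_neutral_left)
    show "\<forall>A\<in>{A. A \<subseteq># B} - {A. A \<in> S \<and> A \<subseteq># B}. \<langle>psum J, mon A\<rangle> * \<langle>g, mon (B - A)\<rangle> = 0"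
    proof
      fix A assume A: "A \<in> {A. A \<subseteq># B} - {A. A \<in> S \<and> A \<subseteq># B}"
      then have "0 \<notin># A" using B by (auto dest: mset_subset_eqD)
      moreover from this A have "sum_mset J \<noteq> sum_mset A" by (auto simp: S_def)
      ultimately show "\<langle>psum J, mon A\<rangle> * \<langle>g, mon (B - A)\<rangle> = 0" using ji_psum_mon[OF psum] by simp
    qed
  qed (auto simp: finite_submultisets)
  finally show ?case .
qed (simp_all add: distrib_right sum.distrib scale_mult_left sum_distrib_left mult.assoc)

section \<open>Jack families\<close>

locale jack_family =
  fixes P :: "nat list \<Rightarrow> ratfun symfun"
  assumes jack: "is_jack_family P"
begin

abbreviation PP :: "nat multiset \<Rightarrow> ratfun symfun" where "PP A \<equiv> P (part_list A)"

lemma ji_PP: "0 \<notin># A \<Longrightarrow> 0 \<notin># B \<Longrightarrow> A \<noteq> B \<Longrightarrow> \<langle>PP A, PP B\<rangle> = 0"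
  using jack unfolding is_jack_family_def by (simp add: is_partition_part_list)

lemma pcoeff_PP:
  assumes "0 \<notin># A"
  shows "pcoeff (PP A) A = 1" and "0 \<notin># B \<Longrightarrow> pcoeff (PP A) B \<noteq> 0 \<Longrightarrow> dom_le B A"
proof -
  define S where "S = {\<mu>. is_partition \<mu> \<and> dominates (part_list A) \<mu> \<and> \<mu> \<noteq> part_list A}"
  have pA: "is_partition (part_list A)" using assms by (simp add: is_partition_part_list)
  obtain c where c: "PP A = monomial_sf (part_list A) + (\<Sum>\<mu>\<in>S. scale_sf (c \<mu>) (monomial_sf \<mu>))"
    using jack pA unfolding is_jack_family_def S_def by blast
  have pcoeff: "pcoeff (PP A) B = (if A = B then 1 else 0) + (\<Sum>\<mu>\<in>S. c \<mu> * (if mset \<mu> = B then 1 else 0))"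
    if "0 \<notin># B" for B
    unfolding c pcoeff_def coeff_add coeff_sum coeff_scale monomial_sf.rep_eq exponents_canon[OF that]
    by (simp add: eq_commute[of B])
  have S: "mset \<mu> \<noteq> A \<and> dom_le (mset \<mu>) A" if "\<mu> \<in> S" for \<mu>
    using that part_list_mset dominates_imp_dom_le[OF pA] by (auto simp: S_def)
  have "(\<Sum>\<mu>\<in>S. c \<mu> * (if mset \<mu> = A then 1 else 0)) = 0" using S by (intro sum.neutral) auto
  then show "pcoeff (PP A) A = 1" using pcoeff[OF assms] by simp
  assume B: "0 \<notin># B" "pcoeff (PP A) B \<noteq> 0"
  show "dom_le B A"
  proof (cases "A = B")
    case False
    with B pcoeff[OF B(1)] have "(\<Sum>\<mu>\<in>S. c \<mu> * (if mset \<mu> = B then 1 else 0)) \<noteq> 0" by simp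
    then obtain \<mu> where "\<mu> \<in> S" "c \<mu> * (if mset \<mu> = B then 1 else 0) \<noteq> 0"
      by (rule sum.not_neutral_contains_not_neutral)
    then have "\<mu> \<in> S" "mset \<mu> = B" by (auto split: if_splits)
    with S show ?thesis by blast
  qed simp
qed

lemma coeff_PP: "0 \<notin># A \<Longrightarrow> coeff_sf (PP A) M \<noteq> 0 \<Longrightarrow> dom_le (exponents M) A"
  using pcoeff_PP(2) by (simp add: coeff_pcoeff)

lemma PP_expand_mon:
  assumes "0 \<notin># A"
  shows "PP A = (\<Sum>B\<in>ptns (sum_mset A). scale_sf (pcoeff (PP A) B) (mon B))"
    and "PP A = mon A + (\<Sum>B\<in>ptns (sum_mset A) - {A}. scale_sf (pcoeff (PP A) B) (mon B))"
proof -
  have "coeff_sf (PP A) M = 0" if "size M > sum_mset A" for M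
    using dom_le_sum[OF coeff_PP[OF assms, of M]] that by (cases "coeff_sf (PP A) M = 0") (simp_all add: size_exponents)
  then show 1: "PP A = (\<Sum>B\<in>ptns (sum_mset A). scale_sf (pcoeff (PP A) B) (mon B))"
    by (rule expand_mon)
  have "A \<in> ptns (sum_mset A)" using assms by (simp add: ptns_def)
  from sum.remove[OF finite_ptns this, of "\<lambda>B. scale_sf (pcoeff (PP A) B) (mon B)"]
  show "PP A = mon A + (\<Sum>B\<in>ptns (sum_mset A) - {A}. scale_sf (pcoeff (PP A) B) (mon B))"
    using 1 by (simp add: pcoeff_PP(1)[OF assms])
qed

text \<open>Descent in dominance terminates because it strictly lowers \<open>sumsq\<close>.\<close>

lemma mon_PP_induct [consumes 1, case_names step]:
  assumes "0 \<notin># A"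
    and "\<And>A. 0 \<notin># A \<Longrightarrow> (\<And>B. 0 \<notin># B \<Longrightarrow> dom_le B A \<Longrightarrow> B \<noteq> A \<Longrightarrow> Q B) \<Longrightarrow> Q A"
  shows "Q A"
  using assms(1)
proof (induction "sumsq A" arbitrary: A rule: less_induct)
  case less
  show ?case
    by (rule assms(2)[OF less.prems], rule less.hyps)
      (rule dom_le_sumsq(2), (assumption | rule less.prems)+)
qed

text \<open>Inverting the unitriangular expansion writes m_A in terms of the P_B with B below A, and
  orthogonality singles out B = L.\<close>

lemma ji_mon_PP:
  assumes "0 \<notin># A" "0 \<notin># L" "\<langle>mon A, PP L\<rangle> \<noteq> 0"
  shows "dom_le L A"
  using assms(1,3)
proof (induction A rule: mon_PP_induct)
  case (step A)
  define s where "s = (\<Sum>B\<in>ptns (sum_mset A) - {A}. pcoeff (PP A) B * \<langle>mon B, PP L\<rangle>)"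
  have eq: "\<langle>PP A, PP L\<rangle> = \<langle>mon A, PP L\<rangle> + s"
    by (subst PP_expand_mon(2)[OF step(1)]) (simp add: s_def)
  show ?case
  proof (cases "s = 0")
    case True
    then have "\<langle>PP A, PP L\<rangle> \<noteq> 0" using eq step(3) by simp
    then have "A = L" using ji_PP[OF step(1) assms(2)] by auto
    then show ?thesis by simp
  next
    case False
    then obtain B where B: "B \<in> ptns (sum_mset A) - {A}" "pcoeff (PP A) B * \<langle>mon B, PP L\<rangle> \<noteq> 0"
      unfolding s_def by (rule sum.not_neutral_contains_not_neutral)
    then have B0: "0 \<notin># B" "B \<noteq> A" "pcoeff (PP A) B \<noteq> 0" "\<langle>mon B, PP L\<rangle> \<noteq> 0" by (auto simp: ptns_def)
    have "dom_le B A" by (rule pcoeff_PP(2)[OF step(1) B0(1,3)])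
    from step(2)[OF B0(1) this B0(2,4)] this show ?thesis by (rule dom_le_trans)
  qed
qed

lemma ji_PP_upper:
  assumes "0 \<notin># L" "\<langle>f, PP L\<rangle> \<noteq> 0"
  obtains A where "0 \<notin># A" "dom_le L A" "pcoeff f A \<noteq> 0"
proof -
  obtain D where D: "\<And>M. size M > D \<Longrightarrow> coeff_sf f M = 0" using coeff_bounded[of f] by blast
  have "\<langle>f, PP L\<rangle> = (\<Sum>A\<in>ptns D. pcoeff f A * \<langle>mon A, PP L\<rangle>)"
    by (subst expand_mon[OF D]) simp_all
  with assms(2) have "(\<Sum>A\<in>ptns D. pcoeff f A * \<langle>mon A, PP L\<rangle>) \<noteq> 0" by simp
  then obtain A where A: "A \<in> ptns D" "pcoeff f A * \<langle>mon A, PP L\<rangle> \<noteq> 0"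
    by (rule sum.not_neutral_contains_not_neutral)
  then have "0 \<notin># A" "\<langle>mon A, PP L\<rangle> \<noteq> 0" "pcoeff f A \<noteq> 0" by (auto simp: ptns_def)
  with ji_mon_PP[of A L] assms(1) that show thesis by blast
qed

lemma span_PP: "sf.span (PP ` positive_parts) = UNIV"
proof -
  have mon: "mon A \<in> sf.span (PP ` positive_parts)" if "0 \<notin># A" for A
    using that
  proof (induction A rule: mon_PP_induct)
    case (step A)
    have "(\<Sum>B\<in>ptns (sum_mset A) - {A}. scale_sf (pcoeff (PP A) B) (mon B)) \<in> sf.span (PP ` positive_parts)"
    proof (rule sf.span_sum)
      fix B assume B: "B \<in> ptns (sum_mset A) - {A}"
      then have B0: "0 \<notin># B" "B \<noteq> A" by (auto simp: ptns_def)
      show "scale_sf (pcoeff (PP A) B) (mon B) \<in> sf.span (PP ` positive_parts)"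
      proof (cases "pcoeff (PP A) B = 0")
        case False
        from step(2)[OF B0(1) pcoeff_PP(2)[OF step(1) B0(1) False] B0(2)] show ?thesis by (rule sf.span_scale)
      qed (simp add: sf.span_zero)
    qed
    moreover have "PP A \<in> sf.span (PP ` positive_parts)" using step(1) by (intro sf.span_base) simp
    moreover have "mon A = PP A - (\<Sum>B\<in>ptns (sum_mset A) - {A}. scale_sf (pcoeff (PP A) B) (mon B))"
      using PP_expand_mon(2)[OF step(1)] by (simp only: eq_diff_eq)
    ultimately show ?case by (simp only: sf.span_diff)
  qed
  have "f \<in> sf.span (PP ` positive_parts)" for f
  proof -
    obtain D where D: "\<And>M. size M > D \<Longrightarrow> coeff_sf f M = 0" using coeff_bounded[of f] by blast
    have "(\<Sum>A\<in>ptns D. scale_sf (pcoeff f A) (mon A)) \<in> sf.span (PP ` positive_parts)"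
      by (intro sf.span_sum sf.span_scale mon) (simp add: ptns_def)
    then show ?thesis using expand_mon[OF D] by simp
  qed
  then show ?thesis by blast
qed

lemma ji_eqI_PP:
  assumes "\<And>A. 0 \<notin># A \<Longrightarrow> \<langle>f, PP A\<rangle> = \<langle>g, PP A\<rangle>"
  shows "f = g"
proof (rule ji_eqI)
  fix h
  have h: "h \<in> sf.span (PP ` positive_parts)" by (simp only: span_PP UNIV_I)
  show "\<langle>f, h\<rangle> = \<langle>g, h\<rangle>"
    by (rule sf.span_induct[OF h]) (use assms in \<open>auto simp: sf.subspace_def\<close>)
qed

lemma norm_PP:
  assumes "0 \<notin># A"
  shows "\<langle>PP A, PP A\<rangle> \<noteq> 0"
proof
  assume "\<langle>PP A, PP A\<rangle> = 0"
  then have "PP A = 0" using ji_PP[OF assms] by (intro ji_eqI_PP) (metis ji_linear(1))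
  then show False using pcoeff_PP(1)[OF assms] by (simp add: pcoeff_def)
qed

lemma inj_PP: "inj_on PP positive_parts"
proof (rule inj_onI)
  fix A B assume "A \<in> positive_parts" "B \<in> positive_parts" "PP A = PP B"
  then show "A = B" using ji_PP[of A B] norm_PP[of A] by auto
qed

text \<open>The last conjunct turns the occurrence of P_A in f into the nonvanishing of a pairing.
  Members of T may still carry coefficient zero.\<close>

lemma PP_expand:
  "\<exists>T c. finite T \<and> T \<subseteq> positive_parts \<and> f = (\<Sum>A\<in>T. scale_sf (c A) (PP A)) \<and>
    (\<forall>A. 0 \<notin># A \<longrightarrow> \<langle>f, PP A\<rangle> = (if A \<in> T then c A * \<langle>PP A, PP A\<rangle> else 0))"
proof -
  have "f \<in> sf.span (PP ` positive_parts)" by (simp only: span_PP UNIV_I)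
  then obtain t and r :: "ratfun symfun \<Rightarrow> ratfun" where
    t: "finite t" "t \<subseteq> PP ` positive_parts" "f = (\<Sum>a\<in>t. scale_sf (r a) a)"
    unfolding sf.span_explicit by (elim CollectE exE conjE) (rule that)
  obtain T where T: "T \<subseteq> positive_parts" "finite T" "t = PP ` T"
    using finite_subset_image[OF t(1,2)] by (elim exE conjE) (rule that)
  have f: "f = (\<Sum>A\<in>T. scale_sf (r (PP A)) (PP A))"
    unfolding t(3) T(3) by (rule sum.reindex[OF inj_on_subset[OF inj_PP T(1)], unfolded o_def])
  have "\<langle>f, PP A\<rangle> = (if A \<in> T then r (PP A) * \<langle>PP A, PP A\<rangle> else 0)" if "0 \<notin># A" for A
  proof -
    have "\<langle>f, PP A\<rangle> = (\<Sum>B\<in>T. r (PP B) * \<langle>PP B, PP A\<rangle>)" by (subst f) simp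
    also have "\<dots> = (\<Sum>B\<in>T. if A = B then r (PP A) * \<langle>PP A, PP A\<rangle> else 0)"
    proof (rule sum.cong[OF refl])
      fix B assume "B \<in> T"
      with T(1) have "0 \<notin># B" by auto
      then show "r (PP B) * \<langle>PP B, PP A\<rangle> = (if A = B then r (PP A) * \<langle>PP A, PP A\<rangle> else 0)"
        using ji_PP[of B A] that by auto
    qed
    finally show ?thesis using T(2) by simp
  qed
  then show ?thesis using T(1,2) f by (intro exI conjI) auto
qed

lemma ji_PP_mon_diag:
  assumes "0 \<notin># A"
  shows "\<langle>PP A, mon A\<rangle> = \<langle>PP A, PP A\<rangle>"
proof -
  have "(\<Sum>B\<in>ptns (sum_mset A) - {A}. pcoeff (PP A) B * \<langle>PP A, mon B\<rangle>) = 0"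
  proof (rule sum.neutral, rule ballI)
    fix B assume B: "B \<in> ptns (sum_mset A) - {A}"
    then have B0: "0 \<notin># B" "B \<noteq> A" by (auto simp: ptns_def)
    show "pcoeff (PP A) B * \<langle>PP A, mon B\<rangle> = 0"
      using pcoeff_PP(2)[OF assms B0(1)] ji_mon_PP[OF B0(1) assms] dom_le_antisym[OF B0(1) assms] B0(2)
      by (auto simp: ji_commute)
  qed
  moreover have "\<langle>PP A, PP A\<rangle> = \<langle>PP A, mon A\<rangle> + (\<Sum>B\<in>ptns (sum_mset A) - {A}. pcoeff (PP A) B * \<langle>PP A, mon B\<rangle>)"
    by (subst (2) PP_expand_mon(2)[OF assms]) simp
  ultimately show ?thesis by simp
qed

lemma ji_mult_PP_mon:
  assumes "0 \<notin># B" "0 \<notin># N" "\<langle>f * PP N, mon B\<rangle> \<noteq> 0"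
  obtains A where "A \<subseteq># B" "\<langle>f, mon A\<rangle> \<noteq> 0" "dom_le N (B - A)"
proof -
  from assms(3) obtain A where "A \<in> {A. A \<subseteq># B}" "\<langle>f, mon A\<rangle> * \<langle>PP N, mon (B - A)\<rangle> \<noteq> 0"
    unfolding ji_mult_mon[OF assms(1)] by (rule sum.not_neutral_contains_not_neutral)
  then have "A \<subseteq># B" "\<langle>f, mon A\<rangle> * \<langle>PP N, mon (B - A)\<rangle> \<noteq> 0" by simp_all
  moreover have "0 \<notin># B - A" using assms(1) by (meson in_diffD)
  ultimately show thesis using ji_mon_PP[OF _ assms(2), of "B - A"] that by (auto simp: ji_commute)
qed

text \<open>The other factor f is arbitrary. As a column (1^k) has excess 0 for t \<ge> 1, the case
  f = P_(1^k) contains the inequalities of N \<union> (1^k) \<le> L at every t \<ge> 1.\<close>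

lemma ji_mult_PP_lower:
  assumes "0 \<notin># N" "0 \<notin># L" "\<langle>f * PP N, PP L\<rangle> \<noteq> 0"
  shows "excess t N \<le> excess t L"
proof -
  have "\<langle>f * PP N, PP L\<rangle> = (\<Sum>B\<in>ptns (sum_mset L). pcoeff (PP L) B * \<langle>f * PP N, mon B\<rangle>)"
    by (subst PP_expand_mon(1)[OF assms(2)]) simp
  with assms(3) have "(\<Sum>B\<in>ptns (sum_mset L). pcoeff (PP L) B * \<langle>f * PP N, mon B\<rangle>) \<noteq> 0" by simp
  then obtain B where B: "B \<in> ptns (sum_mset L)" "pcoeff (PP L) B * \<langle>f * PP N, mon B\<rangle> \<noteq> 0"
    by (rule sum.not_neutral_contains_not_neutral)
  then have B0: "0 \<notin># B" "pcoeff (PP L) B \<noteq> 0" "\<langle>f * PP N, mon B\<rangle> \<noteq> 0" by (auto simp: ptns_def)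
  from ji_mult_PP_mon[OF B0(1) assms(1) B0(3)] obtain A where "dom_le N (B - A)" by blast
  then have "excess t N \<le> excess t (B - A)" by (rule dom_le_excess)
  also have "\<dots> \<le> excess t B" by (rule excess_mono) simp
  also have "\<dots> \<le> excess t L" by (rule dom_le_excess) (rule pcoeff_PP(2)[OF assms(2) B0(1,2)])
  finally show ?thesis .
qed

lemma coeff_mult_nonzero:
  assumes "coeff_sf (f * g :: 'b :: comm_ring_1 symfun) M \<noteq> 0"
  obtains X Y where "M = X + Y" "coeff_sf f X \<noteq> 0" "coeff_sf g Y \<noteq> 0"
proof -
  from assms obtain X where "X \<in> {X. X \<subseteq># M}" "coeff_sf f X * coeff_sf g (M - X) \<noteq> 0"
    unfolding coeff_mult by (rule sum.not_neutral_contains_not_neutral)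
  then have "M = X + (M - X)" "coeff_sf f X \<noteq> 0" "coeff_sf g (M - X) \<noteq> 0" by auto
  then show thesis by (rule that)
qed

lemma ji_mult_PP_sum:
  assumes "0 \<notin># N" "0 \<notin># N'" "0 \<notin># L" "\<langle>PP N * PP N', PP L\<rangle> \<noteq> 0"
  shows "sum_mset L = sum_mset N + sum_mset N'"
proof -
  obtain A where A: "0 \<notin># A" "dom_le L A" "pcoeff (PP N * PP N') A \<noteq> 0"
    using ji_PP_upper[OF assms(3,4)] by blast
  obtain X Y where XY: "canon A = X + Y" "coeff_sf (PP N) X \<noteq> 0" "coeff_sf (PP N') Y \<noteq> 0"
    using coeff_mult_nonzero A(3) unfolding pcoeff_def by blast
  have "sum_mset A = size X + size Y"
    using size_exponents[of "canon A"] unfolding exponents_canon[OF A(1)] by (simp add: XY(1))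
  then show ?thesis
    using dom_le_sum[OF A(2)] dom_le_sum[OF coeff_PP[OF assms(1) XY(2)]]
      dom_le_sum[OF coeff_PP[OF assms(2) XY(3)]] by (simp add: size_exponents)
qed

text \<open>No m_B with B strictly below T = N + S pairs with the product, so only the leading term
  of P_T counts. Among the splittings of T only the one into N and S contributes, with the product
  of two norms as its value.\<close>

lemma ji_mult_PP_union:
  assumes N: "0 \<notin># N" "0 \<notin># S"
  shows "\<langle>PP N * PP S, PP (N + S)\<rangle> \<noteq> 0"
proof -
  define T where "T = N + S"
  have T: "0 \<notin># T" using N by (simp add: T_def)
  have split: "\<exists>A. A \<subseteq># B \<and> dom_le N A \<and> dom_le S (B - A)"
    if B: "0 \<notin># B" and nz: "\<langle>PP N * PP S, mon B\<rangle> \<noteq> 0" for B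
  proof -
    obtain A where A: "A \<subseteq># B" "\<langle>PP N, mon A\<rangle> \<noteq> 0" "dom_le S (B - A)"
      by (rule ji_mult_PP_mon[OF B N(2) nz])
    have "0 \<notin># A" using A(1) B by (meson mset_subset_eqD)
    with ji_mon_PP[OF _ N(1), of A] A show ?thesis by (auto simp: ji_commute)
  qed
  have le: "dom_le T B" if A: "A \<subseteq># B" "dom_le N A" "dom_le S (B - A)" for A B
  proof -
    have "B = A + (B - A)" using A(1) by simp
    then have "excess t B = excess t A + excess t (B - A)" for t by (metis excess_simps(3))
    moreover from this[of 0] have "sum_mset B = sum_mset A + sum_mset (B - A)" by simp
    ultimately show ?thesis
      using dom_le_excess[OF A(2)] dom_le_excess[OF A(3)] dom_le_sum[OF A(2)] dom_le_sum[OF A(3)]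
      unfolding dom_le_def T_def by (simp add: add_mono)
  qed
  have "(\<Sum>B\<in>ptns (sum_mset T) - {T}. pcoeff (PP T) B * \<langle>PP N * PP S, mon B\<rangle>) = 0"
  proof (rule sum.neutral, rule ballI)
    fix B assume "B \<in> ptns (sum_mset T) - {T}"
    then have B: "0 \<notin># B" "B \<noteq> T" by (auto simp: ptns_def)
    show "pcoeff (PP T) B * \<langle>PP N * PP S, mon B\<rangle> = 0"
      using split[OF B(1)] le pcoeff_PP(2)[OF T B(1)] dom_le_antisym[OF B(1) T] B(2) by fastforce
  qed
  then have "\<langle>PP N * PP S, PP T\<rangle> = \<langle>PP N * PP S, mon T\<rangle>"
    by (subst PP_expand_mon(2)[OF T]) simp
  also have "\<dots> = (\<Sum>A | A \<subseteq># T. if A = N then \<langle>PP N, mon N\<rangle> * \<langle>PP S, mon S\<rangle> else 0)"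
    unfolding ji_mult_mon[OF T]
  proof (rule sum.cong[OF refl])
    fix A assume "A \<in> {A. A \<subseteq># T}"
    then have A: "A \<subseteq># T" by simp
    have A0: "0 \<notin># A" "0 \<notin># T - A" using A T by (meson mset_subset_eqD, meson in_diffD)
    show "\<langle>PP N, mon A\<rangle> * \<langle>PP S, mon (T - A)\<rangle> = (if A = N then \<langle>PP N, mon N\<rangle> * \<langle>PP S, mon S\<rangle> else 0)"
    proof (cases "\<langle>PP N, mon A\<rangle> * \<langle>PP S, mon (T - A)\<rangle> = 0")
      case True
      then show ?thesis by (auto simp: T_def)
    next
      case False
      then have dom: "dom_le N A" "dom_le S (T - A)"
        using ji_mon_PP[OF A0(1) N(1)] ji_mon_PP[OF A0(2) N(2)] by (auto simp: ji_commute)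
      have "T = A + (T - A)" using A by simp
      then have "excess t N + excess t S = excess t A + excess t (T - A)" for t by (metis excess_simps(3) T_def)
      \<comment> \<open>Two inequalities whose sums agree are both equalities.\<close>
      then have "excess t N = excess t A" for t
        using dom_le_excess[OF dom(1), of t] dom_le_excess[OF dom(2), of t] by (metis add_le_cancel_left add_le_cancel_right antisym add_mono le_refl order_trans)
      then have "A = N" using multiset_eqI_excess[OF N(1) A0(1)] by simp
      then show ?thesis by (simp add: T_def)
    qed
  qed
  also have "\<dots> = \<langle>PP N, PP N\<rangle> * \<langle>PP S, PP S\<rangle>"
    by (simp add: finite_submultisets T_def ji_PP_mon_diag N)
  finally show ?thesis using norm_PP N by (simp add: T_def)
qed

end

section \<open>The Laplace--Beltrami operator\<close>

text \<open>In $n$ variables this is $2\alpha\sum_i (x_i\partial_i)^2 +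
  \sum_{i\neq j} \frac{x_i+x_j}{x_i-x_j}(x_i\partial_i - x_j\partial_j)$ on functions of degree at
  most \<open>N\<close>, rewritten in power sums.\<close>
definition laplace_op :: "nat \<Rightarrow> nat \<Rightarrow> ratfun symfun \<Rightarrow> ratfun symfun" where
  "laplace_op n N f =
    (\<Sum>b=1..N. \<Sum>s=1..<b. scale_sf (2 * alpha * of_nat s * of_nat (b - s)) (power_sum b * pdrv s (pdrv (b - s) f))
       + scale_sf (2 * of_nat b) (power_sum s * (power_sum (b - s) * pdrv b f))) +
    (\<Sum>b=1..N. scale_sf (2 * of_nat b * (alpha * of_nat b + of_nat n - of_nat b)) (power_sum b * pdrv b f))"

lemma ji_power_sum_mult': "0 < k \<Longrightarrow> \<langle>f, power_sum k * g\<rangle> = alpha * of_nat k * \<langle>pdrv k f, g\<rangle>"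
  using ji_power_sum_mult[of k g f] by (simp add: ji_commute)

text \<open>Both sides are \<alpha>^2 b s (b - s) times the same pairing of derivatives. The
  splitting and joining terms of \<open>laplace_op\<close> are thus adjoint with exactly the
  coefficients they carry there.\<close>

lemma split_join_adjoint:
  assumes "0 < s" "s < b"
  shows "alpha * of_nat s * of_nat (b - s) * \<langle>power_sum b * pdrv s (pdrv (b - s) f), g\<rangle> =
    of_nat b * \<langle>f, power_sum s * (power_sum (b - s) * pdrv b g)\<rangle>"
proof -
  have *: "power_sum s * (power_sum (b - s) * pdrv b g) = power_sum (b - s) * (power_sum s * pdrv b g)"
    by (rule mult.left_commute)
  show ?thesis unfolding * using assms
    by (simp add: ji_power_sum_mult ji_power_sum_mult' del: of_nat_diff)
qed

lemma laplace_op_self_adjoint: "\<langle>laplace_op n N f, g\<rangle> = \<langle>f, laplace_op n N g\<rangle>"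
proof -
  have 1: "2 * alpha * of_nat s * of_nat (b - s) * \<langle>power_sum b * pdrv s (pdrv (b - s) f), g\<rangle> +
      2 * of_nat b * \<langle>power_sum s * (power_sum (b - s) * pdrv b f), g\<rangle> =
      2 * alpha * of_nat s * of_nat (b - s) * \<langle>f, power_sum b * pdrv s (pdrv (b - s) g)\<rangle> +
      2 * of_nat b * \<langle>f, power_sum s * (power_sum (b - s) * pdrv b g)\<rangle>"
    if "s \<in> {1..<b}" for b s
    using split_join_adjoint[of s b f g] split_join_adjoint[of s b g f] that
    by (simp add: ji_commute[of "power_sum s * (power_sum (b - s) * pdrv b f)" g]
        ji_commute[of f "power_sum b * pdrv s (pdrv (b - s) g)"] mult.assoc del: of_nat_diff)
  have 2: "\<langle>power_sum b * pdrv b f, g\<rangle> = \<langle>f, power_sum b * pdrv b g\<rangle>" if "b \<in> {1..N}" for b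
    using that by (simp add: ji_power_sum_mult ji_power_sum_mult')
  show ?thesis unfolding laplace_op_def ji_linear
    by (rule arg_cong2[where f = "(+)"]; intro sum.cong refl)
      (rule 1, assumption, rule arg_cong[where f = "\<lambda>x. c * x" for c], rule 2, assumption)
qed

lemma replicate_mset_add: "replicate_mset (a + b) x = replicate_mset a x + replicate_mset b x"
  by (simp add: multiset_eq_iff)

lemma mcoeff_cancel: "mcoeff f (N + K) (M + K) = mcoeff f N M"
  by (simp add: mcoeff_def)

lemma mcoeff_eq_0: "count M i < count N i \<Longrightarrow> mcoeff f N M = 0"
  by (auto simp: mcoeff_def dest: mset_subset_eq_count[of _ _ i])

lemma sum_split_triangle:
  fixes h :: "nat \<Rightarrow> nat \<Rightarrow> 'b::comm_monoid_add"
  assumes "\<And>t s. N < t + s \<Longrightarrow> h t s = 0"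
  shows "(\<Sum>t=1..N. \<Sum>s=1..N. h t s) = (\<Sum>b=1..N. \<Sum>s=1..<b. h (b - s) s)"
proof -
  have "(\<Sum>t=1..N. \<Sum>s=1..N. h t s) = (\<Sum>(t, s)\<in>{1..N} \<times> {1..N}. h t s)"
    by (simp add: sum.cartesian_product)
  also have "\<dots> = (\<Sum>(t, s)\<in>{(t, s). 1 \<le> t \<and> 1 \<le> s \<and> t + s \<le> N}. h t s)"
    by (rule sum.mono_neutral_right) (auto intro!: assms)
  also have "\<dots> = (\<Sum>(b, s)\<in>(SIGMA b:{1..N}. {1..<b}). h (b - s) s)"
    by (rule sum.reindex_bij_witness[of _ "\<lambda>(b, s). (b - s, s)" "\<lambda>(t, s). (t + s, s)"]) auto
  also have "\<dots> = (\<Sum>b=1..N. \<Sum>s=1..<b. h (b - s) s)"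
    by (simp add: sum.Sigma)
  finally show ?thesis .
qed

text \<open>The Euler operator is applied twice. The second application meets either the prefactor
  x_i^t, giving t^2, or the derivative, giving second derivatives.\<close>

lemma count_squared_mult_coeff:
  fixes f :: "'a::field_char_0 symfun"
  assumes "count M i \<le> N"
  shows "(of_nat (count M i))\<^sup>2 * coeff_sf f M =
    (\<Sum>b=1..N. \<Sum>s=1..<b. of_nat s * of_nat (b - s) * mcoeff (pdrv s (pdrv (b - s) f)) (replicate_mset b i) M) +
    (\<Sum>b=1..N. of_nat b * of_nat b * mcoeff (pdrv b f) (replicate_mset b i) M)"
proof -
  define h where "h t s = of_nat s * of_nat t * mcoeff (pdrv s (pdrv t f)) (replicate_mset (t + s) i) M" for t s
  have step: "of_nat (count M i) * mcoeff (pdrv t f) (replicate_mset t i) M =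
      of_nat t * mcoeff (pdrv t f) (replicate_mset t i) M +
      (\<Sum>s=1..N. of_nat s * mcoeff (pdrv s (pdrv t f)) (replicate_mset (t + s) i) M)" for t
    using count_mult_mcoeff[OF assms, of "replicate_mset t i" "pdrv t f"]
    by (simp add: algebra_simps replicate_mset_add)
  have "(of_nat (count M i))\<^sup>2 * coeff_sf f M = of_nat (count M i) * (\<Sum>t=1..N. of_nat t * mcoeff (pdrv t f) (replicate_mset t i) M)"
    using count_mult_coeff[OF assms, of f] by (simp add: power2_eq_square mult.assoc)
  also have "\<dots> = (\<Sum>t=1..N. of_nat t * (of_nat (count M i) * mcoeff (pdrv t f) (replicate_mset t i) M))"
    by (simp only: sum_distrib_left mult.left_commute)
  also have "\<dots> = (\<Sum>t=1..N. of_nat t * of_nat t * mcoeff (pdrv t f) (replicate_mset t i) M) + (\<Sum>t=1..N. \<Sum>s=1..N. h t s)"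
    unfolding step distrib_left sum.distrib h_def by (simp add: sum_distrib_left mult_ac)
  also have "(\<Sum>t=1..N. \<Sum>s=1..N. h t s) = (\<Sum>b=1..N. \<Sum>s=1..<b. h (b - s) s)"
    by (rule sum_split_triangle) (use assms in \<open>auto simp: h_def intro!: mcoeff_eq_0[of _ i]\<close>)
  also have "\<dots> = (\<Sum>b=1..N. \<Sum>s=1..<b. of_nat s * of_nat (b - s) * mcoeff (pdrv s (pdrv (b - s) f)) (replicate_mset b i) M)"
    by (intro sum.cong refl) (simp add: h_def)
  finally show ?thesis by (simp only: add.commute)
qed

section \<open>Differential operators acting on coefficients in n variables\<close>

definition move :: "nat \<Rightarrow> nat \<Rightarrow> nat \<Rightarrow> nat multiset \<Rightarrow> nat multiset" where
  "move i j s M = M - replicate_mset s j + replicate_mset s i"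

definition euler_diff :: "nat \<Rightarrow> nat \<Rightarrow> (nat multiset \<Rightarrow> ratfun) \<Rightarrow> nat multiset \<Rightarrow> ratfun" where
  "euler_diff i j u M = (of_nat (count M i) - of_nat (count M j)) * u M"

text \<open>The coefficient of $x^M$ in $\frac{x_i+x_j}{x_i-x_j}(x_i\partial_i - x_j\partial_j) \sum_M u_M x^M$,
  obtained by expanding the quotient as a power series in $x_j / x_i$.\<close>
definition quot_coeff :: "nat \<Rightarrow> nat \<Rightarrow> (nat multiset \<Rightarrow> ratfun) \<Rightarrow> nat multiset \<Rightarrow> ratfun" where
  "quot_coeff i j u M = euler_diff i j u M + 2 * (\<Sum>s=1..count M j. euler_diff i j u (move i j s M))"

text \<open>The same quotient without division: (x_i + x_j)(x_i^b - x_j^b) / (x_i - x_j) is x_i^b +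
  x_j^b plus twice the sum of the mixed monomials of degree b. This form is symmetric in i and
  j.\<close>

definition quot_drv :: "nat \<Rightarrow> nat \<Rightarrow> nat \<Rightarrow> ratfun symfun \<Rightarrow> nat multiset \<Rightarrow> ratfun" where
  "quot_drv N i j f M = (\<Sum>b=1..N. of_nat b * (mcoeff (pdrv b f) (replicate_mset b i) M + mcoeff (pdrv b f) (replicate_mset b j) M +
     2 * (\<Sum>s=1..<b. mcoeff (pdrv b f) (replicate_mset s i + replicate_mset (b - s) j) M)))"

lemma quot_drv_commute: "quot_drv N i j f M = quot_drv N j i f M"
proof -
  have "(\<Sum>s=1..<b. mcoeff (pdrv b f) (replicate_mset s i + replicate_mset (b - s) j) M) =
      (\<Sum>s=1..<b. mcoeff (pdrv b f) (replicate_mset s j + replicate_mset (b - s) i) M)" for b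
    by (rule sum.reindex_bij_witness[of _ "\<lambda>s. b - s" "\<lambda>s. b - s"]) (auto simp: add.commute)
  then show ?thesis by (simp add: quot_drv_def add.commute add.left_commute)
qed

lemma count_move: "i \<noteq> j \<Longrightarrow> count (move i j s M) k =
    (if k = i then count M i + s else if k = j then count M j - s else count M k)"
  by (auto simp: move_def)

text \<open>Write M as x_j times L. Then this compares the coefficients of x_i x_j L in (x_i - x_j)
  q = (x_i + x_j) e, where q is the quotient series and e the difference of Euler operators applied
  to u.\<close>

lemma quot_coeff_step:
  assumes ij: "i \<noteq> j" and j: "j \<in># M"
  shows "quot_coeff i j u M = quot_coeff i j u (move i j 1 M) + euler_diff i j u M + euler_diff i j u (move i j 1 M)"
proof -
  obtain m where m: "count M j = Suc m" using j by (cases "count M j") (auto simp: not_in_iff[symmetric])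
  have move: "move i j s (move i j 1 M) = move i j (Suc s) M" for s
    using ij by (intro multiset_eqI) (simp add: count_move)
  have "(\<Sum>s=1..Suc m. euler_diff i j u (move i j s M)) = euler_diff i j u (move i j 1 M) + (\<Sum>s=Suc 1..Suc m. euler_diff i j u (move i j s M))"
    by (rule sum.atLeast_Suc_atMost) simp
  also have "(\<Sum>s=Suc 1..Suc m. euler_diff i j u (move i j s M)) = (\<Sum>s=1..m. euler_diff i j u (move i j (Suc s) M))"
    by (rule sum.shift_bounds_cl_Suc_ivl)
  finally show ?thesis
    using ij by (simp add: quot_coeff_def m move count_move del: One_nat_def)
qed

text \<open>The equation of \<open>quot_coeff_step\<close> for the division-free form, checked
  separately for each derivative with respect to p_b.\<close>

lemma quot_drv_step:
  assumes ij: "i \<noteq> j" and j: "j \<in># M" and N: "size M \<le> N"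
  shows "quot_drv N i j f M = quot_drv N i j f (move i j 1 M) + euler_diff i j (coeff_sf f) M + euler_diff i j (coeff_sf f) (move i j 1 M)"
proof -
  obtain L where M: "M = add_mset j L" using j by (metis multi_member_split)
  have M1: "move i j 1 M = add_mset i L" by (simp add: M move_def)
  define M' where "M' = add_mset i L"
  define k where "k b s t = mcoeff (pdrv b f) (replicate_mset s i + replicate_mset t j) L" for b s t
  define U where "U b = mcoeff (pdrv b f) (replicate_mset b i) M" for b
  define V where "V b = mcoeff (pdrv b f) (replicate_mset b j) M'" for b
  have kM: "mcoeff (pdrv b f) (replicate_mset s i + replicate_mset (Suc t) j) M = k b s t" for b s t
    using mcoeff_cancel[of "pdrv b f" "replicate_mset s i + replicate_mset t j" "{#j#}" L] by (simp add: k_def M)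
  have kM': "mcoeff (pdrv b f) (replicate_mset (Suc s) i + replicate_mset t j) M' = k b s t" for b s t
    using mcoeff_cancel[of "pdrv b f" "replicate_mset s i + replicate_mset t j" "{#i#}" L] by (simp add: k_def M'_def)
  have cnt: "count Z z \<le> N" if "size Z \<le> N" for Z and z :: nat
    using that count_le_size[of Z z] by linarith
  have N': "size M' \<le> N" using N by (simp add: M M'_def)
  have F: "euler_diff i j (coeff_sf f) Z = (\<Sum>b=1..N. of_nat b * (mcoeff (pdrv b f) (replicate_mset b i) Z - mcoeff (pdrv b f) (replicate_mset b j) Z))"
    if "size Z \<le> N" for Z
    unfolding euler_diff_def left_diff_distrib count_mult_coeff[OF cnt[OF that]]
    by (simp only: sum_subtractf right_diff_distrib)
  have "quot_drv N i j f M - quot_drv N i j f M' - euler_diff i j (coeff_sf f) M - euler_diff i j (coeff_sf f) M' = 0"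
    unfolding quot_drv_def F[OF N] F[OF N'] sum_subtractf[symmetric]
  proof (rule sum.neutral, rule ballI)
    fix b assume "b \<in> {1..N}"
    then obtain c where b: "b = Suc c" by (cases b) auto
    have 1: "mcoeff (pdrv b f) (replicate_mset b j) M = k b 0 c" using kM[of b 0 c] by (simp add: b)
    have 2: "mcoeff (pdrv b f) (replicate_mset b i) M' = k b c 0" using kM'[of b c 0] by (simp add: b)
    have 3: "(\<Sum>s=1..<b. mcoeff (pdrv b f) (replicate_mset s i + replicate_mset (b - s) j) M) = (\<Sum>s=1..<Suc c. k b s (c - s))"
      unfolding b by (intro sum.cong refl) (metis kM Suc_diff_le atLeastLessThan_iff less_Suc_eq_le b)
    have 4: "(\<Sum>s=1..<b. mcoeff (pdrv b f) (replicate_mset s i + replicate_mset (b - s) j) M') = (\<Sum>s<c. k b s (c - s))"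
      unfolding b by (rule sum.reindex_bij_witness[of _ Suc "\<lambda>s. s - 1"]) (auto simp: b simp flip: kM')
    \<comment> \<open>Both sums run along the antidiagonal of total degree c and differ only in
      their endpoints.\<close>
    have 5: "(\<Sum>s<c. k b s (c - s)) + k b c 0 = k b 0 c + (\<Sum>s=1..<Suc c. k b s (c - s))"
    proof -
      have "(\<Sum>s<Suc c. k b s (c - s)) = k b 0 c + (\<Sum>s<c. k b (Suc s) (c - Suc s))"
        by (subst sum.lessThan_Suc_shift) simp
      also have "(\<Sum>s<c. k b (Suc s) (c - Suc s)) = (\<Sum>s=1..<Suc c. k b s (c - s))"
        by (rule sum.reindex_bij_witness[of _ "\<lambda>s. s - 1" Suc]) auto
      finally show ?thesis by simp
    qed
    define X where "X = (\<Sum>s=1..<Suc c. k b s (c - s))"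
    define Y where "Y = (\<Sum>s<c. k b s (c - s))"
    have XY: "X = Y + k b c 0 - k b 0 c" using 5 unfolding X_def Y_def by (simp add: algebra_simps)
    show "of_nat b * (mcoeff (pdrv b f) (replicate_mset b i) M + mcoeff (pdrv b f) (replicate_mset b j) M +
        2 * (\<Sum>s=1..<b. mcoeff (pdrv b f) (replicate_mset s i + replicate_mset (b - s) j) M)) -
      of_nat b * (mcoeff (pdrv b f) (replicate_mset b i) M' + mcoeff (pdrv b f) (replicate_mset b j) M' +
        2 * (\<Sum>s=1..<b. mcoeff (pdrv b f) (replicate_mset s i + replicate_mset (b - s) j) M')) -
      of_nat b * (mcoeff (pdrv b f) (replicate_mset b i) M - mcoeff (pdrv b f) (replicate_mset b j) M) -
      of_nat b * (mcoeff (pdrv b f) (replicate_mset b i) M' - mcoeff (pdrv b f) (replicate_mset b j) M') = 0"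
      unfolding 1 2 3 4 X_def[symmetric] Y_def[symmetric] XY by (simp add: algebra_simps)
  qed
  then show ?thesis unfolding M1 M'_def[symmetric] by (simp add: algebra_simps)
qed

text \<open>Both sides obey the same recursion, which lowers the exponent of x_j. Once x_j is
  absent, neither a series term nor a mixed term is left.\<close>

lemma quot_drv_eq_quot_coeff:
  assumes "i \<noteq> j" "size M \<le> N"
  shows "quot_drv N i j f M = quot_coeff i j (coeff_sf f) M"
  using assms(2)
proof (induction "count M j" arbitrary: M)
  case 0
  have z: "mcoeff (pdrv b f) Z M = 0" if "j \<in># Z" for b Z
    using that 0 by (intro mcoeff_eq_0[of _ j]) simp
  have "count M i \<le> N" using 0 count_le_size[of M i] by linarith
  then have "of_nat (count M i) * coeff_sf f M = (\<Sum>b=1..N. of_nat b * mcoeff (pdrv b f) (replicate_mset b i) M)"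
    by (rule count_mult_coeff)
  moreover have "quot_drv N i j f M = (\<Sum>b=1..N. of_nat b * mcoeff (pdrv b f) (replicate_mset b i) M)"
    unfolding quot_drv_def by (intro sum.cong refl) (simp add: z sum.neutral)
  moreover have "quot_coeff i j (coeff_sf f) M = of_nat (count M i) * coeff_sf f M"
    using 0 by (simp add: quot_coeff_def euler_diff_def)
  ultimately show ?case by simp
next
  case (Suc m)
  have j: "j \<in># M" using Suc(2) by (metis count_eq_zero_iff nat.distinct(1))
  obtain L where "M = add_mset j L" using j by (metis multi_member_split)
  then have sz: "size (move i j 1 M) \<le> N" using Suc(3) by (simp add: move_def)
  have "m = count (move i j 1 M) j" using Suc(2) assms(1) by (simp add: count_move)
  from Suc(1)[OF this sz] show ?case
    by (simp only: quot_drv_step[OF assms(1) j Suc(3)] quot_coeff_step[OF assms(1) j])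
qed

text \<open>Expansions in x_j / x_i and in x_i / x_j agree since the quotient is a polynomial in
  both variables. The direction of expansion may thus be chosen freely.\<close>

lemma quot_coeff_coeff_commute: "i \<noteq> j \<Longrightarrow> quot_coeff i j (coeff_sf f) M = quot_coeff j i (coeff_sf f) M"
  using quot_drv_eq_quot_coeff[of i j M "size M" f] quot_drv_eq_quot_coeff[of j i M "size M" f] quot_drv_commute by simp

definition laplace_coeff :: "nat \<Rightarrow> (nat multiset \<Rightarrow> ratfun) \<Rightarrow> nat multiset \<Rightarrow> ratfun" where
  "laplace_coeff n u M = 2 * alpha * of_nat (\<Sum>i<n. (count M i)\<^sup>2) * u M + (\<Sum>i<n. \<Sum>j\<in>{..<n} - {i}. quot_coeff i j u M)"

lemma coeff_laplace_op:
  assumes M: "set_mset M \<subseteq> {..<n}" and N: "size M \<le> N"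
  shows "coeff_sf (laplace_op n N f) M = laplace_coeff n (coeff_sf f) M"
proof -
  define A where "A b i = mcoeff (pdrv b f) (replicate_mset b i) M" for b i
  define C where "C b i j = (\<Sum>s=1..<b. mcoeff (pdrv b f) (replicate_mset s i + replicate_mset (b - s) j) M)" for b i j
  define D where "D b i = (\<Sum>s=1..<b. of_nat s * of_nat (b - s) * mcoeff (pdrv s (pdrv (b - s) f)) (replicate_mset b i) M)" for b i
  have cnt: "count M i \<le> N" for i using N count_le_size[of M i] by linarith
  have p1: "coeff_sf (power_sum b * g) M = (\<Sum>i<n. mcoeff g (replicate_mset b i) M)" if "0 < b" for b g
    by (rule coeff_power_sum_mult[OF that _ M]) simp
  have p2: "coeff_sf (power_sum s * (power_sum t * g)) M =
      (\<Sum>i<n. \<Sum>j<n. mcoeff g (replicate_mset s i + replicate_mset t j) M)" if "0 < s" "0 < t" for s t g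
    using that by (simp add: p1 mcoeff_power_sum_mult[OF _ _ M])
  have S1: "(\<Sum>s=1..<b. coeff_sf (scale_sf (2 * alpha * of_nat s * of_nat (b - s)) (power_sum b * pdrv s (pdrv (b - s) f))) M)
      = 2 * alpha * (\<Sum>i<n. D b i)" for b
  proof -
    have "(\<Sum>s=1..<b. coeff_sf (scale_sf (2 * alpha * of_nat s * of_nat (b - s)) (power_sum b * pdrv s (pdrv (b - s) f))) M) =
      (\<Sum>s=1..<b. \<Sum>i<n. 2 * alpha * (of_nat s * of_nat (b - s) * mcoeff (pdrv s (pdrv (b - s) f)) (replicate_mset b i) M))"
      by (intro sum.cong refl) (simp add: p1 sum_distrib_left mult.assoc del: of_nat_diff)
    also have "\<dots> = 2 * alpha * (\<Sum>i<n. D b i)"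
      by (subst sum.swap) (simp add: D_def sum_distrib_left del: of_nat_diff)
    finally show ?thesis .
  qed
  have S2: "(\<Sum>s=1..<b. coeff_sf (scale_sf (2 * of_nat b) (power_sum s * (power_sum (b - s) * pdrv b f))) M)
      = 2 * of_nat b * (\<Sum>i<n. \<Sum>j<n. C b i j)" for b
  proof -
    have "(\<Sum>s=1..<b. coeff_sf (scale_sf (2 * of_nat b) (power_sum s * (power_sum (b - s) * pdrv b f))) M) =
      (\<Sum>s=1..<b. 2 * of_nat b * (\<Sum>i<n. \<Sum>j<n. mcoeff (pdrv b f) (replicate_mset s i + replicate_mset (b - s) j) M))"
      by (intro sum.cong refl) (simp add: p2)
    also have "\<dots> = 2 * of_nat b * (\<Sum>s=1..<b. \<Sum>i<n. \<Sum>j<n. mcoeff (pdrv b f) (replicate_mset s i + replicate_mset (b - s) j) M)"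
      by (simp only: sum_distrib_left)
    also have "(\<Sum>s=1..<b. \<Sum>i<n. \<Sum>j<n. mcoeff (pdrv b f) (replicate_mset s i + replicate_mset (b - s) j) M) =
      (\<Sum>i<n. \<Sum>j<n. C b i j)"
      unfolding C_def by (subst sum.swap) (intro sum.cong refl sum.swap)
    finally show ?thesis .
  qed
  \<comment> \<open>The products p_s p_(b-s) contain terms with i = j, b - 1 of them for each i,
    against n - 1 partners j of i in the operator. The balance is the factor n - b in
    \<open>laplace_op\<close>.\<close>
  have CA: "C b i i = (of_nat b - 1) * A b i" if "1 \<le> b" for b i
  proof -
    have "C b i i = (\<Sum>s=1..<b. A b i)"
      unfolding C_def A_def by (intro sum.cong refl) (simp flip: replicate_mset_add)
    then show ?thesis using that by (simp add: of_nat_diff)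
  qed
  have off: "(\<Sum>i<n. \<Sum>j\<in>{..<n} - {i}. of_nat b * (A b i + A b j + 2 * C b i j)) =
      2 * of_nat b * (\<Sum>i<n. \<Sum>j<n. C b i j) + 2 * of_nat b * (of_nat n - of_nat b) * (\<Sum>i<n. A b i)"
    if "b \<in> {1..N}" for b
  proof -
    have "(\<Sum>i<n. \<Sum>j\<in>{..<n} - {i}. of_nat b * (A b i + A b j + 2 * C b i j)) =
        (\<Sum>i<n. (\<Sum>j<n. of_nat b * (A b i + A b j + 2 * C b i j)) - of_nat b * (A b i + A b i + 2 * C b i i))"
      by (intro sum.cong refl) (simp add: sum_diff1)
    also have "\<dots> = of_nat b * (of_nat n * (\<Sum>i<n. A b i) + of_nat n * (\<Sum>i<n. A b i) + 2 * (\<Sum>i<n. \<Sum>j<n. C b i j))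
        - of_nat b * (2 * of_nat b * (\<Sum>i<n. A b i))"
      using that by (simp add: sum_subtractf sum.distrib sum_distrib_left CA algebra_simps)
    finally show ?thesis by (simp add: algebra_simps)
  qed
  have sq: "(\<Sum>i<n. (of_nat (count M i))\<^sup>2 * coeff_sf f M) =
      (\<Sum>b=1..N. (\<Sum>i<n. D b i) + of_nat b * of_nat b * (\<Sum>i<n. A b i))"
  proof -
    have "(\<Sum>i<n. (of_nat (count M i))\<^sup>2 * coeff_sf f M) = (\<Sum>i<n. \<Sum>b=1..N. D b i + of_nat b * of_nat b * A b i)"
      by (intro sum.cong refl) (simp only: count_squared_mult_coeff[OF cnt] D_def A_def sum.distrib)
    also have "\<dots> = (\<Sum>b=1..N. \<Sum>i<n. D b i + of_nat b * of_nat b * A b i)" by (rule sum.swap)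
    finally show ?thesis by (simp only: sum.distrib sum_distrib_left)
  qed
  have G: "(\<Sum>i<n. \<Sum>j\<in>{..<n} - {i}. quot_coeff i j (coeff_sf f) M) =
      (\<Sum>b=1..N. 2 * of_nat b * (\<Sum>i<n. \<Sum>j<n. C b i j) + 2 * of_nat b * (of_nat n - of_nat b) * (\<Sum>i<n. A b i))"
  proof -
    have "(\<Sum>i<n. \<Sum>j\<in>{..<n} - {i}. quot_coeff i j (coeff_sf f) M) =
        (\<Sum>i<n. \<Sum>j\<in>{..<n} - {i}. \<Sum>b=1..N. of_nat b * (A b i + A b j + 2 * C b i j))"
    proof (intro sum.cong refl)
      fix i j assume "j \<in> {..<n} - {i}"
      then have "i \<noteq> j" by auto
      from quot_drv_eq_quot_coeff[OF this N, of f]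
      show "quot_coeff i j (coeff_sf f) M = (\<Sum>b=1..N. of_nat b * (A b i + A b j + 2 * C b i j))"
        unfolding quot_drv_def A_def C_def by (rule sym)
    qed
    also have "\<dots> = (\<Sum>i<n. \<Sum>b=1..N. \<Sum>j\<in>{..<n} - {i}. of_nat b * (A b i + A b j + 2 * C b i j))"
      by (intro sum.cong refl sum.swap)
    also have "\<dots> = (\<Sum>b=1..N. \<Sum>i<n. \<Sum>j\<in>{..<n} - {i}. of_nat b * (A b i + A b j + 2 * C b i j))"
      by (rule sum.swap)
    also have "\<dots> = (\<Sum>b=1..N. 2 * of_nat b * (\<Sum>i<n. \<Sum>j<n. C b i j) + 2 * of_nat b * (of_nat n - of_nat b) * (\<Sum>i<n. A b i))"
      by (intro sum.cong refl off)
    finally show ?thesis .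
  qed
  have "coeff_sf (laplace_op n N f) M =
      (\<Sum>b=1..N. 2 * alpha * (\<Sum>i<n. D b i) + 2 * of_nat b * (\<Sum>i<n. \<Sum>j<n. C b i j)) +
      (\<Sum>b=1..N. 2 * of_nat b * (alpha * of_nat b + of_nat n - of_nat b) * (\<Sum>i<n. A b i))"
    unfolding laplace_op_def coeff_add coeff_sum sum.distrib S1 S2
    by (intro arg_cong2[where f = "(+)"] refl sum.cong) (simp add: p1 A_def)
  also have "\<dots> = 2 * alpha * (\<Sum>b=1..N. (\<Sum>i<n. D b i) + of_nat b * of_nat b * (\<Sum>i<n. A b i)) +
      (\<Sum>b=1..N. 2 * of_nat b * (\<Sum>i<n. \<Sum>j<n. C b i j) + 2 * of_nat b * (of_nat n - of_nat b) * (\<Sum>i<n. A b i))"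
    unfolding sum_distrib_left[of "2 * alpha" "\<lambda>b. (\<Sum>i<n. D b i) + of_nat b * of_nat b * (\<Sum>i<n. A b i)"]
      sum.distrib[symmetric]
    by (intro sum.cong refl) (simp add: algebra_simps)
  also have "\<dots> = laplace_coeff n (coeff_sf f) M"
    unfolding sq[symmetric] G[symmetric] laplace_coeff_def by (simp add: sum_distrib_right mult.assoc)
  finally show ?thesis .
qed

section \<open>Raising moves, leading monomials and eigenvalues\<close>

lemma excess_exponents:
  "finite I \<Longrightarrow> set_mset M \<subseteq> I \<Longrightarrow> excess t (exponents M) = (\<Sum>i\<in>I. count M i - t)"
  unfolding excess_def by (rule sum_count_exponents[symmetric]) simp_all

lemma sumsq_exponents:
  "finite I \<Longrightarrow> set_mset M \<subseteq> I \<Longrightarrow> sumsq (exponents M) = (\<Sum>i\<in>I. (count M i)\<^sup>2)"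
  unfolding sumsq_def by (rule sum_count_exponents[symmetric]) simp_all

lemma set_move: "set_mset (move i j s M) \<subseteq> insert i (set_mset M)"
  by (auto simp: move_def dest: in_diffD)

lemma size_move: "s \<le> count M j \<Longrightarrow> size (move i j s M) = size M"
proof -
  assume "s \<le> count M j"
  then have "replicate_mset s j \<subseteq># M" by (simp add: count_le_replicate_mset_subset_eq)
  then obtain L where "M = L + replicate_mset s j" by (metis subset_mset.diff_add)
  then show ?thesis by (simp add: move_def)
qed

lemma sum_move:
  fixes f :: "nat \<Rightarrow> nat"
  assumes "i \<noteq> j" "finite I" "i \<in> I" "j \<in> I"
  shows "(\<Sum>k\<in>I. f (count (move i j s M) k)) + f (count M i) + f (count M j) =
    (\<Sum>k\<in>I. f (count M k)) + f (count M i + s) + f (count M j - s)"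
proof -
  have split: "(\<Sum>k\<in>I. h k) = h i + h j + (\<Sum>k\<in>I - {i, j}. h k)" for h :: "nat \<Rightarrow> nat"
  proof -
    have "I = insert i (insert j (I - {i, j}))" using assms by auto
    then have "(\<Sum>k\<in>I. h k) = (\<Sum>k\<in>insert i (insert j (I - {i, j})). h k)" by simp
    also have "\<dots> = h i + h j + (\<Sum>k\<in>I - {i, j}. h k)" using assms(1,2) by simp
    finally show ?thesis .
  qed
  have "(\<Sum>k\<in>I - {i, j}. f (count (move i j s M) k)) = (\<Sum>k\<in>I - {i, j}. f (count M k))"
    using assms(1) by (intro sum.cong) (auto simp: count_move)
  then show ?thesis
    using assms(1) split[of "\<lambda>k. f (count (move i j s M) k)"] split[of "\<lambda>k. f (count M k)"]
    by (simp add: count_move)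
qed

text \<open>Convexity of x |-> max(x - t, 0): two exponents are spread apart while their sum stays
  fixed.\<close>

lemma dom_le_move:
  assumes "i \<noteq> j" "s \<le> count M j" "count M j \<le> count M i"
  shows "dom_le (exponents M) (exponents (move i j s M))"
  unfolding dom_le_def
proof (intro conjI allI)
  show "sum_mset (exponents M) = sum_mset (exponents (move i j s M))"
    using size_move[OF assms(2)] by (simp add: size_exponents)
  fix t
  define I where "I = insert i (insert j (set_mset M))"
  have I: "finite I" "i \<in> I" "j \<in> I" "set_mset M \<subseteq> I" by (auto simp: I_def)
  have I': "set_mset (move i j s M) \<subseteq> I" using set_move[of i j s M] I by auto
  show "excess t (exponents M) \<le> excess t (exponents (move i j s M))"
    using sum_move[OF assms(1) I(1-3), of "\<lambda>a. a - t" s M] assms(2,3)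
    unfolding excess_exponents[OF I(1,4)] excess_exponents[OF I(1) I'] by linarith
qed

lemma sumsq_move:
  assumes "i \<noteq> j" "0 < s" "s \<le> count M j" "count M j \<le> count M i"
  shows "sumsq (exponents M) < sumsq (exponents (move i j s M))"
proof -
  define I where "I = insert i (insert j (set_mset M))"
  have I: "finite I" "i \<in> I" "j \<in> I" "set_mset M \<subseteq> I" by (auto simp: I_def)
  have I': "set_mset (move i j s M) \<subseteq> I" using set_move[of i j s M] I by auto
  obtain c where c: "count M j = c + s" using assms(3) by (metis add.commute le_iff_add)
  obtain d where d: "count M i = d + (c + s)" using assms(4) c by (metis add.commute le_iff_add)
  have "(count M i)\<^sup>2 + (count M j)\<^sup>2 < (count M i + s)\<^sup>2 + (count M j - s)\<^sup>2"
    unfolding c d using assms(2) by (simp add: power2_eq_square algebra_simps)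
  then show ?thesis
    using sum_move[OF assms(1) I(1-3), of "\<lambda>a. a\<^sup>2" s M]
    unfolding sumsq_exponents[OF I(1,4)] sumsq_exponents[OF I(1) I'] by linarith
qed

definition nvar :: "nat \<Rightarrow> nat \<Rightarrow> nat multiset \<Rightarrow> bool" where
  "nvar n d M \<longleftrightarrow> set_mset M \<subseteq> {..<n} \<and> size M = d"

lemma nvar_move: "nvar n d M \<Longrightarrow> i < n \<Longrightarrow> s \<le> count M j \<Longrightarrow> nvar n d (move i j s M)"
  unfolding nvar_def using set_move[of i j s M] size_move[of s M j i] by auto

lemma nvar_canon: "0 \<notin># A \<Longrightarrow> size A \<le> n \<Longrightarrow> nvar n (sum_mset A) (canon A)"
  unfolding nvar_def using set_canon[of A] size_exponents[of "canon A"] by (auto simp: exponents_canon)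

lemma quot_coeff_support:
  assumes "i \<noteq> j" "i < n" "count M j \<le> count M i" "nvar n d M" "quot_coeff i j u M \<noteq> 0"
  shows "\<exists>M'. nvar n d M' \<and> u M' \<noteq> 0 \<and> dom_le (exponents M) (exponents M')"
proof (cases "u M = 0")
  case True
  then have "(\<Sum>s=1..count M j. euler_diff i j u (move i j s M)) \<noteq> 0"
    using assms(5) by (simp add: quot_coeff_def euler_diff_def)
  then obtain s where s: "s \<in> {1..count M j}" "euler_diff i j u (move i j s M) \<noteq> 0"
    by (rule sum.not_neutral_contains_not_neutral)
  then have "u (move i j s M) \<noteq> 0" "s \<le> count M j" by (auto simp: euler_diff_def)
  then show ?thesis using nvar_move[OF assms(4,2)] dom_le_move[OF assms(1) _ assms(3)] by blast
next
  case False
  with assms(4) dom_le_refl show ?thesis by blast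
qed

text \<open>It permits expanding each quotient in the direction in which moves go from the smaller
  exponent to the larger one, hence up in dominance.\<close>

definition quot_symmetric :: "nat \<Rightarrow> (nat multiset \<Rightarrow> ratfun) \<Rightarrow> nat multiset \<Rightarrow> bool" where
  "quot_symmetric n u M \<longleftrightarrow> (\<forall>i<n. \<forall>j<n. i \<noteq> j \<longrightarrow> quot_coeff i j u M = quot_coeff j i u M)"

lemma quot_symmetric_coeff: "quot_symmetric n (coeff_sf f) M"
  by (simp add: quot_symmetric_def quot_coeff_coeff_commute)

lemma laplace_coeff_support:
  assumes "quot_symmetric n u M" "nvar n d M" "laplace_coeff n u M \<noteq> 0"
  shows "\<exists>M'. nvar n d M' \<and> u M' \<noteq> 0 \<and> dom_le (exponents M) (exponents M')"
proof (cases "u M = 0")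
  case True
  then have "(\<Sum>i<n. \<Sum>j\<in>{..<n} - {i}. quot_coeff i j u M) \<noteq> 0" using assms(3) by (simp add: laplace_coeff_def)
  then obtain i where i: "i \<in> {..<n}" "(\<Sum>j\<in>{..<n} - {i}. quot_coeff i j u M) \<noteq> 0"
    by (rule sum.not_neutral_contains_not_neutral)
  from i(2) obtain j where j: "j \<in> {..<n} - {i}" "quot_coeff i j u M \<noteq> 0"
    by (rule sum.not_neutral_contains_not_neutral)
  show ?thesis
  proof (cases "count M j \<le> count M i")
    case True
    show ?thesis by (rule quot_coeff_support[OF _ _ True assms(2) j(2)]) (use i j in auto)
  next
    case False
    have "quot_coeff j i u M \<noteq> 0" using assms(1) i j by (auto simp: quot_symmetric_def)
    then show ?thesis by (intro quot_coeff_support[of j i n M d u]) (use i j False assms(2) in auto)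
  qed
next
  case False
  with assms(2) dom_le_refl show ?thesis by blast
qed

text \<open>The diagonal entry of the operator: the quotient for i and j, expanded from the larger
  exponent, starts with the absolute difference of the exponents, written as maximum minus minimum
  in the naturals.\<close>

definition laplace_ev :: "nat \<Rightarrow> nat multiset \<Rightarrow> ratfun" where
  "laplace_ev n M = 2 * alpha * of_nat (sumsq (exponents M)) +
    of_nat (\<Sum>i<n. \<Sum>j\<in>{..<n} - {i}. max (count M i) (count M j) - min (count M i) (count M j))"

text \<open>Each move in the raising direction increases the sum of squares and lands where u
  vanishes, so only the diagonal entry remains.\<close>

lemma laplace_coeff_top:
  assumes M: "nvar n d M" "quot_symmetric n u M"
    and top: "\<And>M'. nvar n d M' \<Longrightarrow> sumsq (exponents M) < sumsq (exponents M') \<Longrightarrow> u M' = 0"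
  shows "laplace_coeff n u M = laplace_ev n M * u M"
proof -
  have *: "quot_coeff i j u M = of_nat (max (count M i) (count M j) - min (count M i) (count M j)) * u M"
    if "i < n" "j < n" "i \<noteq> j" "count M j \<le> count M i" for i j
  proof -
    have "(\<Sum>s=1..count M j. euler_diff i j u (move i j s M)) = 0"
    proof (rule sum.neutral, rule ballI)
      fix s assume "s \<in> {1..count M j}"
      then have s: "0 < s" "s \<le> count M j" by auto
      have "u (move i j s M) = 0"
        by (rule top[OF nvar_move[OF M(1) that(1) s(2)] sumsq_move[OF that(3) s that(4)]])
      then show "euler_diff i j u (move i j s M) = 0" by (simp add: euler_diff_def)
    qed
    then show ?thesis using that(4) by (simp add: quot_coeff_def euler_diff_def max_def min_def of_nat_diff)
  qed
  have G: "quot_coeff i j u M = of_nat (max (count M i) (count M j) - min (count M i) (count M j)) * u M"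
    if "i < n" "j \<in> {..<n} - {i}" for i j
  proof (cases "count M j \<le> count M i")
    case True
    with that show ?thesis by (intro *) auto
  next
    case False
    have "quot_coeff i j u M = quot_coeff j i u M" using M(2) that by (auto simp: quot_symmetric_def)
    also have "\<dots> = of_nat (max (count M j) (count M i) - min (count M j) (count M i)) * u M"
      using that False by (intro *) auto
    finally show ?thesis by (simp only: max.commute min.commute)
  qed
  have "(\<Sum>i<n. \<Sum>j\<in>{..<n} - {i}. quot_coeff i j u M) =
      (\<Sum>i<n. \<Sum>j\<in>{..<n} - {i}. of_nat (max (count M i) (count M j) - min (count M i) (count M j)) * u M)"
    by (intro sum.cong refl G) auto
  moreover have "sumsq (exponents M) = (\<Sum>i<n. (count M i)\<^sup>2)"
    using M(1) by (intro sumsq_exponents) (auto simp: nvar_def)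
  ultimately show ?thesis
    unfolding laplace_coeff_def laplace_ev_def distrib_right of_nat_sum sum_distrib_right by simp
qed

text \<open>As \<alpha> is an indeterminate, its coefficients on both sides can be compared; this is
  what separates eigenvalues.\<close>

lemma alpha_transcendental:
  assumes "2 * alpha * of_nat a + of_nat b = 2 * alpha * of_nat a' + of_nat b'"
  shows "a = a'"
proof -
  have *: "2 * alpha * of_nat a + of_nat b = Fract [:of_nat b, of_nat (2 * a):] 1" for a b
  proof -
    have "2 * alpha * of_nat a + of_nat b = of_nat 2 * alpha * of_nat a + of_nat b" by simp
    also have "\<dots> = Fract (of_nat 2) 1 * Fract [:0, 1:] 1 * Fract (of_nat a) 1 + Fract (of_nat b) 1"
      by (simp only: jack_param_def Fract_of_nat_eq)
    also have "\<dots> = Fract (of_nat 2 * [:0, 1:] * of_nat a + of_nat b) 1"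
      by (simp only: mult_fract add_fract[OF one_neq_zero one_neq_zero] mult_1_right)
    also have "of_nat 2 * [:0, 1:] * of_nat a + of_nat b = ([:of_nat b, of_nat (2 * a):] :: rat poly)"
      by (simp add: of_nat_poly)
    finally show ?thesis .
  qed
  from assms have "[:of_nat b, of_nat (2 * a):] = ([:of_nat b', of_nat (2 * a'):] :: rat poly)"
    unfolding * by (simp add: eq_fract)
  then have "(of_nat (2 * a) :: rat) = of_nat (2 * a')" by (metis pCons_eq_iff)
  then show ?thesis by (simp only: of_nat_eq_iff)
qed

text \<open>The monomial (x_0 ... x_(n-1))^r. For M dividing it, \<open>box n r - M\<close> is the
  reflected monomial.\<close>

definition box :: "nat \<Rightarrow> nat \<Rightarrow> nat multiset" where
  "box n r = (\<Sum>i<n. replicate_mset r i)"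

lemma count_box: "count (box n r) k = (if k < n then r else 0)"
  by (simp add: box_def count_sum if_distrib sum.delta cong: if_cong)

lemma subseteq_box_iff: "M \<subseteq># box n r \<longleftrightarrow> set_mset M \<subseteq> {..<n} \<and> (\<forall>k. count M k \<le> r)"
proof
  assume "M \<subseteq># box n r"
  then have le: "count M k \<le> (if k < n then r else 0)" for k
    using mset_subset_eq_count[OF \<open>M \<subseteq># box n r\<close>, of k] by (simp only: count_box)
  have "k < n" if "k \<in># M" for k
  proof (rule ccontr)
    assume "\<not> k < n"
    then have "count M k = 0" using le[of k] by simp
    then have "k \<notin># M" by (rule not_in_iff[THEN iffD2])
    with that show False by simp
  qed
  moreover have "count M k \<le> r" for k using le[of k] by (auto split: if_splits)
  ultimately show "set_mset M \<subseteq> {..<n} \<and> (\<forall>k. count M k \<le> r)" by auto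
next
  assume M: "set_mset M \<subseteq> {..<n} \<and> (\<forall>k. count M k \<le> r)"
  have "count M k \<le> count (box n r) k" for k
  proof (cases "k \<in># M")
    case True
    with M show ?thesis by (auto simp: count_box)
  next
    case False
    then have "count M k = 0" by (rule not_in_iff[THEN iffD1])
    then show ?thesis by simp
  qed
  then show "M \<subseteq># box n r" by (simp add: subseteq_mset_def)
qed

lemma size_box: "size (box n r) = n * r"
  by (induction n) (simp_all add: box_def)

lemma inbox_exponents: "M \<subseteq># box n r \<Longrightarrow> inbox n r (exponents M)"
proof -
  assume M: "M \<subseteq># box n r"
  then have "card (set_mset M) \<le> card {..<n}" by (intro card_mono) (auto simp: subseteq_box_iff)
  with M show ?thesis
    unfolding inbox_def by (auto simp: size_exponents_card) (auto simp: exponents_def subseteq_box_iff)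
qed

lemma subseteq_BxI:
  assumes "set_mset M \<subseteq> {..<n}" "inbox n r B" "dom_le (exponents M) B"
  shows "M \<subseteq># box n r"
proof -
  have bd: "\<forall>a\<in>#exponents M. a \<le> r" using dom_le_bound[OF assms(3)] assms(2) by (auto simp: inbox_def)
  have "count M k \<le> r" for k
  proof (cases "k \<in># M")
    case True
    with bd show ?thesis by (simp add: exponents_def)
  next
    case False
    then have "count M k = 0" by (rule not_in_iff[THEN iffD1])
    then show ?thesis by simp
  qed
  with assms(1) show ?thesis by (simp add: subseteq_box_iff)
qed

text \<open>Variables absent from M turn into full rows, which is what the padding in
  \<open>rcompl\<close> provides.\<close>

lemma exponents_box_diff:
  assumes "M \<subseteq># box n r"
  shows "exponents (box n r - M) = rcompl n r (exponents M)"
proof -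
  have M: "set_mset M \<subseteq> {..<n}" using assms by (simp add: subseteq_box_iff)
  have "set_mset (box n r - M) \<subseteq> {..<n}"
    using subseteq_box_iff[of "box n r - M" n r] by (meson diff_subset_eq_self)
  then have "exponents (box n r - M) =
      filter_mset (\<lambda>a. a \<noteq> 0) (image_mset (count (box n r - M)) (mset_set {..<n}))"
    by (intro exponents_count) auto
  also have "image_mset (count (box n r - M)) (mset_set {..<n}) =
      image_mset (\<lambda>a. r - a) (image_mset (count M) (mset_set {..<n}))"
    unfolding multiset.map_comp by (intro image_mset_cong) (simp add: count_box)
  also have "\<dots> = image_mset (\<lambda>a. r - a) (exponents M) + replicate_mset (n - size (exponents M)) r"
    using image_count_mset_set[OF _ M] by simp
  finally show ?thesis by (simp add: rcompl_def)
qed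

lemma quot_coeff_diff: "quot_coeff i j (\<lambda>M. u M - v M) M = quot_coeff i j u M - quot_coeff i j v M"
  by (simp add: quot_coeff_def euler_diff_def right_diff_distrib sum_subtractf)

lemma laplace_coeff_diff: "laplace_coeff n (\<lambda>M. u M - v M) M = laplace_coeff n u M - laplace_coeff n v M"
  by (simp add: laplace_coeff_def quot_coeff_diff right_diff_distrib sum_subtractf)

text \<open>Two eigenfunctions with the same leading exponent coincide: at a point of the support of their
  difference with the largest sum of squares, the eigenvalue is \<open>laplace_ev\<close>, whose $\alpha$-part
  determines that sum of squares.\<close>
lemma eigenfunction_unique:
  assumes A: "0 \<notin># A" "size A \<le> n"
    and supp: "\<And>M. nvar n (sum_mset A) M \<Longrightarrow> u M \<noteq> 0 \<Longrightarrow> M \<subseteq># box n r \<and> dom_le (exponents M) A"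
      "\<And>M. nvar n (sum_mset A) M \<Longrightarrow> v M \<noteq> 0 \<Longrightarrow> M \<subseteq># box n r \<and> dom_le (exponents M) A"
    and lead: "\<And>M. nvar n (sum_mset A) M \<Longrightarrow> exponents M = A \<Longrightarrow> u M = 1"
      "\<And>M. nvar n (sum_mset A) M \<Longrightarrow> exponents M = A \<Longrightarrow> v M = 1"
    and sym: "\<And>M. M \<subseteq># box n r \<Longrightarrow> quot_symmetric n u M" "\<And>M. M \<subseteq># box n r \<Longrightarrow> quot_symmetric n v M"
    and eig: "\<And>M. M \<subseteq># box n r \<Longrightarrow> size M = sum_mset A \<Longrightarrow> laplace_coeff n u M = \<epsilon> * u M"
      "\<And>M. M \<subseteq># box n r \<Longrightarrow> size M = sum_mset A \<Longrightarrow> laplace_coeff n v M = \<epsilon>' * v M"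
    and M: "nvar n (sum_mset A) M"
  shows "u M = v M"
proof (rule ccontr)
  assume neq: "u M \<noteq> v M"
  \<comment> \<open>The leading monomial forces the eigenvalue. Applied to both functions this gives
    the same scalar, so their difference is again an eigenfunction.\<close>
  have eps: "e = laplace_ev n (canon A)"
    if "\<And>M. nvar n (sum_mset A) M \<Longrightarrow> w M \<noteq> 0 \<Longrightarrow> M \<subseteq># box n r \<and> dom_le (exponents M) A"
      "\<And>M. nvar n (sum_mset A) M \<Longrightarrow> exponents M = A \<Longrightarrow> w M = 1"
      "\<And>M. M \<subseteq># box n r \<Longrightarrow> quot_symmetric n w M"
      "\<And>M. M \<subseteq># box n r \<Longrightarrow> size M = sum_mset A \<Longrightarrow> laplace_coeff n w M = e * w M" for w e
  proof -
    have nv: "nvar n (sum_mset A) (canon A)" by (rule nvar_canon[OF A])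
    have w1: "w (canon A) = 1" by (rule that(2)[OF nv exponents_canon[OF A(1)]])
    have B: "canon A \<subseteq># box n r" using that(1)[OF nv] w1 by simp
    have "laplace_coeff n w (canon A) = laplace_ev n (canon A) * w (canon A)"
    proof (rule laplace_coeff_top[OF nv that(3)[OF B]])
      fix M' assume "nvar n (sum_mset A) M'" "sumsq (exponents (canon A)) < sumsq (exponents M')"
      then show "w M' = 0"
        using that(1)[of M'] dom_le_sumsq(1)[of "exponents M'" A] by (fastforce simp: exponents_canon[OF A(1)])
    qed
    moreover have "laplace_coeff n w (canon A) = e * w (canon A)"
      using that(4)[OF B] nv by (simp add: nvar_def)
    ultimately show ?thesis by (simp add: w1)
  qed
  have e1: "\<epsilon> = laplace_ev n (canon A)" by (rule eps[OF supp(1) lead(1) sym(1) eig(1)])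
  have e2: "\<epsilon>' = laplace_ev n (canon A)" by (rule eps[OF supp(2) lead(2) sym(2) eig(2)])
  define w where "w = (\<lambda>M. u M - v M)"
  have supp_w: "M \<subseteq># box n r \<and> dom_le (exponents M) A" if "nvar n (sum_mset A) M" "w M \<noteq> 0" for M
    using that supp[of M] by (cases "u M = 0") (auto simp: w_def)
  \<comment> \<open>Confinement to the box makes this set finite, hence a point with largest sum of
    squares exists.\<close>
  define S where "S = {M. M \<subseteq># box n r \<and> size M = sum_mset A \<and> w M \<noteq> 0}"
  have fin: "finite S" by (rule finite_subset[OF _ finite_submultisets[of "box n r"]]) (auto simp: S_def)
  have "M \<in> S" using supp_w[OF M] M neq by (auto simp: S_def w_def nvar_def)
  then have "Max ((\<lambda>M. sumsq (exponents M)) ` S) \<in> (\<lambda>M. sumsq (exponents M)) ` S"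
    using fin by (intro Max_in) auto
  then obtain N where N: "N \<in> S" "sumsq (exponents N) = Max ((\<lambda>M. sumsq (exponents M)) ` S)" by auto
  have top: "sumsq (exponents M') \<le> sumsq (exponents N)" if "M' \<in> S" for M'
    unfolding N(2) using fin that by (intro Max_ge) auto
  have NB: "N \<subseteq># box n r" "size N = sum_mset A" "w N \<noteq> 0" using N(1) by (auto simp: S_def)
  have nvN: "nvar n (sum_mset A) N" using NB by (auto simp: nvar_def subseteq_box_iff)
  have "quot_symmetric n w N" using sym(1)[OF NB(1)] sym(2)[OF NB(1)] unfolding quot_symmetric_def w_def quot_coeff_diff by simp
  then have "laplace_coeff n w N = laplace_ev n N * w N"
  proof (rule laplace_coeff_top[OF nvN])
    fix M' assume M': "nvar n (sum_mset A) M'" "sumsq (exponents N) < sumsq (exponents M')"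
    then show "w M' = 0" using supp_w[OF M'(1)] top[of M'] by (auto simp: S_def nvar_def)
  qed
  moreover have "laplace_coeff n w N = laplace_ev n (canon A) * w N"
    unfolding w_def laplace_coeff_diff eig[OF NB(1,2)] e1 e2 by (simp add: right_diff_distrib)
  ultimately have "laplace_ev n N = laplace_ev n (canon A)" using NB(3) by simp
  \<comment> \<open>Strictness in \<open>dom_le_sumsq\<close> now forces the exponents of N to be A,
    where the leading coefficients of u and v cancel.\<close>
  then have "sumsq (exponents N) = sumsq A"
    unfolding laplace_ev_def exponents_canon[OF A(1)] by (rule alpha_transcendental)
  moreover have "dom_le (exponents N) A" using supp_w[OF nvN NB(3)] by simp
  ultimately have "exponents N = A"
    using dom_le_sumsq(2)[of "exponents N" A] A(1) by fastforce
  then have "w N = 0" using lead[OF nvN] by (simp add: w_def)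
  with NB(3) show False by simp
qed

text \<open>Under x |-> 1/x both (x_i + x_j)/(x_i - x_j) and the difference of Euler operators
  change sign, and that difference kills the factor (x_0 ... x_(n-1))^r. Since x_j / x_i becomes x_i
  / x_j, the direction of expansion is exchanged.\<close>

lemma quot_coeff_reflect:
  assumes ij: "i \<noteq> j" "i < n" "j < n"
    and f: "\<And>M. set_mset M \<subseteq> {..<n} \<Longrightarrow> \<not> M \<subseteq># box n r \<Longrightarrow> f M = 0"
    and M: "M \<subseteq># box n r"
  shows "quot_coeff i j (\<lambda>M. if M \<subseteq># box n r then f (box n r - M) else 0) M = quot_coeff j i f (box n r - M)"
proof -
  define g where "g = (\<lambda>M. if M \<subseteq># box n r then f (box n r - M) else 0)"
  define M' where "M' = box n r - M"
  have le: "count Z k \<le> (if k < n then r else 0)" if "Z \<subseteq># box n r" for Z k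
    using mset_subset_eq_count[OF that, of k] by (simp only: count_box)
  have cM: "count M k \<le> r" for k using M by (simp add: subseteq_box_iff)
  have cM': "count M' k = (if k < n then r - count M k else 0)" for k
    using le[OF M, of k] by (simp add: M'_def count_box)
  have F: "euler_diff i j g Z = euler_diff j i f (box n r - Z)" if "Z \<subseteq># box n r" for Z
  proof -
    have "count Z i \<le> r" "count Z j \<le> r" using le[OF that, of i] le[OF that, of j] ij by simp_all
    then show ?thesis using ij that by (simp add: euler_diff_def g_def count_box of_nat_diff)
  qed
  have setmv: "set_mset (move j i s M') \<subseteq> {..<n}" for s
    using set_move[of j i s M'] subseteq_box_iff[of M' n r] ij(3) by (auto simp: M'_def)
  \<comment> \<open>The shifts that stay inside the box. For the others the terms on the left vanish
    by the definition of g and those on the right by the assumption on f.\<close>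
  define K where "K = {1..min (count M j) (r - count M i)}"
  have T: "euler_diff i j g (move i j s M) = euler_diff j i f (move j i s M')" if "s \<in> K" for s
  proof -
    have s: "s \<le> count M j" "s \<le> r - count M i" using that by (auto simp: K_def)
    have sub: "move i j s M \<subseteq># box n r"
      unfolding subseteq_mset_def
    proof
      fix k
      have "count M i + s \<le> r" "count M j - s \<le> r" using s cM[of i] cM[of j] by linarith+
      with le[OF M, of k] ij show "count (move i j s M) k \<le> count (box n r) k"
        by (simp add: count_move count_box split: if_splits)
    qed
    have "box n r - move i j s M = move j i s M'"
      using ij s cM[of i] cM[of j] by (intro multiset_eqI) (auto simp: count_move cM' count_box)
    with F[OF sub] show ?thesis by simp
  qed
  have "(\<Sum>s=1..count M j. euler_diff i j g (move i j s M)) = (\<Sum>s\<in>K. euler_diff i j g (move i j s M))"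
  proof (rule sum.mono_neutral_right)
    show "\<forall>s\<in>{1..count M j} - K. euler_diff i j g (move i j s M) = 0"
    proof
      fix s assume "s \<in> {1..count M j} - K"
      then have "r < count (move i j s M) i" using ij by (auto simp: K_def count_move)
      then have "\<not> move i j s M \<subseteq># box n r" using le[of "move i j s M" i] by (auto split: if_splits)
      then show "euler_diff i j g (move i j s M) = 0" by (simp add: euler_diff_def g_def)
    qed
  qed (auto simp: K_def)
  also have "\<dots> = (\<Sum>s\<in>K. euler_diff j i f (move j i s M'))" by (intro sum.cong refl T)
  also have "\<dots> = (\<Sum>s=1..count M' i. euler_diff j i f (move j i s M'))"
  proof (rule sum.mono_neutral_left)
    show "\<forall>s\<in>{1..count M' i} - K. euler_diff j i f (move j i s M') = 0"
    proof
      fix s assume "s \<in> {1..count M' i} - K"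
      then have "r < count (move j i s M') j" using ij cM[of j] by (auto simp: K_def count_move cM')
      then have "\<not> move j i s M' \<subseteq># box n r" using le[of "move j i s M'" j] by (auto split: if_splits)
      then show "euler_diff j i f (move j i s M') = 0" using f[OF setmv] by (simp add: euler_diff_def)
    qed
  qed (use ij in \<open>auto simp: K_def cM'\<close>)
  finally show ?thesis using F[OF M] unfolding quot_coeff_def g_def[symmetric] M'_def[symmetric] by simp
qed

context jack_family
begin

text \<open>A triangular and self-adjoint operator is diagonal on an orthogonal triangular basis.
  The equation is confined to monomials in n variables, where \<open>laplace_op\<close> has been
  identified with the differential operator.\<close>

lemma PP_eigen:
  assumes A: "0 \<notin># A" "size A \<le> n"
  shows "\<exists>\<epsilon>. \<forall>M. nvar n (sum_mset A) M \<longrightarrow> laplace_coeff n (coeff_sf (PP A)) M = \<epsilon> * coeff_sf (PP A) M"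
proof -
  define N where "N = sum_mset A"
  \<comment> \<open>Triangularity. A partition D above C again has at most n parts, so its
    representative monomial lies in the n variables where the support is controlled.\<close>
  have key: "dom_le C B"
    if B: "0 \<notin># B" and C: "0 \<notin># C" and nz: "\<langle>laplace_op n N (PP B), PP C\<rangle> \<noteq> 0"
      and sumC: "sum_mset C = N" and szC: "size C \<le> n" for B C
  proof -
    obtain D where D: "0 \<notin># D" "dom_le C D" "pcoeff (laplace_op n N (PP B)) D \<noteq> 0"
      by (rule ji_PP_upper[OF C nz])
    have "size D \<le> n" using dom_le_size[OF D(2) C D(1)] szC by simp
    moreover have sD: "sum_mset D = N" using dom_le_sum[OF D(2)] sumC by simp
    ultimately have nv: "nvar n N (canon D)" using nvar_canon[OF D(1), of n] by simp
    then have "laplace_coeff n (coeff_sf (PP B)) (canon D) \<noteq> 0"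
      using D(3) coeff_laplace_op[of "canon D" n N "PP B"] by (simp add: pcoeff_def nvar_def)
    from laplace_coeff_support[OF quot_symmetric_coeff nv this] obtain M' where
      M': "coeff_sf (PP B) M' \<noteq> 0" "dom_le (exponents (canon D)) (exponents M')" by blast
    have "dom_le D (exponents M')" using M'(2) by (simp add: exponents_canon[OF D(1)])
    with D(2) coeff_PP[OF B M'(1)] show ?thesis by (blast intro: dom_le_trans)
  qed
  \<comment> \<open>The only scalar for which h is orthogonal to P_A.\<close>
  define \<epsilon> where "\<epsilon> = \<langle>laplace_op n N (PP A), PP A\<rangle> / \<langle>PP A, PP A\<rangle>"
  define h where "h = laplace_op n N (PP A) - scale_sf \<epsilon> (PP A)"
  have hA: "\<langle>h, PP A\<rangle> = 0" using norm_PP[OF A(1)] by (simp add: h_def \<epsilon>_def)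
  have "coeff_sf h M = 0" if M: "nvar n N M" for M
  proof (rule ccontr)
    assume nz: "coeff_sf h M \<noteq> 0"
    obtain T c where T: "finite T" "T \<subseteq> positive_parts" "h = (\<Sum>B\<in>T. scale_sf (c B) (PP B))"
      "\<forall>B. 0 \<notin># B \<longrightarrow> \<langle>h, PP B\<rangle> = (if B \<in> T then c B * \<langle>PP B, PP B\<rangle> else 0)"
      using PP_expand[of h] by (elim exE conjE) (rule that)
    from nz have "(\<Sum>B\<in>T. c B * coeff_sf (PP B) M) \<noteq> 0" by (simp add: T(3))
    then obtain B where B: "B \<in> T" "c B * coeff_sf (PP B) M \<noteq> 0"
      by (rule sum.not_neutral_contains_not_neutral)
    then have B0: "0 \<notin># B" "c B \<noteq> 0" "coeff_sf (PP B) M \<noteq> 0" using T(2) by auto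
    have dom: "dom_le (exponents M) B" by (rule coeff_PP[OF B0(1,3)])
    have sB: "sum_mset B = N" using dom_le_sum[OF dom] M by (simp add: size_exponents nvar_def)
    have "size B \<le> size (exponents M)" by (rule dom_le_size[OF dom zero_notin_exponents B0(1)])
    also have "\<dots> \<le> n" using M card_mono[of "{..<n}" "set_mset M"] by (simp add: size_exponents_card nvar_def)
    finally have szB: "size B \<le> n" .
    have hB: "\<langle>h, PP B\<rangle> \<noteq> 0" using T(4) B(1) B0(1,2) norm_PP[OF B0(1)] by simp
    then have BA: "B \<noteq> A" using hA by auto
    have OAB: "\<langle>laplace_op n N (PP A), PP B\<rangle> \<noteq> 0"
      using hB ji_PP[OF A(1) B0(1)] BA by (auto simp: h_def)
    \<comment> \<open>Self-adjointness exchanges A and B, so triangularity bounds them against each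
      other in both directions.\<close>
    then have OBA: "\<langle>laplace_op n N (PP B), PP A\<rangle> \<noteq> 0"
      using laplace_op_self_adjoint[of n N "PP B" "PP A"] ji_commute by metis
    have "dom_le B A" by (rule key[OF A(1) B0(1) OAB sB szB])
    moreover have "dom_le A B" by (rule key[OF B0(1) A(1) OBA N_def[symmetric] A(2)])
    ultimately show False using dom_le_antisym[OF B0(1) A(1)] BA by simp
  qed
  then have "laplace_coeff n (coeff_sf (PP A)) M = \<epsilon> * coeff_sf (PP A) M" if "nvar n N M" for M
    using coeff_laplace_op[of M n N "PP A"] that by (simp add: h_def nvar_def)
  then show ?thesis unfolding N_def by blast
qed

lemma PP_reflect:
  assumes A: "inbox n r A" and M: "M \<subseteq># box n r"
  shows "coeff_sf (PP A) (box n r - M) = coeff_sf (PP (rcompl n r A)) M"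
proof (cases "size M = sum_mset (rcompl n r A)")
  case True
  define f where "f = coeff_sf (PP A)"
  define A' where "A' = rcompl n r A"
  define g where "g = (\<lambda>M. if M \<subseteq># box n r then f (box n r - M) else 0)"
  have A0: "0 \<notin># A" "size A \<le> n" using A by (auto simp: inbox_def)
  have A': "inbox n r A'" unfolding A'_def by (rule inbox_rcompl[OF A])
  have A'0: "0 \<notin># A'" "size A' \<le> n" using A' by (auto simp: inbox_def)
  have f0: "f Z = 0" if "set_mset Z \<subseteq> {..<n}" "\<not> Z \<subseteq># box n r" for Z
    using subseteq_BxI[OF that(1) A coeff_PP[OF A0(1), of Z]] that(2) by (auto simp: f_def)
  have sumA: "sum_mset A' + sum_mset A = n * r" unfolding A'_def by (rule sum_rcompl[OF A])
  have comp: "box n r - Z \<subseteq># box n r" for Z by simp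
  have szc: "size (box n r - Z) + size Z = n * r" if "Z \<subseteq># box n r" for Z
    using that size_mset_mono[OF that] by (simp add: size_Diff_submset size_box)
  obtain \<epsilon> where \<epsilon>: "\<And>Z. nvar n (sum_mset A) Z \<Longrightarrow> laplace_coeff n f Z = \<epsilon> * f Z"
    using PP_eigen[OF A0] unfolding f_def by blast
  obtain \<epsilon>' where \<epsilon>': "\<And>Z. nvar n (sum_mset A') Z \<Longrightarrow> laplace_coeff n (coeff_sf (PP A')) Z = \<epsilon>' * coeff_sf (PP A') Z"
    using PP_eigen[OF A'0] by blast
  have Gg: "quot_coeff i j g Z = quot_coeff i j f (box n r - Z)" if "i < n" "j < n" "i \<noteq> j" "Z \<subseteq># box n r" for i j Z
  proof -
    have "quot_coeff i j g Z = quot_coeff j i f (box n r - Z)"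
      unfolding g_def by (rule quot_coeff_reflect[OF that(3,1,2) f0 that(4)])
    also have "\<dots> = quot_coeff i j f (box n r - Z)"
      unfolding f_def by (rule quot_coeff_coeff_commute[symmetric, OF that(3)])
    finally show ?thesis .
  qed
  have "g M = coeff_sf (PP A') M"
  proof (rule eigenfunction_unique[OF A'0, where r = r and u = g and v = "coeff_sf (PP A')"])
    show "nvar n (sum_mset A') M" using M True by (auto simp: nvar_def A'_def subseteq_box_iff)
    fix Z
    show "quot_symmetric n (coeff_sf (PP A')) Z" by (rule quot_symmetric_coeff)
    show "quot_symmetric n g Z" if "Z \<subseteq># box n r"
      unfolding quot_symmetric_def using Gg[OF _ _ _ that] quot_coeff_coeff_commute unfolding f_def by metis
    show "Z \<subseteq># box n r \<and> dom_le (exponents Z) A'" if "nvar n (sum_mset A') Z" "coeff_sf (PP A') Z \<noteq> 0"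
      using subseteq_BxI[of Z n r A'] that A' coeff_PP[OF A'0(1) that(2)] by (simp add: nvar_def)
    show "Z \<subseteq># box n r \<and> dom_le (exponents Z) A'" if "nvar n (sum_mset A') Z" "g Z \<noteq> 0"
    proof -
      have Z: "Z \<subseteq># box n r" "f (box n r - Z) \<noteq> 0" using that(2) by (auto simp: g_def split: if_splits)
      have "dom_le (exponents (box n r - Z)) A" using coeff_PP[OF A0(1)] Z(2) by (simp add: f_def)
      then have "dom_le (rcompl n r (exponents (box n r - Z))) A'"
        unfolding A'_def by (rule dom_le_rcompl[OF inbox_exponents[OF comp] A])
      then show ?thesis using Z(1) by (simp add: exponents_box_diff rcompl_rcompl inbox_exponents)
    qed
    show "coeff_sf (PP A') Z = 1" if "exponents Z = A'"
      using pcoeff_PP(1)[OF A'0(1)] that by (simp add: coeff_pcoeff)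
    show "g Z = 1" if "nvar n (sum_mset A') Z" "exponents Z = A'"
    proof -
      have Z: "Z \<subseteq># box n r" using subseteq_BxI[of Z n r A'] that A' by (simp add: nvar_def)
      then have "exponents (box n r - Z) = A" by (simp add: exponents_box_diff that(2) A'_def rcompl_rcompl[OF A])
      then show ?thesis using Z pcoeff_PP(1)[OF A0(1)] by (simp add: g_def f_def coeff_pcoeff)
    qed
    show "laplace_coeff n (coeff_sf (PP A')) Z = \<epsilon>' * coeff_sf (PP A') Z" if "Z \<subseteq># box n r" "size Z = sum_mset A'"
      using that by (intro \<epsilon>') (simp add: nvar_def subseteq_box_iff)
    \<comment> \<open>The quotients are invariant by \<open>Gg\<close>. The shift stems from the
      squares: the sum of (r - e_i)^2 is the sum of e_i^2 plus n r^2 - 2 r |A|.\<close>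
    show "laplace_coeff n g Z = (\<epsilon> + 2 * alpha * (of_nat (n * r\<^sup>2) - of_nat (2 * r * sum_mset A))) * g Z"
      if Z: "Z \<subseteq># box n r" "size Z = sum_mset A'"
    proof -
      define Z' where "Z' = box n r - Z"
      have sz': "size Z' = sum_mset A" using szc[OF Z(1)] sumA Z(2) by (simp add: Z'_def)
      have set': "set_mset Z' \<subseteq> {..<n}" using comp[of Z] unfolding subseteq_box_iff Z'_def by simp
      have cZ': "count Z i = r - count Z' i" "count Z' i \<le> r" if "i < n" for i
        using that Z(1) by (auto simp: Z'_def count_box subseteq_box_iff)
      have sumZ': "(\<Sum>i<n. count Z' i) = sum_mset A"
        using excess_exponents[OF _ set', of 0] by (simp add: size_exponents sz')
      have "(\<Sum>i<n. (count Z i)\<^sup>2) + 2 * r * (\<Sum>i<n. count Z' i) = (\<Sum>i<n. r\<^sup>2 + (count Z' i)\<^sup>2)"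
        unfolding sum_distrib_left sum.distrib[symmetric]
      proof (rule sum.cong[OF refl])
        fix i assume "i \<in> {..<n}"
        then obtain c where "r = count Z' i + c" using cZ'(2)[of i] by (auto simp: le_iff_add)
        then show "(count Z i)\<^sup>2 + 2 * r * count Z' i = r\<^sup>2 + (count Z' i)\<^sup>2"
          using cZ'(1)[of i] \<open>i \<in> {..<n}\<close> by (simp add: power2_eq_square algebra_simps)
      qed
      then have sq: "(\<Sum>i<n. (count Z i)\<^sup>2) + 2 * r * sum_mset A = n * r\<^sup>2 + (\<Sum>i<n. (count Z' i)\<^sup>2)"
        by (simp add: sumZ' sum.distrib)
      have shift: "x + c = b + y \<Longrightarrow> x = y + (b - c)" for x b c y :: ratfun
        by (simp add: algebra_simps)
      have sq': "of_nat (\<Sum>i<n. (count Z i)\<^sup>2) =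
          of_nat (\<Sum>i<n. (count Z' i)\<^sup>2) + (of_nat (n * r\<^sup>2) - of_nat (2 * r * sum_mset A) :: ratfun)"
        by (rule shift) (simp only: sq flip: of_nat_add)
      have gZ: "g Z = f Z'" using Z(1) by (simp add: g_def Z'_def)
      have "(\<Sum>i<n. \<Sum>j\<in>{..<n} - {i}. quot_coeff i j g Z) = (\<Sum>i<n. \<Sum>j\<in>{..<n} - {i}. quot_coeff i j f Z')"
        unfolding Z'_def by (intro sum.cong refl Gg Z(1)) auto
      then have "laplace_coeff n g Z = laplace_coeff n f Z' + 2 * alpha * (of_nat (n * r\<^sup>2) - of_nat (2 * r * sum_mset A)) * f Z'"
        unfolding laplace_coeff_def sq' gZ by (simp only: distrib_left distrib_right add.assoc add.commute add.left_commute)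
      also have "laplace_coeff n f Z' = \<epsilon> * f Z'" by (intro \<epsilon>) (simp add: nvar_def set' sz')
      finally show ?thesis by (simp only: gZ distrib_right)
    qed
  qed
  then show ?thesis using M by (simp add: g_def f_def A'_def)
next
  \<comment> \<open>In the wrong degree both coefficients vanish by homogeneity.\<close>
  case False
  have A0: "0 \<notin># A" using A by (simp add: inbox_def)
  have "size (box n r - M) + size M = n * r"
    using size_mset_mono[OF M] M by (simp add: size_Diff_submset size_box)
  then have "size (box n r - M) \<noteq> sum_mset A" using False sum_rcompl[OF A] by simp
  then have "coeff_sf (PP A) (box n r - M) = 0"
    using coeff_PP[OF A0, of "box n r - M"] dom_le_sum by (fastforce simp: size_exponents)
  moreover have "coeff_sf (PP (rcompl n r A)) M = 0"
    using coeff_PP[OF zero_notin_rcompl, of n r A M] dom_le_sum False by (fastforce simp: size_exponents)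
  ultimately show ?thesis by simp
qed

end

section \<open>Reflection of products in a box\<close>

lemma box_add: "box n (r + q) = box n r + box n q"
  by (simp add: multiset_eq_iff count_box)

lemma box_diff_add:
  assumes "X \<subseteq># box n r" "Y \<subseteq># box n q"
  shows "box n (r + q) - (X + Y) = (box n r - X) + (box n q - Y)"
proof -
  have "count (box n r) k + count (box n q) k - (count X k + count Y k) =
      (count (box n r) k - count X k) + (count (box n q) k - count Y k)" for k
    using mset_subset_eq_count[OF assms(1), of k] mset_subset_eq_count[OF assms(2), of k] by linarith
  then show ?thesis by (simp add: multiset_eq_iff box_add)
qed

text \<open>Reflection is multiplicative and the widths add, as the box monomials for r and q
  multiply to the one for r + q. Vanishing outside the boxes guarantees that no splitting is
  lost.\<close>

lemma coeff_mult_reflect: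
  fixes f g f' g' :: "'a::comm_ring_1 symfun"
  assumes f: "\<And>M. set_mset M \<subseteq> {..<n} \<Longrightarrow> coeff_sf f M = (if M \<subseteq># box n r then coeff_sf g (box n r - M) else 0)"
    and g: "\<And>M. set_mset M \<subseteq> {..<n} \<Longrightarrow> \<not> M \<subseteq># box n r \<Longrightarrow> coeff_sf g M = 0"
    and f': "\<And>M. set_mset M \<subseteq> {..<n} \<Longrightarrow> coeff_sf f' M = (if M \<subseteq># box n q then coeff_sf g' (box n q - M) else 0)"
    and g': "\<And>M. set_mset M \<subseteq> {..<n} \<Longrightarrow> \<not> M \<subseteq># box n q \<Longrightarrow> coeff_sf g' M = 0"
    and M: "set_mset M \<subseteq> {..<n}"
  shows "coeff_sf (f * f') M = (if M \<subseteq># box n (r + q) then coeff_sf (g * g') (box n (r + q) - M) else 0)"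
proof -
  define S where "S = {A. A \<subseteq># M \<and> A \<subseteq># box n r \<and> M - A \<subseteq># box n q}"
  have nv: "set_mset A \<subseteq> {..<n}" if "A \<subseteq># Z" "set_mset Z \<subseteq> {..<n}" for A Z
    using that set_mset_mono by blast
  have 1: "coeff_sf (f * f') M = (\<Sum>A\<in>S. coeff_sf f A * coeff_sf f' (M - A))"
    unfolding coeff_mult
  proof (rule sum.mono_neutral_right)
    show "\<forall>A\<in>{A. A \<subseteq># M} - S. coeff_sf f A * coeff_sf f' (M - A) = 0"
      using f[OF nv[OF _ M]] f'[OF nv[OF diff_subset_eq_self M]] by (auto simp: S_def)
  qed (auto simp: S_def finite_submultisets)
  show ?thesis
  proof (cases "M \<subseteq># box n (r + q)")
    case False
    have "S = {}"
    proof (rule ccontr)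
      assume "S \<noteq> {}"
      then obtain A where A: "A \<subseteq># M" "A \<subseteq># box n r" "M - A \<subseteq># box n q" by (auto simp: S_def)
      then have "A + (M - A) \<subseteq># box n r + box n q" by (intro subset_mset.add_mono)
      with A(1) False show False by (simp add: box_add)
    qed
    with 1 False show ?thesis by simp
  next
    case True
    define Z where "Z = box n (r + q) - M"
    define S' where "S' = {C. C \<subseteq># Z \<and> C \<subseteq># box n r \<and> Z - C \<subseteq># box n q}"
    have "Z \<subseteq># box n (r + q)" by (simp add: Z_def)
    then have Z: "set_mset Z \<subseteq> {..<n}" unfolding subseteq_box_iff by simp
    have invol: "box n k - (box n k - A) = A" if "A \<subseteq># box n k" for A k
      by (rule multiset_eqI) (use mset_subset_eq_count[OF that] in simp)
    have MZ: "M = box n (r + q) - Z" unfolding Z_def by (rule invol[OF True, symmetric])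
    have 2: "coeff_sf (g * g') Z = (\<Sum>C\<in>S'. coeff_sf g C * coeff_sf g' (Z - C))"
      unfolding coeff_mult
    proof (rule sum.mono_neutral_right)
      show "\<forall>A\<in>{A. A \<subseteq># Z} - S'. coeff_sf g A * coeff_sf g' (Z - A) = 0"
      proof
        fix A assume "A \<in> {A. A \<subseteq># Z} - S'"
        then have A: "A \<subseteq># Z" "\<not> A \<subseteq># box n r \<or> \<not> Z - A \<subseteq># box n q" by (auto simp: S'_def)
        from A(2) g[OF nv[OF A(1) Z]] g'[OF nv[OF diff_subset_eq_self[of Z A] Z]]
        show "coeff_sf g A * coeff_sf g' (Z - A) = 0" by (elim disjE) simp_all
      qed
    qed (auto simp: S'_def finite_submultisets)
    have main: "box n r - A \<in> {C. C \<subseteq># box n (r + q) - W \<and> C \<subseteq># box n r \<and> box n (r + q) - W - C \<subseteq># box n q} \<and>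
        box n (r + q) - W - (box n r - A) = box n q - (W - A)"
      if "A \<subseteq># W" "A \<subseteq># box n r" "W - A \<subseteq># box n q" for A W
    proof -
      have W: "A + (W - A) = W" using that(1) by simp
      have "box n (r + q) - W = (box n r - A) + (box n q - (W - A))"
        using box_diff_add[OF that(2,3)] unfolding W .
      then show ?thesis by simp
    qed
    have "(\<Sum>A\<in>S. coeff_sf f A * coeff_sf f' (M - A)) = (\<Sum>C\<in>S'. coeff_sf g C * coeff_sf g' (Z - C))"
    proof (rule sum.reindex_bij_witness[of _ "\<lambda>C. box n r - C" "\<lambda>A. box n r - A"])
      fix A assume "A \<in> S"
      then have A: "A \<subseteq># M" "A \<subseteq># box n r" "M - A \<subseteq># box n q" by (auto simp: S_def)
      show "box n r - (box n r - A) = A" by (rule invol[OF A(2)])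
      show "box n r - A \<in> S'" using main[OF A] by (simp add: S'_def Z_def)
      have "Z - (box n r - A) = box n q - (M - A)" using main[OF A] by (simp add: Z_def)
      then show "coeff_sf g (box n r - A) * coeff_sf g' (Z - (box n r - A)) = coeff_sf f A * coeff_sf f' (M - A)"
        using f[OF nv[OF A(1) M]] f'[OF nv[OF diff_subset_eq_self M]] A by simp
    next
      fix C assume "C \<in> S'"
      then have C: "C \<subseteq># Z" "C \<subseteq># box n r" "Z - C \<subseteq># box n q" by (auto simp: S'_def)
      show "box n r - (box n r - C) = C" by (rule invol[OF C(2)])
      show "box n r - C \<in> S" using main[OF C] unfolding S_def MZ[symmetric] by simp
    qed
    with 1 2 True show ?thesis by (simp add: Z_def)
  qed
qed

text \<open>Width 0 is treated apart because \<open>replicate_mset n 0\<close> would consist of zero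
  parts.\<close>

definition rect :: "nat \<Rightarrow> nat \<Rightarrow> nat multiset" where
  "rect n r = (if r = 0 then {#} else replicate_mset n r)"

lemma filter_positive_replicate [simp]:
  "0 < r \<Longrightarrow> filter_mset ((<) 0) (replicate_mset n r) = replicate_mset n (r :: nat)"
  by (induction n) auto

lemma rect_eq_rcompl: "rect n r = rcompl n r {#}"
  by (simp add: rect_def rcompl_def)

lemma inbox_empty: "inbox n r {#}"
  by (simp add: inbox_def)

lemma inbox_rect: "inbox n r (rect n r)"
  unfolding rect_eq_rcompl by (rule inbox_rcompl[OF inbox_empty])

lemma rcompl_rect: "rcompl n r (rect n r) = {#}"
  unfolding rect_eq_rcompl by (rule rcompl_rcompl[OF inbox_empty])

lemma inbox_mono: "inbox n r A \<Longrightarrow> r \<le> r' \<Longrightarrow> inbox n r' A"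
  by (auto simp: inbox_def)

lemma inboxD: "inbox n r A \<Longrightarrow> 0 \<notin># A" "inbox n r A \<Longrightarrow> size A \<le> n"
  by (auto simp: inbox_def)

definition drop_column :: "nat multiset \<Rightarrow> nat multiset" where
  "drop_column A = filter_mset (\<lambda>x. x \<noteq> 0) (image_mset (\<lambda>a. a - 1) A)"

lemma excess_drop_column: "excess t (drop_column A) = excess (Suc t) A"
  unfolding drop_column_def excess_filter_nonzero by (simp add: excess_def multiset.map_comp comp_def)

lemma zero_notin_drop_column: "0 \<notin># drop_column A"
  by (simp add: drop_column_def)

lemma sum_drop_column: "0 \<notin># A \<Longrightarrow> sum_mset (drop_column A) + size A = sum_mset A"
  using excess_drop_column[of 0 A] excess_1[of A] by simp

lemma inbox_drop_column: "inbox n r A \<Longrightarrow> inbox n r (drop_column A)"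
proof -
  assume A: "inbox n r A"
  have "size (drop_column A) \<le> size A" unfolding drop_column_def by (metis size_filter_mset_lesseq size_image_mset)
  with A show ?thesis by (auto simp: inbox_def drop_column_def)
qed

context jack_family
begin

lemma coeff_PP_box:
  assumes A: "inbox n r A" and M: "set_mset M \<subseteq> {..<n}"
  shows "coeff_sf (PP A) M = (if M \<subseteq># box n r then coeff_sf (PP (rcompl n r A)) (box n r - M) else 0)"
proof (cases "M \<subseteq># box n r")
  case True
  then show ?thesis using PP_reflect[OF inbox_rcompl[OF A] True] by (simp add: rcompl_rcompl[OF A])
next
  case False
  then have "coeff_sf (PP A) M = 0"
    using subseteq_BxI[OF M A coeff_PP[OF inboxD(1)[OF A], of M]] by auto
  with False show ?thesis by simp
qed

lemma coeff_PP_length: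
  assumes "0 \<notin># A" "coeff_sf (PP A) M \<noteq> 0"
  shows "size A \<le> card (set_mset M)"
  using dom_le_size[OF coeff_PP[OF assms] zero_notin_exponents assms(1)] by (simp add: size_exponents_card)

text \<open>Every monomial of P_N involves at least \<open>size N\<close> variables, hence so does
  every monomial of the product. Some exponent partition of the product lies above L and has no more
  parts than L.\<close>

lemma ji_mult_PP_size:
  assumes "0 \<notin># N" "0 \<notin># L" "\<langle>PP N * f, PP L\<rangle> \<noteq> 0"
  shows "size N \<le> size L"
proof -
  obtain C where C: "0 \<notin># C" "dom_le L C" "pcoeff (PP N * f) C \<noteq> 0"
    by (rule ji_PP_upper[OF assms(2,3)])
  obtain X Y where XY: "canon C = X + Y" "coeff_sf (PP N) X \<noteq> 0"
    using coeff_mult_nonzero C(3) unfolding pcoeff_def by blast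
  have "size N \<le> card (set_mset X)" by (rule coeff_PP_length[OF assms(1) XY(2)])
  also have "\<dots> \<le> card (set_mset (canon C))" by (intro card_mono) (auto simp: XY(1))
  also have "\<dots> = size C" using size_exponents_card[of "canon C"] by (simp add: exponents_canon[OF C(1)])
  also have "\<dots> \<le> size L" by (rule dom_le_size[OF C(2) assms(2) C(1)])
  finally show ?thesis .
qed

lemma coeff_PP_count:
  assumes "inbox n r A" "coeff_sf (PP A) M \<noteq> 0"
  shows "count M k \<le> r"
proof (cases "k \<in># M")
  case True
  then have "count M k \<in># exponents M" by (simp add: exponents_def)
  moreover have "\<forall>a\<in>#A. a \<le> r" using assms(1) by (simp add: inbox_def)
  ultimately show ?thesis using dom_le_bound[OF coeff_PP[OF inboxD(1)[OF assms(1)] assms(2)]] by blast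
next
  case False
  then have "count M k = 0" by (rule not_in_iff[THEN iffD1])
  then show ?thesis by simp
qed

lemma ji_mult_PP_inbox:
  assumes N: "inbox n r N" and N': "inbox n q N'" and L: "0 \<notin># L" "size L \<le> n"
    and nz: "\<langle>PP N * PP N', PP L\<rangle> \<noteq> 0"
  shows "inbox n (r + q) L"
proof -
  obtain C where C: "0 \<notin># C" "dom_le L C" "pcoeff (PP N * PP N') C \<noteq> 0"
    by (rule ji_PP_upper[OF L(1) nz])
  obtain X Y where XY: "canon C = X + Y" "coeff_sf (PP N) X \<noteq> 0" "coeff_sf (PP N') Y \<noteq> 0"
    using coeff_mult_nonzero C(3) unfolding pcoeff_def by blast
  have "c \<le> r + q" if "c \<in># C" for c
  proof -
    have "c \<in># exponents (canon C)" using that by (simp add: exponents_canon[OF C(1)])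
    then obtain k where "c = count (canon C) k" by (auto simp: exponents_def)
    then show ?thesis
      using coeff_PP_count[OF N XY(2), of k] coeff_PP_count[OF N' XY(3), of k] by (simp add: XY(1))
  qed
  then show ?thesis using dom_le_bound[OF C(2)] L by (auto simp: inbox_def)
qed

text \<open>In n variables the expansion of the product is reflected term by term, and Jack
  functions of partitions with more than n parts vanish there. Agreement in n variables decides the
  pairing with P of a partition with at most n parts, by \<open>ji_PP_upper\<close> and
  \<open>dom_le_size\<close>.\<close>

lemma ji_mult_PP_reflect:
  assumes N: "inbox n r N" and N': "inbox n q N'" and L: "0 \<notin># L" "size L \<le> n"
    and nz: "\<langle>PP N * PP N', PP L\<rangle> \<noteq> 0"
  shows "\<langle>PP (rcompl n r N) * PP (rcompl n q N'), PP (rcompl n (r + q) L)\<rangle> \<noteq> 0"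
proof -
  define f where "f = PP N * PP N'"
  define f' where "f' = PP (rcompl n r N) * PP (rcompl n q N')"
  obtain T c where T: "finite T" "T \<subseteq> positive_parts" "f = (\<Sum>A\<in>T. scale_sf (c A) (PP A))"
    "\<forall>A. 0 \<notin># A \<longrightarrow> \<langle>f, PP A\<rangle> = (if A \<in> T then c A * \<langle>PP A, PP A\<rangle> else 0)"
    using PP_expand[of f] by (elim exE conjE) (rule that)
  define T' where "T' = {A \<in> T. size A \<le> n \<and> c A \<noteq> 0}"
  have T': "inbox n (r + q) A" if "A \<in> T'" for A
  proof -
    have A: "A \<in> T" "0 \<notin># A" "size A \<le> n" "c A \<noteq> 0" using that T(2) by (auto simp: T'_def)
    then have "\<langle>f, PP A\<rangle> \<noteq> 0" using T(4) norm_PP by simp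
    then show ?thesis using ji_mult_PP_inbox[OF N N' A(2,3)] by (simp add: f_def)
  qed
  have LT: "L \<in> T'" using nz L T(4) by (auto simp: T'_def f_def split: if_splits)
  define f'' where "f'' = (\<Sum>A\<in>T'. scale_sf (c A) (PP (rcompl n (r + q) A)))"
  have eq: "coeff_sf (f' - f'') M = 0" if M: "set_mset M \<subseteq> {..<n}" for M
  proof -
    have box: "coeff_sf (PP (rcompl n k A)) Z = (if Z \<subseteq># box n k then coeff_sf (PP A) (box n k - Z) else 0)"
      if "inbox n k A" "set_mset Z \<subseteq> {..<n}" for A k Z
      using coeff_PP_box[OF inbox_rcompl[OF that(1)] that(2)] by (simp add: rcompl_rcompl[OF that(1)])
    have "coeff_sf f' M = (if M \<subseteq># box n (r + q) then coeff_sf f (box n (r + q) - M) else 0)"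
      unfolding f'_def f_def
    proof (rule coeff_mult_reflect[OF box[OF N] _ box[OF N'] _ M])
      show "coeff_sf (PP N) Z = 0" if "set_mset Z \<subseteq> {..<n}" "\<not> Z \<subseteq># box n r" for Z
        using coeff_PP_box[OF N that(1)] that(2) by simp
      show "coeff_sf (PP N') Z = 0" if "set_mset Z \<subseteq> {..<n}" "\<not> Z \<subseteq># box n q" for Z
        using coeff_PP_box[OF N' that(1)] that(2) by simp
    qed
    moreover have "coeff_sf f (box n (r + q) - M) = (\<Sum>A\<in>T'. c A * coeff_sf (PP A) (box n (r + q) - M))"
      unfolding T(3) coeff_sum coeff_scale
    proof (rule sum.mono_neutral_right)
      have "set_mset (box n (r + q) - M) \<subseteq> {..<n}"
        using subseteq_box_iff[of "box n (r + q) - M" n "r + q"] by simp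
      then have "card (set_mset (box n (r + q) - M)) \<le> n"
        using card_mono[of "{..<n}" "set_mset (box n (r + q) - M)"] by simp
      then have short: "size A \<le> n" if "0 \<notin># A" "coeff_sf (PP A) (box n (r + q) - M) \<noteq> 0" for A
        using coeff_PP_length[OF that] by linarith
      show "\<forall>A\<in>T - T'. c A * coeff_sf (PP A) (box n (r + q) - M) = 0"
      proof
        fix A assume "A \<in> T - T'"
        then have "0 \<notin># A" "size A \<le> n \<longrightarrow> c A = 0" using T(2) by (auto simp: T'_def)
        with short[of A] show "c A * coeff_sf (PP A) (box n (r + q) - M) = 0"
          by (cases "coeff_sf (PP A) (box n (r + q) - M) = 0") simp_all
      qed
    qed (use T(1) in \<open>auto simp: T'_def\<close>)
    moreover have "coeff_sf f'' M = (if M \<subseteq># box n (r + q) then (\<Sum>A\<in>T'. c A * coeff_sf (PP A) (box n (r + q) - M)) else 0)"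
      unfolding f''_def coeff_sum coeff_scale using box[OF T' M] by simp
    ultimately show ?thesis by simp
  qed
  have cL: "0 \<notin># rcompl n (r + q) L" "size (rcompl n (r + q) L) \<le> n"
    using inbox_rcompl[OF T'[OF LT]] by (auto simp: inbox_def)
  have "\<langle>f' - f'', PP (rcompl n (r + q) L)\<rangle> = 0"
  proof (rule ccontr)
    assume "\<langle>f' - f'', PP (rcompl n (r + q) L)\<rangle> \<noteq> 0"
    then obtain C where C: "0 \<notin># C" "dom_le (rcompl n (r + q) L) C" "pcoeff (f' - f'') C \<noteq> 0"
      by (rule ji_PP_upper[OF cL(1)])
    have "size C \<le> n" using dom_le_size[OF C(2) cL(1) C(1)] cL(2) by simp
    then have "set_mset (canon C) \<subseteq> {..<n}" using set_canon[of C] by auto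
    from eq[OF this] C(3) show False by (simp add: pcoeff_def)
  qed
  then have "\<langle>f', PP (rcompl n (r + q) L)\<rangle> = (\<Sum>A\<in>T'. c A * \<langle>PP (rcompl n (r + q) A), PP (rcompl n (r + q) L)\<rangle>)"
    by (simp add: f''_def)
  also have "\<dots> = (\<Sum>A\<in>T'. if A = L then c L * \<langle>PP (rcompl n (r + q) L), PP (rcompl n (r + q) L)\<rangle> else 0)"
  proof (rule sum.cong[OF refl])
    fix A assume A: "A \<in> T'"
    have inj: "A = L" if "rcompl n (r + q) A = rcompl n (r + q) L"
      using rcompl_rcompl[OF T'[OF A]] rcompl_rcompl[OF T'[OF LT]] unfolding that by simp
    then show "c A * \<langle>PP (rcompl n (r + q) A), PP (rcompl n (r + q) L)\<rangle> =
        (if A = L then c L * \<langle>PP (rcompl n (r + q) L), PP (rcompl n (r + q) L)\<rangle> else 0)"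
    proof (cases "A = L")
      case False
      with inj have "rcompl n (r + q) A \<noteq> rcompl n (r + q) L" by blast
      then show ?thesis using ji_PP[OF zero_notin_rcompl zero_notin_rcompl] False by simp
    qed simp
  qed
  also have "\<dots> = c L * \<langle>PP (rcompl n (r + q) L), PP (rcompl n (r + q) L)\<rangle>"
    using LT T(1) by (simp add: T'_def)
  also have "\<dots> \<noteq> 0" using LT norm_PP[OF cL(1)] by (simp add: T'_def)
  finally show ?thesis by (simp add: f'_def)
qed

lemma inbox_column: "k \<le> n \<Longrightarrow> inbox n 1 (replicate_mset k 1)"
  by (auto simp: inbox_def)

text \<open>In width one the complement of a column is a column again. The lower bound for the
  reflected product concerns width 1 + r, and returning to width r costs the shift to s - 1.\<close>

lemma column_mult_lower:
  assumes k: "k \<le> n" and N: "inbox n r N" and L: "inbox n r L" and s: "0 < s"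
    and nz: "\<langle>PP (replicate_mset k 1) * PP N, PP L\<rangle> \<noteq> 0"
  shows "excess s (rcompl n r N) \<le> excess (s - 1) (rcompl n r L)"
proof -
  have "\<langle>PP (rcompl n 1 (replicate_mset k 1)) * PP (rcompl n r N), PP (rcompl n (1 + r) L)\<rangle> \<noteq> 0"
    by (rule ji_mult_PP_reflect[OF inbox_column[OF k] N inboxD[OF L] nz])
  then have "excess s (rcompl n r N) \<le> excess s (rcompl n (1 + r) L)"
    by (intro ji_mult_PP_lower) auto
  also have "\<dots> = excess (s - 1) (rcompl n r L)" using excess_rcompl_Suc[OF s L] by simp
  finally show ?thesis .
qed

lemma PP_empty: "PP {#} = 1"
proof -
  have "A = {#}" if "A \<in> ptns (sum_mset {#})" for A
    using that by (cases A) (auto simp: ptns_def)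
  then have e: "ptns 0 - {{#}} = {}" by auto
  show ?thesis using PP_expand_mon(2)[of "{#}"] by (simp add: mon_empty e)
qed

text \<open>Monomials of P_(1^k) have exponents at most 1, so the excess of the product at t + 1 is
  at most that of the other factor at t. Taking k as the number of parts of N makes N itself the
  bound.\<close>

lemma column_mult_upper:
  assumes N: "0 \<notin># N"
  defines "f \<equiv> PP (replicate_mset (size N) 1) * PP (drop_column N)"
  shows "0 \<notin># C \<Longrightarrow> pcoeff f C \<noteq> 0 \<Longrightarrow> dom_le C N" and "pcoeff f N = 1"
proof -
  define k where "k = size N"
  have col: "inbox k 1 (replicate_mset k 1)" by (rule inbox_column) simp
  show "dom_le C N" if C: "0 \<notin># C" and nz: "pcoeff f C \<noteq> 0"
  proof -
    obtain X Y where XY: "canon C = X + Y" "coeff_sf (PP (replicate_mset k 1)) X \<noteq> 0" "coeff_sf (PP (drop_column N)) Y \<noteq> 0"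
      using coeff_mult_nonzero nz unfolding pcoeff_def f_def k_def by blast
    have X1: "count X i \<le> 1" for i by (rule coeff_PP_count[OF col XY(2)])
    have dX: "dom_le (exponents X) (replicate_mset k 1)" by (rule coeff_PP[OF inboxD(1)[OF col] XY(2)])
    have dY: "dom_le (exponents Y) (drop_column N)" by (rule coeff_PP[OF zero_notin_drop_column XY(3)])
    define I where "I = set_mset (canon C)"
    have I: "finite I" "set_mset (canon C) \<subseteq> I" "set_mset Y \<subseteq> I" by (auto simp: I_def XY(1))
    have sumC: "sum_mset C = sum_mset N"
    proof -
      have "sum_mset C = size X + size Y"
        using size_exponents[of "canon C"] unfolding exponents_canon[OF C] by (simp add: XY(1))
      then show ?thesis
        using dom_le_sum[OF dX] dom_le_sum[OF dY] sum_drop_column[OF N] by (simp add: size_exponents k_def)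
    qed
    have "excess t C \<le> excess t N" for t
    proof (cases t)
      case 0
      then show ?thesis using sumC by simp
    next
      case (Suc u)
      have "excess t C = (\<Sum>i\<in>I. count (canon C) i - t)"
        using excess_exponents[OF I(1,2), of t] by (simp add: exponents_canon[OF C])
      also have "\<dots> \<le> (\<Sum>i\<in>I. count Y i - u)"
      proof (rule sum_mono)
        fix i
        show "count (canon C) i - t \<le> count Y i - u" using X1[of i] by (simp add: XY(1) Suc)
      qed
      also have "\<dots> = excess u (exponents Y)" by (rule excess_exponents[OF I(1,3), symmetric])
      also have "\<dots> \<le> excess u (drop_column N)" by (rule dom_le_excess[OF dY])
      finally show ?thesis by (simp add: excess_drop_column Suc)
    qed
    with sumC show ?thesis by (simp add: dom_le_def)
  qed
  \<comment> \<open>The product of all k variables of \<open>canon N\<close>. A monomial of P_(1^k)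
    dividing \<open>canon N\<close> has exponents at most 1 and degree k, so it must be E.\<close>
  define E where "E = mset_set (set_mset (canon N))"
  have cardN: "card (set_mset (canon N)) = k"
    using size_exponents_card[of "canon N"] by (simp add: exponents_canon[OF N] k_def)
  have cE: "count E i = (if i \<in># canon N then 1 else 0)" for i by (simp add: E_def)
  have E: "E \<subseteq># canon N" unfolding subseteq_mset_def by (simp add: cE Suc_le_eq)
  have expE: "exponents E = replicate_mset k 1"
  proof -
    have "set_mset E = set_mset (canon N)" by (simp add: E_def)
    then have "exponents E = image_mset (count E) (mset_set (set_mset (canon N)))"
      unfolding exponents_def by (simp only:)
    also have "\<dots> = image_mset (\<lambda>_. 1) (mset_set (set_mset (canon N)))"
      by (intro image_mset_cong) (simp add: cE)
    finally have "exponents E = image_mset (\<lambda>_. 1) (mset_set (set_mset (canon N)))" .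
    then show ?thesis by (simp add: image_mset_const_eq cardN)
  qed
  have expR: "exponents (canon N - E) = drop_column N"
  proof -
    have "set_mset (canon N - E) \<subseteq> set_mset (canon N)" by (auto dest: in_diffD)
    then have "exponents (canon N - E) =
        filter_mset (\<lambda>a. a \<noteq> 0) (image_mset (count (canon N - E)) (mset_set (set_mset (canon N))))"
      by (intro exponents_count) auto
    also have "image_mset (count (canon N - E)) (mset_set (set_mset (canon N))) =
        image_mset (\<lambda>a. a - 1) (exponents (canon N))"
      unfolding exponents_def multiset.map_comp by (intro image_mset_cong) (simp add: cE)
    finally show ?thesis by (simp only: drop_column_def exponents_canon[OF N])
  qed
  have "pcoeff f N = (\<Sum>A | A \<subseteq># canon N. coeff_sf (PP (replicate_mset k 1)) A * coeff_sf (PP (drop_column N)) (canon N - A))"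
    by (simp only: pcoeff_def f_def coeff_mult k_def)
  also have "\<dots> = (\<Sum>A | A \<subseteq># canon N. if A = E then 1 else 0)"
  proof (rule sum.cong[OF refl])
    fix A assume "A \<in> {A. A \<subseteq># canon N}"
    then have A: "A \<subseteq># canon N" by simp
    show "coeff_sf (PP (replicate_mset k 1)) A * coeff_sf (PP (drop_column N)) (canon N - A) = (if A = E then 1 else 0)"
    proof (cases "coeff_sf (PP (replicate_mset k 1)) A = 0")
      case False
      have A1: "count A i \<le> 1" for i by (rule coeff_PP_count[OF col False])
      have AE: "A \<subseteq># E"
        unfolding subseteq_mset_def
      proof
        fix i
        show "count A i \<le> count E i"
        proof (cases "i \<in># canon N")
          case True
          with A1[of i] show ?thesis by (simp add: cE)
        next
          case False
          then have "count (canon N) i = 0" by (rule not_in_iff[THEN iffD1])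
          with mset_subset_eq_count[OF A, of i] show ?thesis by simp
        qed
      qed
      have "size A = k"
        using dom_le_sum[OF coeff_PP[OF inboxD(1)[OF col] False]] by (simp add: size_exponents)
      moreover have "size E = k" by (simp add: E_def cardN)
      moreover obtain D where D: "E = A + D" using AE by (auto simp: subset_mset.le_iff_add)
      ultimately have "A = E" by simp
      then show ?thesis
        using pcoeff_PP(1)[OF inboxD(1)[OF col]] pcoeff_PP(1)[OF zero_notin_drop_column, of N] by (simp add: coeff_pcoeff expE expR)
    next
      case True
      moreover have "A \<noteq> E"
        using True pcoeff_PP(1)[OF inboxD(1)[OF col]] by (auto simp: coeff_pcoeff expE)
      ultimately show ?thesis by simp
    qed
  qed
  also have "\<dots> = 1" using E by (simp add: finite_submultisets)
  finally show "pcoeff f N = 1" .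
qed

text \<open>Induction on \<open>N\<close>: its Jack function is the leading term of the product of a column with the
  Jack function of \<open>N\<close> without its first column.\<close>
lemma pairing_dom_le:
  assumes "inbox n r N" "0 \<notin># L" "\<langle>PP L * PP N, PP (rect n r)\<rangle> \<noteq> 0"
  shows "inbox n r L \<and> dom_le (rcompl n r L) N"
  using assms
proof (induction "sum_mset N" arbitrary: N L rule: less_induct)
  case (less m)
  \<comment> \<open>The number of parts is bounded by \<open>ji_mult_PP_size\<close> and the largest
    part by the vanishing of the excess of the rectangle at r.\<close>
  have boxL: "inbox n r L" if L: "0 \<notin># L" and nz: "\<langle>PP L * PP N, PP (rect n r)\<rangle> \<noteq> 0" for L N
  proof -
    have "size L \<le> n"
      using ji_mult_PP_size[OF L inboxD(1)[OF inbox_rect] nz] inboxD(2)[OF inbox_rect[of n r]] by simp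
    moreover have "excess r L \<le> excess r (rect n r)"
      using ji_mult_PP_lower[OF L inboxD(1)[OF inbox_rect], of "PP N"] nz by (simp add: mult.commute)
    then have "excess r L = 0" by (simp add: inbox_excess_ge[OF inbox_rect order_refl])
    then have "\<forall>a\<in>#L. a \<le> r" by (simp only: excess_eq_0_iff)
    ultimately show ?thesis using L by (simp add: inbox_def)
  qed
  \<comment> \<open>An inner induction along dominance, among partitions of the weight of
    \<open>m\<close>, which the outer induction on the weight has fixed. It deals with the terms
    strictly below N in the product of a column with P of \<open>drop_column N\<close>.\<close>
  have "0 \<notin># N \<longrightarrow> sum_mset N = sum_mset m \<longrightarrow> inbox n r N \<longrightarrow> 0 \<notin># L \<longrightarrow> \<langle>PP L * PP N, PP (rect n r)\<rangle> \<noteq> 0 \<longrightarrow> dom_le (rcompl n r L) N"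
    if N0: "0 \<notin># N" for N L
    using N0
  proof (induction N arbitrary: L rule: mon_PP_induct)
    case (step N)
    show ?case
    proof (intro impI)
      assume N: "inbox n r N" and sN: "sum_mset N = sum_mset m" and L: "0 \<notin># L" and nz: "\<langle>PP L * PP N, PP (rect n r)\<rangle> \<noteq> 0"
      have bL: "inbox n r L" by (rule boxL[OF L nz])
      show "dom_le (rcompl n r L) N"
      proof (cases "N = {#}")
        case True
        then have "L = rect n r" using ji_PP[OF L inboxD(1)[OF inbox_rect]] nz by (auto simp: PP_empty)
        then show ?thesis by (simp add: True rcompl_rect)
      next
        case False
        define k where "k = size N"
        have k: "0 < k" "k \<le> n" using False N by (auto simp: k_def inbox_def nonempty_has_size)
        define f where "f = PP (replicate_mset k 1) * PP (drop_column N)"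
        obtain T c where T: "finite T" "T \<subseteq> positive_parts" "f = (\<Sum>A\<in>T. scale_sf (c A) (PP A))"
          "\<forall>A. 0 \<notin># A \<longrightarrow> \<langle>f, PP A\<rangle> = (if A \<in> T then c A * \<langle>PP A, PP A\<rangle> else 0)"
          using PP_expand[of f] by (elim exE conjE) (rule that)
        have Tle: "dom_le A N" if "A \<in> T" "c A \<noteq> 0" for A
        proof -
          have A0: "0 \<notin># A" using that T(2) by auto
          then have "\<langle>f, PP A\<rangle> \<noteq> 0" using that T(4) norm_PP by simp
          then obtain C where C: "0 \<notin># C" "dom_le A C" "pcoeff f C \<noteq> 0" by (rule ji_PP_upper[OF A0])
          then have "dom_le C N" using column_mult_upper(1)[OF step(1) C(1)] by (simp add: f_def k_def)
          with C(2) show ?thesis by (rule dom_le_trans)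
        qed
        have "(\<Sum>A\<in>T. c A * pcoeff (PP A) N) \<noteq> 0"
          using column_mult_upper(2)[OF step(1)] T(3) by (simp add: f_def k_def pcoeff_def)
        then obtain A where A: "A \<in> T" "c A * pcoeff (PP A) N \<noteq> 0" by (rule sum.not_neutral_contains_not_neutral)
        then have A0: "0 \<notin># A" "c A \<noteq> 0" "pcoeff (PP A) N \<noteq> 0" using T(2) by auto
        have "A = N"
          using dom_le_antisym[OF A0(1) step(1) Tle[OF A(1) A0(2)] pcoeff_PP(2)[OF A0(1) step(1) A0(3)]] .
        then have NT: "N \<in> T" "c N \<noteq> 0" using A A0 by auto
        have expand: "\<langle>PP L * f, PP (rect n r)\<rangle> = c N * \<langle>PP L * PP N, PP (rect n r)\<rangle> +
            (\<Sum>A\<in>T - {N}. c A * \<langle>PP L * PP A, PP (rect n r)\<rangle>)"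
        proof -
          have "\<langle>PP L * f, PP (rect n r)\<rangle> = (\<Sum>A\<in>T. c A * \<langle>PP L * PP A, PP (rect n r)\<rangle>)"
            by (simp add: T(3) sum_distrib_left scale_mult_right)
          also have "\<dots> = c N * \<langle>PP L * PP N, PP (rect n r)\<rangle> +
              (\<Sum>A\<in>T - {N}. c A * \<langle>PP L * PP A, PP (rect n r)\<rangle>)"
            by (rule sum.remove[OF T(1) NT(1)])
          finally show ?thesis .
        qed
        show ?thesis
        \<comment> \<open>If this pairing vanishes, a term of f strictly below N must pair with P_L,
          and the inner hypothesis applies. Otherwise the column is transferred from N to L and the
          outer hypothesis applies to \<open>drop_column N\<close>.\<close>
        proof (cases "\<langle>PP L * f, PP (rect n r)\<rangle> = 0")
          case True
          have "(\<Sum>A\<in>T - {N}. c A * \<langle>PP L * PP A, PP (rect n r)\<rangle>) \<noteq> 0"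
            using expand True nz NT(2) by auto
          then obtain A where A: "A \<in> T - {N}" "c A * \<langle>PP L * PP A, PP (rect n r)\<rangle> \<noteq> 0"
            by (rule sum.not_neutral_contains_not_neutral)
          then have A0: "0 \<notin># A" "c A \<noteq> 0" "A \<noteq> N" "\<langle>PP L * PP A, PP (rect n r)\<rangle> \<noteq> 0" using T(2) by auto
          have AN: "dom_le A N" using Tle A A0 by auto
          have "inbox n r A" by (rule boxL[OF A0(1), of L]) (use A0(4) in \<open>simp add: mult.commute\<close>)
          then have "dom_le (rcompl n r L) A"
            using step(2)[OF A0(1) AN A0(3)] A0 L sN dom_le_sum[OF AN] by simp
          then show ?thesis using AN by (rule dom_le_trans)
        next
          case False
          define h where "h = PP (replicate_mset k 1) * PP L"
          have "\<langle>h * PP (drop_column N), PP (rect n r)\<rangle> \<noteq> 0"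
            using False by (simp add: h_def f_def mult_ac)
          moreover obtain U d where U: "finite U" "U \<subseteq> positive_parts" "h = (\<Sum>A\<in>U. scale_sf (d A) (PP A))"
            "\<forall>A. 0 \<notin># A \<longrightarrow> \<langle>h, PP A\<rangle> = (if A \<in> U then d A * \<langle>PP A, PP A\<rangle> else 0)"
            using PP_expand[of h] by (elim exE conjE) (rule that)
          ultimately have "(\<Sum>A\<in>U. d A * \<langle>PP A * PP (drop_column N), PP (rect n r)\<rangle>) \<noteq> 0"
            by (simp add: sum_distrib_right scale_mult_left)
          then obtain A where A: "A \<in> U" "d A * \<langle>PP A * PP (drop_column N), PP (rect n r)\<rangle> \<noteq> 0"
            by (rule sum.not_neutral_contains_not_neutral)
          then have A0: "0 \<notin># A" "d A \<noteq> 0" "\<langle>PP A * PP (drop_column N), PP (rect n r)\<rangle> \<noteq> 0" using U(2) by auto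
          have hA: "\<langle>h, PP A\<rangle> \<noteq> 0" using U(4) A(1) A0(1,2) norm_PP by simp
          have "sum_mset (drop_column N) < sum_mset m" using sum_drop_column[OF step(1)] sN k by (simp add: k_def)
          from less.hyps[OF this inbox_drop_column[OF N] A0(1,3)]
          have IH: "inbox n r A" "dom_le (rcompl n r A) (drop_column N)" by auto
          have sums: "sum_mset (rcompl n r L) = sum_mset N"
          proof -
            have "sum_mset (rect n r) = sum_mset L + sum_mset N"
              by (rule ji_mult_PP_sum[OF L step(1) inboxD(1)[OF inbox_rect] nz])
            moreover have "sum_mset (rect n r) = n * r" using sum_rcompl[OF inbox_empty, of n r] by (simp add: rect_eq_rcompl)
            ultimately show ?thesis using sum_rcompl[OF bL] by simp
          qed
          have "excess s (rcompl n r L) \<le> excess s N" for s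
          proof (cases s)
            case 0
            then show ?thesis using sums by simp
          next
            case (Suc u)
            \<comment> \<open>Adding the column to L and removing it from N shift the parameter by
              the same unit, so the two shifts cancel.\<close>
            have "excess s (rcompl n r L) \<le> excess u (rcompl n r A)"
              using column_mult_lower[OF k(2) bL IH(1), of s] hA by (simp add: h_def Suc)
            also have "\<dots> \<le> excess u (drop_column N)" by (rule dom_le_excess[OF IH(2)])
            finally show ?thesis by (simp add: excess_drop_column Suc)
          qed
          then show ?thesis using sums by (simp add: dom_le_def)
        qed
      qed
    qed
  qed
  with less.prems boxL show ?case by (simp add: inbox_def)
qed

lemma pairing_unique:
  assumes "inbox n r N" "0 \<notin># L" "\<langle>PP L * PP N, PP (rect n r)\<rangle> \<noteq> 0"
  shows "L = rcompl n r N"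
proof -
  have 1: "inbox n r L" "dom_le (rcompl n r L) N" using pairing_dom_le[OF assms] by auto
  have "\<langle>PP N * PP L, PP (rect n r)\<rangle> \<noteq> 0" using assms(3) by (simp add: mult.commute)
  from pairing_dom_le[OF 1(1) inboxD(1)[OF assms(1)] this] have 2: "dom_le (rcompl n r N) L" by simp
  have "dom_le L (rcompl n r N)"
    using dom_le_rcompl[OF inbox_rcompl[OF 1(1)] assms(1) 1(2)] by (simp add: rcompl_rcompl[OF 1(1)])
  then show ?thesis using dom_le_antisym[OF assms(2) zero_notin_rcompl _ 2] by simp
qed

text \<open>If P_N paired to zero with its complement, then by uniqueness with every P_A, and all
  multiples of P_N would be orthogonal to P_R. The multiple P_N P_S contains P of N + S, and pairing
  with the complement of N + S isolates that term.\<close>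

lemma pairing_nonzero_remove_rows:
  assumes N: "0 \<notin># N" "0 \<notin># S" "inbox n r (N + S)"
    and nz: "\<langle>PP (N + S) * PP (rcompl n r (N + S)), PP (rect n r)\<rangle> \<noteq> 0"
  shows "\<langle>PP N * PP (rcompl n r N), PP (rect n r)\<rangle> \<noteq> 0"
proof
  assume z: "\<langle>PP N * PP (rcompl n r N), PP (rect n r)\<rangle> = 0"
  have boxN: "inbox n r N" using N(3) by (auto simp: inbox_def)
  have 0: "\<langle>PP N * PP A, PP (rect n r)\<rangle> = 0" if "0 \<notin># A" for A
    using pairing_unique[OF boxN that] z by (metis mult.commute)
  have "\<langle>PP N * h, PP (rect n r)\<rangle> = 0" for h
  proof -
    have h: "h \<in> sf.span (PP ` positive_parts)" by (simp only: span_PP UNIV_I)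
    show ?thesis
      by (rule sf.span_induct[OF h]) (use 0 in \<open>auto simp: sf.subspace_def distrib_left scale_mult_right\<close>)
  qed
  then have zero: "\<langle>(PP N * PP S) * PP (rcompl n r (N + S)), PP (rect n r)\<rangle> = 0" by (simp add: mult.assoc)
  obtain T c where T: "finite T" "T \<subseteq> positive_parts" "PP N * PP S = (\<Sum>A\<in>T. scale_sf (c A) (PP A))"
    "\<forall>A. 0 \<notin># A \<longrightarrow> \<langle>PP N * PP S, PP A\<rangle> = (if A \<in> T then c A * \<langle>PP A, PP A\<rangle> else 0)"
    using PP_expand[of "PP N * PP S"] by (elim exE conjE) (rule that)
  have "\<langle>(PP N * PP S) * PP (rcompl n r (N + S)), PP (rect n r)\<rangle> =
      (\<Sum>A\<in>T. c A * \<langle>PP A * PP (rcompl n r (N + S)), PP (rect n r)\<rangle>)"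
    by (simp add: T(3) sum_distrib_right scale_mult_left)
  also have "\<dots> = (\<Sum>A\<in>T. if A = N + S then c A * \<langle>PP A * PP (rcompl n r (N + S)), PP (rect n r)\<rangle> else 0)"
  proof (rule sum.cong[OF refl])
    fix A assume "A \<in> T"
    then have "0 \<notin># A" using T(2) by auto
    from pairing_unique[OF inbox_rcompl[OF N(3)] this]
    show "c A * \<langle>PP A * PP (rcompl n r (N + S)), PP (rect n r)\<rangle> =
        (if A = N + S then c A * \<langle>PP A * PP (rcompl n r (N + S)), PP (rect n r)\<rangle> else 0)"
      by (auto simp: rcompl_rcompl[OF N(3)])
  qed
  finally have "(if N + S \<in> T then c (N + S) * \<langle>PP (N + S) * PP (rcompl n r (N + S)), PP (rect n r)\<rangle> else 0) = 0"
    using zero T(1) by simp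
  moreover have "N + S \<in> T" "c (N + S) \<noteq> 0"
    using ji_mult_PP_union[OF N(1,2)] T(4) N(1,2) by (auto split: if_splits)
  ultimately show False using nz by simp
qed

lemma rcompl_rect_double: "rcompl n (Suc r + r) (rect n r) = rect n (Suc r)"
  by (cases "r = 0") (auto simp: rcompl_def rect_def)

lemma pairing_nonzero:
  assumes "inbox n r N"
  shows "\<langle>PP N * PP (rcompl n r N), PP (rect n r)\<rangle> \<noteq> 0"
  using assms
proof (induction r arbitrary: N)
  case 0
  then have "\<forall>a\<in>#N. a = 0" "0 \<notin># N" by (auto simp: inbox_def)
  then have "N = {#}" by (cases N) auto
  moreover have "rcompl n 0 {#} = {#}" using rect_eq_rcompl[of n 0] by (simp add: rect_def)
  ultimately show ?case by (simp add: rect_def PP_empty ji_1_left coeff_1)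
next
  case (Suc r)
  \<comment> \<open>N is reflected in width r + 1 and its complement in width r, where the second
    reflection gives N back. The rectangle (r^n) is reflected in width 2r + 1 and becomes
    ((r+1)^n).\<close>
  have narrow: "\<langle>PP N * PP (rcompl n (Suc r) N), PP (rect n (Suc r))\<rangle> \<noteq> 0" if N: "inbox n r N" for N
  proof -
    have "\<langle>PP (rcompl n (Suc r) N) * PP (rcompl n r (rcompl n r N)), PP (rcompl n (Suc r + r) (rect n r))\<rangle> \<noteq> 0"
      by (rule ji_mult_PP_reflect[OF inbox_mono[OF N] inbox_rcompl[OF N] inboxD[OF inbox_rect] Suc.IH[OF N]]) simp
    then show ?thesis unfolding rcompl_rcompl[OF N] rcompl_rect_double by (simp add: mult.commute)
  qed
  \<comment> \<open>With n parts there is no empty row, so the complement has parts at most r and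
    \<open>narrow\<close> applies with the factors exchanged.\<close>
  have full: "\<langle>PP N * PP (rcompl n (Suc r) N), PP (rect n (Suc r))\<rangle> \<noteq> 0" if N: "inbox n (Suc r) N" "size N = n" for N
  proof -
    have "x \<le> r" if "x \<in># rcompl n (Suc r) N" for x
    proof -
      from that obtain a where "a \<in># N" "x = Suc r - a" by (auto simp: rcompl_def N(2))
      moreover from this inboxD(1)[OF N(1)] have "a \<noteq> 0" by (cases a) auto
      ultimately show ?thesis by simp
    qed
    with inbox_rcompl[OF N(1)] have "inbox n r (rcompl n (Suc r) N)" by (simp add: inbox_def)
    from narrow[OF this] show ?thesis by (simp add: rcompl_rcompl[OF N(1)] mult.commute)
  qed
  \<comment> \<open>Rows of full length are added until there are n parts;
    \<open>pairing_nonzero_remove_rows\<close> takes them away again.\<close>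
  define S where "S = replicate_mset (n - size N) (Suc r)"
  have NS: "inbox n (Suc r) (N + S)" "size (N + S) = n" using Suc.prems by (auto simp: inbox_def S_def)
  have "0 \<notin># S" by (simp add: S_def)
  then show ?case by (rule pairing_nonzero_remove_rows[OF inboxD(1)[OF Suc.prems] _ NS(1) full[OF NS]])
qed

lemma mult_adjoint_rect:
  assumes N: "inbox n r N" and "a \<noteq> 0" "b \<noteq> 0"
  shows "\<exists>c. c \<noteq> 0 \<and> mult_adjoint (scale_sf a (PP N)) (scale_sf b (PP (rect n r))) = scale_sf c (PP (rcompl n r N))"
proof -
  \<comment> \<open>The coefficient at the complement, found by pairing with its Jack function; by
    uniqueness all other coefficients vanish.\<close>
  define c where "c = a * b * \<langle>PP N * PP (rcompl n r N), PP (rect n r)\<rangle> / \<langle>PP (rcompl n r N), PP (rcompl n r N)\<rangle>"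
  have norm: "\<langle>PP (rcompl n r N), PP (rcompl n r N)\<rangle> \<noteq> 0" by (rule norm_PP) simp
  have "c \<noteq> 0" using assms pairing_nonzero[OF N] norm by (simp add: c_def)
  moreover have "mult_adjoint (scale_sf a (PP N)) (scale_sf b (PP (rect n r))) = scale_sf c (PP (rcompl n r N))"
  proof (rule ji_eqI_PP)
    fix A :: "nat multiset" assume A: "0 \<notin># A"
    have "\<langle>mult_adjoint (scale_sf a (PP N)) (scale_sf b (PP (rect n r))), PP A\<rangle> =
        a * b * \<langle>PP N * PP A, PP (rect n r)\<rangle>"
      unfolding ji_mult_adjoint by (simp add: scale_mult_left ji_commute[of "PP (rect n r)"])
    also have "\<dots> = \<langle>scale_sf c (PP (rcompl n r N)), PP A\<rangle>"
    proof (cases "A = rcompl n r N")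
      case True
      then show ?thesis using norm by (simp add: c_def)
    next
      case False
      then have "\<langle>PP N * PP A, PP (rect n r)\<rangle> = 0"
        using pairing_unique[OF N A] by (metis mult.commute)
      then show ?thesis using ji_PP[OF zero_notin_rcompl A] False by simp
    qed
    finally show "\<langle>mult_adjoint (scale_sf a (PP N)) (scale_sf b (PP (rect n r))), PP A\<rangle> =
        \<langle>scale_sf c (PP (rcompl n r N)), PP A\<rangle>" .
  qed
  ultimately show ?thesis by blast
qed

end

section \<open>The rectangular filtration\<close>

lemma mset_hull_compl: "mset (hull_compl lam) = rcompl (length lam) (hd lam) (mset lam)"
  by (simp add: hull_compl_def rect_compl_def rcompl_def multiset.map_comp comp_def)

lemma inbox_hull:
  assumes "is_partition lam" "lam \<noteq> []"
  shows "inbox (length lam) (hd lam) (mset lam)"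
  using assms by (cases lam) (auto simp: inbox_def is_partition_def)

lemma is_partition_hull_compl:
  assumes "is_partition lam"
  shows "is_partition (hull_compl lam)"
proof -
  have "sorted_wrt (\<ge>) (map (\<lambda>x. hd lam - x) (rev lam))"
    using assms by (auto simp: is_partition_def sorted_wrt_map sorted_wrt_rev elim!: sorted_wrt_mono_rel[rotated])
  then show ?thesis
    by (simp add: is_partition_def hull_compl_def rect_compl_def sorted_wrt_filter)
qed

lemma hull_compl_eq: "is_partition lam \<Longrightarrow> hull_compl lam = part_list (rcompl (length lam) (hd lam) (mset lam))"
  using part_list_mset[OF is_partition_hull_compl] mset_hull_compl by metis

lemma rect_hull_eq:
  assumes "is_partition lam" "lam \<noteq> []"
  shows "rect_hull lam = part_list (rect (length lam) (hd lam))"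
proof -
  have "hd lam \<noteq> 0" using assms by (cases lam) (auto simp: is_partition_def)
  then have "mset (rect_hull lam) = rect (length lam) (hd lam)" by (simp add: rect_hull_def rect_def)
  moreover have "is_partition (rect_hull lam)"
    using \<open>hd lam \<noteq> 0\<close> by (simp add: is_partition_def rect_hull_def sorted_wrt_iff_nth_less)
  ultimately show ?thesis using part_list_mset by metis
qed

text \<open>The largest part becomes zero and is dropped, while the other values are reflected
  injectively. As the box has exactly \<open>length lam\<close> rows, no padding adds a
  value.\<close>

lemma card_set_hull_compl:
  assumes "is_partition lam" "lam \<noteq> []"
  shows "card (set lam) = Suc (card (set (hull_compl lam)))"
proof -
  have le: "\<forall>x\<in>set lam. x \<le> hd lam" using inbox_hull[OF assms] by (simp add: inbox_def)
  have "set (hull_compl lam) = (\<lambda>x. hd lam - x) ` (set lam - {hd lam})"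
    using le by (force simp: hull_compl_def rect_compl_def)
  moreover have "inj_on (\<lambda>x. hd lam - x) (set lam - {hd lam})"
    using le by (auto simp: inj_on_def)
  ultimately have "card (set (hull_compl lam)) = card (set lam - {hd lam})" by (simp only: card_image)
  moreover have "Suc (card (set lam - {hd lam})) = card (set lam)"
    by (rule card_Suc_Diff1) (simp_all add: assms(2))
  ultimately show ?thesis by (simp only:)
qed

lemma rect_filtration_rec:
  assumes "is_partition lam" "lam \<noteq> []"
  shows "rect_filtration lam = rect_hull lam # rect_filtration (hull_compl lam)"
proof -
  have "rect_filtration lam = map (\<lambda>i. rect_hull ((hull_compl ^^ i) lam)) (0 # map Suc [0..<card (set (hull_compl lam))])"
    unfolding rect_filtration_def card_set_hull_compl[OF assms] by (simp only: upt_conv_Cons map_Suc_upt zero_less_Suc)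
  also have "\<dots> = rect_hull lam # rect_filtration (hull_compl lam)"
    by (simp add: rect_filtration_def funpow_swap1)
  finally show ?thesis .
qed

text \<open>The inner expression is a multiple of P_\<nu> for the complement \<nu> of
  \<open>lam\<close> in its hull R. Its adjoint applied to Q_R gives the complement of \<nu>, which
  is \<open>lam\<close> again.\<close>

lemma (in jack_family) nested_adjoint_rect_filtration:
  assumes "is_partition lam" "lam \<noteq> []"
  shows "\<exists>c. c \<noteq> 0 \<and> nested_adjoint (map (jack_dual P) (rect_filtration lam)) = scale_sf c (P lam)"
  using assms
proof (induction "card (set lam)" arbitrary: lam rule: less_induct)
  case less
  define n where "n = length lam"
  define r where "r = hd lam"
  define \<nu> where "\<nu> = hull_compl lam"
  have box: "inbox n r (mset lam)" unfolding n_def r_def by (rule inbox_hull[OF less.prems])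
  have lam: "part_list (mset lam) = lam" by (rule part_list_mset[OF less.prems(1)])
  have hull: "rect_hull lam = part_list (rect n r)" unfolding n_def r_def by (rule rect_hull_eq[OF less.prems])
  have \<nu>: "\<nu> = part_list (rcompl n r (mset lam))" unfolding \<nu>_def n_def r_def by (rule hull_compl_eq[OF less.prems(1)])
  have p\<nu>: "is_partition \<nu>" unfolding \<nu>_def by (rule is_partition_hull_compl[OF less.prems(1)])
  define b where "b = inverse \<langle>PP (rect n r), PP (rect n r)\<rangle>"
  have b: "b \<noteq> 0" using norm_PP[OF inboxD(1)[OF inbox_rect]] by (simp add: b_def)
  have dual: "jack_dual P (rect_hull lam) = scale_sf b (PP (rect n r))" by (simp add: jack_dual_def hull b_def)
  show ?case
  proof (cases "\<nu> = []")
    \<comment> \<open>An empty complement means that \<open>lam\<close> is its own hull, so the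
      filtration has length one.\<close>
    case True
    then have "rcompl n r (mset lam) = {#}" using \<nu> by (metis mset_part_list mset.simps(1))
    then have "mset lam = rect n r" using rcompl_rcompl[OF box] by (simp add: rect_eq_rcompl)
    then have "P lam = PP (rect n r)" using lam by simp
    moreover have "rect_filtration lam = [rect_hull lam]"
      using rect_filtration_rec[OF less.prems] True by (simp add: \<nu>_def rect_filtration_def)
    ultimately show ?thesis using b dual by (intro exI[of _ b]) simp
  next
    case False
    have "card (set \<nu>) < card (set lam)" unfolding \<nu>_def card_set_hull_compl[OF less.prems] by simp
    from less.hyps[OF this p\<nu> False] obtain a where
      a: "a \<noteq> 0" "nested_adjoint (map (jack_dual P) (rect_filtration \<nu>)) = scale_sf a (P \<nu>)" by blast
    have "nested_adjoint (map (jack_dual P) (rect_filtration lam)) =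
        mult_adjoint (nested_adjoint (map (jack_dual P) (rect_filtration \<nu>))) (jack_dual P (rect_hull lam))"
      using rect_filtration_rec[OF less.prems] rect_filtration_rec[OF p\<nu> False] by (simp add: \<nu>_def)
    also have "\<dots> = mult_adjoint (scale_sf a (PP (rcompl n r (mset lam)))) (scale_sf b (PP (rect n r)))"
      unfolding a(2) dual by (simp only: \<nu>)
    finally show ?thesis
      using mult_adjoint_rect[OF inbox_rcompl[OF box] a(1) b] by (simp add: rcompl_rcompl[OF box] lam)
  qed
qed

theorem theorem4p21:
  fixes P :: "nat list \<Rightarrow> ratfun symfun" and lam :: "nat list"
  assumes "is_jack_family P"
    and "is_partition lam" and "lam \<noteq> []"
  shows "\<exists>c :: ratfun. c \<noteq> 0 \<and>
    jack_dual P lam = scale_sf c (nested_adjoint (map (jack_dual P) (rect_filtration lam)))"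
proof -
  interpret jack_family P by unfold_locales fact
  obtain c where c: "c \<noteq> 0" "nested_adjoint (map (jack_dual P) (rect_filtration lam)) = scale_sf c (P lam)"
    using nested_adjoint_rect_filtration[OF assms(2,3)] by blast
  have "0 \<notin># mset lam" using assms(2) by (simp add: is_partition_def)
  from norm_PP[OF this] have norm: "\<langle>P lam, P lam\<rangle> \<noteq> 0" by (simp add: part_list_mset[OF assms(2)])
  \<comment> \<open>Both sides are nonzero multiples of \<open>P lam\<close>, by the inverse norm on
    the left and by c in the nested expression; the witness is the quotient.\<close>
  show ?thesis
    by (rule exI[of _ "inverse \<langle>P lam, P lam\<rangle> * inverse c"]) (use c norm in \<open>simp add: jack_dual_def\<close>)
qed

end
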